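(* Let $n\in\mathbb{N}$ with $n\geq 3$, let input pairs $p_0,g_0,\dots,p_{n-1},g_{n-1}$ with arrival times $a:\{p_0,g_0,\dots,p_{n-1},g_{n-1}\}\to\mathbb{N}$ be given, and let $W=\sum_{i=0}^{n-1}\big(2^{a(p_i)}+2^{a(g_i)}\big)$. Set $d_1=8.461$ and $d_2=6.2$ if $n\leq 2^{21}$, and $d_1=9.067$ and $d_2=4.442$ otherwise. Then one can construct in polynomial time an adder circuit $C_n$ on these input pairs with $$\mathrm{del}(C_n)\leq \log_2 W+3\log_2\log_2 n+3\log_2\log_2\log_2 n+d_1\quad\text{and}\quad \mathrm{s}(C_n)\leq d_2\, n\log_2 n.$$
   Context: A circuit over the basis $\{\land,\lor\}$ is a finite acyclic directed graph whose vertices are either inputs (in-degree $0$, each labeled with a distinct Boolean variable or a constant) or gates (each labeled $\land$ or $\lor$ with two ordered predecessors), together with a designated nonempty set of outputs; each vertex computes a Boolean function of the inputs recursively. Given arrival times of the inputs, the arrival time of a gate is the maximum arrival time of its predecessors plus $1$, and the delay $\mathrm{del}$ of a circuit is the maximum arrival time of an output. The size $\mathrm{s}$ is the number of gates. The carry bits of input pairs $p_0,g_0,\dots,p_{n-1},g_{n-1}$ are $c_0=0$ and $c_{i+1}=g_i\lor(p_i\land c_i)$ for $i\in\{0,\dots,n-1\}$. An adder circuit on these input pairs is a circuit over $\{\land,\lor\}$ with inputs $p_0,g_0,\dots,p_{n-1},g_{n-1}$ having, for each $i\in\{1,\dots,n\}$, an output computing $c_i$. *)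

theory Defs
  imports Complex_Main "HOL-Computational_Algebra.Polynomial"
begin

section \<open>Circuits over conjunction and disjunction\<close>

text \<open>
  The vertices of a circuit are numbered by their position in the list of nodes; a gate
  names its two ordered predecessors. The list need not be in topological order.
\<close>

datatype 'x node = Input 'x | Constant bool | AndGate nat nat | OrGate nat nat

datatype 'x circuit = Circuit (nodes: "'x node list") (outputs: "nat list")

fun preds :: "'x node \<Rightarrow> nat set" where
  "preds (Input x) = {}"
| "preds (Constant b) = {}"
| "preds (AndGate u w) = {u, w}"
| "preds (OrGate u w) = {u, w}"

fun is_gate :: "'x node \<Rightarrow> bool" where
  "is_gate (Input x) = False"
| "is_gate (Constant b) = False"
| "is_gate (AndGate u w) = True"
| "is_gate (OrGate u w) = True"

definition verts :: "'x circuit \<Rightarrow> nat set" where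
  "verts C = {..<length (nodes C)}"

definition edges :: "'x circuit \<Rightarrow> (nat \<times> nat) set" where
  "edges C = {(u, v). v \<in> verts C \<and> u \<in> preds (nodes C ! v)}"

definition wf_circuit :: "'x circuit \<Rightarrow> bool" where
  "wf_circuit C \<longleftrightarrow>
     edges C \<subseteq> verts C \<times> verts C \<and> acyclic (edges C) \<and>
     outputs C \<noteq> [] \<and> set (outputs C) \<subseteq> verts C \<and>
     (\<forall>u\<in>verts C. \<forall>v\<in>verts C. \<forall>x. nodes C ! u = Input x \<and> nodes C ! v = Input x \<longrightarrow> u = v)"

text \<open>
  The two recursions below run along the edge relation, which is well-founded for a well-formed
  circuit; the recursion equations are \<open>value_rec\<close> and \<open>arrival_rec\<close>.
\<close>

definition vertex_value :: "'x circuit \<Rightarrow> ('x \<Rightarrow> bool) \<Rightarrow> nat \<Rightarrow> bool" where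
  "vertex_value C x = wfrec (edges C) (\<lambda>f v. case nodes C ! v of
       Input y \<Rightarrow> x y
     | Constant b \<Rightarrow> b
     | AndGate u w \<Rightarrow> f u \<and> f w
     | OrGate u w \<Rightarrow> f u \<or> f w)"

text \<open>Arrival times are given on the variables; constants are available at time 0.\<close>

definition arrival :: "'x circuit \<Rightarrow> ('x \<Rightarrow> nat) \<Rightarrow> nat \<Rightarrow> nat" where
  "arrival C a = wfrec (edges C) (\<lambda>f v. case nodes C ! v of
       Input y \<Rightarrow> a y
     | Constant b \<Rightarrow> 0
     | AndGate u w \<Rightarrow> max (f u) (f w) + 1
     | OrGate u w \<Rightarrow> max (f u) (f w) + 1)"

definition delay :: "'x circuit \<Rightarrow> ('x \<Rightarrow> nat) \<Rightarrow> nat" where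
  "delay C a = Max (arrival C a ` set (outputs C))"

definition circuit_size :: "'x circuit \<Rightarrow> nat" where
  "circuit_size C = card {v \<in> verts C. is_gate (nodes C ! v)}"

lemma wf_edges:
  assumes "wf_circuit C"
  shows "wf (edges C)"
proof -
  have "finite (edges C)"
    using assms unfolding wf_circuit_def verts_def by (meson finite_SigmaI finite_lessThan finite_subset)
  then show ?thesis
    using assms by (simp add: finite_acyclic_wf wf_circuit_def)
qed

lemma value_rec:
  assumes "wf_circuit C" "v \<in> verts C"
  shows "vertex_value C x v = (case nodes C ! v of
       Input y \<Rightarrow> x y
     | Constant b \<Rightarrow> b
     | AndGate u w \<Rightarrow> vertex_value C x u \<and> vertex_value C x w
     | OrGate u w \<Rightarrow> vertex_value C x u \<or> vertex_value C x w)"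
  unfolding vertex_value_def
  by (subst wfrec[OF wf_edges[OF assms(1)]])
     (use assms(2) in \<open>auto split: node.split simp: cut_def edges_def\<close>)

lemma arrival_rec:
  assumes "wf_circuit C" "v \<in> verts C"
  shows "arrival C a v = (case nodes C ! v of
       Input y \<Rightarrow> a y
     | Constant b \<Rightarrow> 0
     | AndGate u w \<Rightarrow> max (arrival C a u) (arrival C a w) + 1
     | OrGate u w \<Rightarrow> max (arrival C a u) (arrival C a w) + 1)"
  unfolding arrival_def
  by (subst wfrec[OF wf_edges[OF assms(1)]])
     (use assms(2) in \<open>auto split: node.split simp: cut_def edges_def\<close>)


section \<open>Adder circuits\<close>

text \<open>\<open>P i\<close> and \<open>G i\<close> are the two variables of the \<open>i\<close>-th input pair.\<close>

datatype signal = P nat | G nat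

definition signals :: "nat \<Rightarrow> signal set" where
  "signals n = P ` {..<n} \<union> G ` {..<n}"

fun carry :: "(signal \<Rightarrow> bool) \<Rightarrow> nat \<Rightarrow> bool" where
  "carry x 0 = False"
| "carry x (Suc i) = (x (G i) \<or> (x (P i) \<and> carry x i))"

text \<open>
  The inputs of an adder circuit are exactly the \<open>2 n\<close> variables of the input pairs; in
  particular there are no constant inputs.
\<close>

definition adder_circuit :: "nat \<Rightarrow> signal circuit \<Rightarrow> bool" where
  "adder_circuit n C \<longleftrightarrow>
     wf_circuit C \<and>
     {z \<in> set (nodes C). \<not> is_gate z} = Input ` signals n \<and>
     (\<forall>i\<in>{1..n}. \<exists>v\<in>set (outputs C). \<forall>x. vertex_value C x v = carry x i)"


section \<open>Polynomial-time computation\<close>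

text \<open>
  The machine model is first-order pure Lisp: call-by-value programs of mutually recursive
  functions over binary trees, charged one unit per evaluation step. Every step is a constant
  number of pointer operations (for a fixed program), so that polynomial time in this model
  coincides with polynomial time on Turing machines, given that the output is of polynomial
  size. The latter is demanded separately, because trees are shared in memory.
\<close>

datatype data = Atom | Pair data data

text \<open>
  \<open>Var i\<close> is the \<open>i\<close>-th argument of the function being evaluated, and \<open>Call f es\<close> calls the
  \<open>f\<close>-th function of the program. The only test is whether a tree is \<open>Atom\<close>.
\<close>

datatype expr =
    Var nat
  | EAtom
  | EPair expr expr
  | Left expr
  | Right expr
  | IfAtom expr expr expr
  | Call nat "expr list"

type_synonym program = "expr list"

fun left :: "data \<Rightarrow> data" where
  "left Atom = Atom"
| "left (Pair d e) = d"

fun right :: "data \<Rightarrow> data" where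
  "right Atom = Atom"
| "right (Pair d e) = e"

text \<open>\<open>eval Q env e d t\<close>: in program \<open>Q\<close>, with arguments \<open>env\<close>, \<open>e\<close> evaluates to \<open>d\<close> in time \<open>t\<close>.\<close>

inductive eval :: "program \<Rightarrow> data list \<Rightarrow> expr \<Rightarrow> data \<Rightarrow> nat \<Rightarrow> bool"
  and evals :: "program \<Rightarrow> data list \<Rightarrow> expr list \<Rightarrow> data list \<Rightarrow> nat \<Rightarrow> bool"
  for Q :: program
where
  eval_Var: "i < length env \<Longrightarrow> eval Q env (Var i) (env ! i) 1"
| eval_Atom: "eval Q env EAtom Atom 1"
| eval_Pair: "eval Q env e1 d1 t1 \<Longrightarrow> eval Q env e2 d2 t2 \<Longrightarrow>
    eval Q env (EPair e1 e2) (Pair d1 d2) (t1 + t2 + 1)"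
| eval_Left: "eval Q env e d t \<Longrightarrow> eval Q env (Left e) (left d) (t + 1)"
| eval_Right: "eval Q env e d t \<Longrightarrow> eval Q env (Right e) (right d) (t + 1)"
| eval_If_True: "eval Q env e Atom t \<Longrightarrow> eval Q env e1 d t' \<Longrightarrow>
    eval Q env (IfAtom e e1 e2) d (t + t' + 1)"
| eval_If_False: "eval Q env e (Pair d1 d2) t \<Longrightarrow> eval Q env e2 d t' \<Longrightarrow>
    eval Q env (IfAtom e e1 e2) d (t + t' + 1)"
| eval_Call: "evals Q env es ds t \<Longrightarrow> f < length Q \<Longrightarrow> eval Q ds (Q ! f) d t' \<Longrightarrow>
    eval Q env (Call f es) d (t + t' + 1)"
| evals_Nil: "evals Q env [] [] 1"
| evals_Cons: "eval Q env e d t \<Longrightarrow> evals Q env es ds t' \<Longrightarrow>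
    evals Q env (e # es) (d # ds) (t + t' + 1)"

lemma eval_deterministic:
  "eval Q env e d t \<Longrightarrow> eval Q env e d' t' \<Longrightarrow> d' = d \<and> t' = t"
  "evals Q env es ds t \<Longrightarrow> evals Q env es ds' t' \<Longrightarrow> ds' = ds \<and> t' = t"
proof (induction arbitrary: d' t' and ds' t' rule: eval_evals.inducts)
  case (eval_Var i env) from eval_Var.prems eval_Var.hyps show ?case by cases auto
next
  case (eval_Atom env) then show ?case by cases auto
next
  case (eval_Pair env e1 d1 t1 e2 d2 t2) from eval_Pair.prems eval_Pair.IH show ?case by cases blast
next
  case (eval_Left env e d t) from eval_Left.prems eval_Left.IH show ?case by cases blast
next
  case (eval_Right env e d t) from eval_Right.prems eval_Right.IH show ?case by cases blast
next
  case (eval_If_True env e t e1 d t1 e2) from eval_If_True.prems eval_If_True.IH show ?case by cases blast+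
next
  case (eval_If_False env e d1 d2 t e2 d t1 e1) from eval_If_False.prems eval_If_False.IH show ?case by cases blast+
next
  case (eval_Call env es ds t f d t1) from eval_Call.prems eval_Call.IH show ?case by cases blast
next
  case (evals_Nil env) then show ?case by cases auto
next
  case (evals_Cons env e d t es ds t1) from evals_Cons.prems evals_Cons.IH show ?case by cases blast
qed

text \<open>
  \<open>constructible_in_poly_time D enc enc' R\<close>: one program and one polynomial serve all instances
  \<open>x \<in> D\<close>; started on the code of \<open>x\<close>, the main function (number 0) returns the code of some \<open>y\<close>
  that is related to \<open>x\<close> by \<open>R\<close>. The \<open>size\<close> of a tree is its number of \<open>Pair\<close> nodes.
\<close>

definition constructible_in_poly_time ::
  "'i set \<Rightarrow> ('i \<Rightarrow> data) \<Rightarrow> ('o \<Rightarrow> data) \<Rightarrow> ('i \<Rightarrow> 'o \<Rightarrow> bool) \<Rightarrow> bool" where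
  "constructible_in_poly_time D enc enc' R \<longleftrightarrow>
     (\<exists>(Q :: program) (q :: nat poly). \<forall>x\<in>D. \<exists>y t.
        R x y \<and>
        eval Q [enc x] (Call 0 [Var 0]) (enc' y) t \<and>
        t + size (enc' y) \<le> poly q (size (enc x)))"


section \<open>Encodings\<close>

fun enc_bool :: "bool \<Rightarrow> data" where
  "enc_bool False = Atom"
| "enc_bool True = Pair Atom Atom"

fun enc_list :: "data list \<Rightarrow> data" where
  "enc_list [] = Atom"
| "enc_list (d # ds) = Pair d (enc_list ds)"

text \<open>Numbers are in binary, least significant bit first.\<close>

fun enc_nat :: "nat \<Rightarrow> data" where
  "enc_nat m = (if m = 0 then Atom else Pair (enc_bool (odd m)) (enc_nat (m div 2)))"

declare enc_nat.simps [simp del]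

text \<open>The number \<open>n\<close> of input pairs is encoded as the length of the list of arrival times.\<close>

fun enc_instance :: "nat \<times> (signal \<Rightarrow> nat) \<Rightarrow> data" where
  "enc_instance (n, a) =
     enc_list (map (\<lambda>i. Pair (enc_nat (a (P i))) (enc_nat (a (G i)))) [0..<n])"

fun enc_node :: "signal node \<Rightarrow> data" where
  "enc_node (Input (P i)) = Pair (enc_nat 0) (enc_nat i)"
| "enc_node (Input (G i)) = Pair (enc_nat 1) (enc_nat i)"
| "enc_node (Constant b) = Pair (enc_nat 2) (enc_bool b)"
| "enc_node (AndGate u w) = Pair (enc_nat 3) (Pair (enc_nat u) (enc_nat w))"
| "enc_node (OrGate u w) = Pair (enc_nat 4) (Pair (enc_nat u) (enc_nat w))"

definition enc_circuit :: "signal circuit \<Rightarrow> data" where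
  "enc_circuit C =
     Pair (enc_list (map enc_node (nodes C))) (enc_list (map enc_nat (outputs C)))"

lemma enc_bool_eq_iff [simp]: "enc_bool b = enc_bool c \<longleftrightarrow> b = c"
  by (cases b; cases c) auto

lemma enc_list_eq_iff [simp]: "enc_list xs = enc_list ys \<longleftrightarrow> xs = ys"
proof (induction xs arbitrary: ys)
  case Nil then show ?case by (cases ys) auto
next
  case (Cons d ds) then show ?case by (cases ys) auto
qed

lemma enc_nat_eq_iff [simp]: "enc_nat m = enc_nat k \<longleftrightarrow> m = k"
proof (induction m arbitrary: k rule: less_induct)
  case (less m)
  show ?case
  proof
    assume eq: "enc_nat m = enc_nat k"
    show "m = k"
    proof (cases "m = 0 \<or> k = 0")
      case True
      then show ?thesis using eq by (auto simp: enc_nat.simps split: if_splits)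
    next
      case False
      then have "odd m = odd k" "enc_nat (m div 2) = enc_nat (k div 2)"
        using eq by (simp_all add: enc_nat.simps[of m] enc_nat.simps[of k])
      then have "odd m = odd k" "m div 2 = k div 2"
        using less[of "m div 2" "k div 2"] False by auto
      then show ?thesis by presburger
    qed
  qed simp
qed

lemma enc_node_eq_iff [simp]: "enc_node z = enc_node z' \<longleftrightarrow> z = z'"
  by (cases z rule: enc_node.cases; cases z' rule: enc_node.cases) auto

lemma inj_enc_circuit: "inj enc_circuit"
  by (auto intro!: injI circuit.expand simp: enc_circuit_def inj_map_eq_map inj_def)

end

theory Submission imports Defs
begin

text \<open>
  The inputs are cut into blocks of about \<open>log n\<close> pairs. Inside the blocks, Kogge-Stone doubling
  computes all carries with two levels per step. Across the blocks, carries are alternating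
  disjunctions and conjunctions of block generate and propagate signals; they are first formed on
  the dyadic (Fenwick) intervals \<open>[b - low b, b)\<close> and then on the chain of those intervals that
  covers \<open>[0, b)\<close>, so that the formulas to be realised have \<open>O(n)\<close> literals in total.

  An alternating formula is built by recursion: \<open>\<and>\<close> and \<open>\<or>\<close> being idempotent, the alternating
  formula of \<open>u @ y # r\<close> splits into that of \<open>u\<close> and that of \<open>r\<close>, where the latter also absorbs
  every second literal of \<open>u\<close>. Delays are controlled by weights \<open>2 ^ e\<close>, as in Huffman coding:
  pending literals are collected in a binary counter, and each level of the recursion halves a
  budget that bounds a weighted sum of the weights. The delay is then the logarithm of the total
  weight plus the logarithm of the number of levels. The doubling contributes \<open>2 log log n\<close>, the
  dyadic intervals (\<open>O(log n)\<close> levels) another \<open>log log n\<close>, and the chains, having only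
  \<open>O(log n)\<close> items and hence \<open>O(log log n)\<close> levels, a term \<open>log log log n\<close>.

  Polynomial time is treated as a predicate on functions between encoded types, which is closed
  under composition, pairing, case distinction and recursion along a polynomially bounded measure.
\<close>

section \<open>Alternating formulas\<close>

text \<open>The invariant shapes everything. A cut must give each half at most \<open>2 ^ d\<close>:
  the left half is filled greedily, and the overflow at which it stops proves that the rest is
  small. The literals used twice are paid for by the coefficient \<open>2 * (d + 1)\<close>, which
  falls by 2 per level. With exponent \<open>K\<close> the recursion thus accepts items of total
  weight \<open>2 ^ K / (4 * (K + 1))\<close>. Weights are halved until they meet this and the
  result is scaled back, which multiplies the total weight by at most
  \<open>64 / 7 * (K + 1)\<close> up to an additive \<open>2 ^ K\<close>; the 8/7 in it is the price
  of rounding up. Doing this for intervals and then for chains gives the factor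
  \<open>(64 / 7) ^ 2 < 85\<close> together with \<open>lg n + 8\<close> and
  \<open>2 * lam n + 8\<close>. The logarithms of these, \<open>2 * lam n\<close> levels inside the
  blocks and two final gates make up the delay. The block length settles the size: about
  \<open>n / log n\<close> boundaries, intervals of \<open>log n / 2\<close> items on average and
  \<open>log n\<close> gates per item stay within order \<open>n * log n\<close>, while doubling
  costs \<open>3 * n\<close> gates for each of only about \<open>log log n\<close> steps.\<close>

text \<open>\<open>True\<close> stands for conjunction, \<open>False\<close> for disjunction.\<close>

datatype fm = Lf nat | Op bool fm fm

fun opb :: "bool \<Rightarrow> bool \<Rightarrow> bool \<Rightarrow> bool" where
  "opb True x y = (x \<and> y)" | "opb False x y = (x \<or> y)"

fun fval :: "(nat \<Rightarrow> bool) \<Rightarrow> fm \<Rightarrow> bool" where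
  "fval r (Lf v) = r v"
| "fval r (Op b A B) = opb b (fval r A) (fval r B)"

fun farr :: "(nat \<Rightarrow> int) \<Rightarrow> fm \<Rightarrow> int" where
  "farr r (Lf v) = r v"
| "farr r (Op b A B) = max (farr r A) (farr r B) + 1"

fun gates :: "fm \<Rightarrow> nat" where
  "gates (Lf v) = 0"
| "gates (Op b A B) = gates A + gates B + 1"

fun fvars :: "fm \<Rightarrow> nat set" where
  "fvars (Lf v) = {v}"
| "fvars (Op b A B) = fvars A \<union> fvars B"

text \<open>The value on the empty list is the neutral element of the preceding operator
  \<open>\<not> c\<close>, so that a last literal stands alone.\<close>

fun altv :: "bool \<Rightarrow> bool list \<Rightarrow> bool" where
  "altv c [] = (\<not> c)"
| "altv c (x # r) = opb c x (altv (\<not> c) r)"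

text \<open>Known as an extended AND-OR path: the literals \<open>S\<close> are symmetric, all
  joined by the first operator, and the alternation of \<open>t\<close> starts with the other
  one.\<close>

definition ext :: "bool \<Rightarrow> bool list \<Rightarrow> bool list \<Rightarrow> bool" where
  "ext b S t = foldr (opb b) S (altv (\<not> b) t)"

fun evens :: "'a list \<Rightarrow> 'a list" where
  "evens (x # y # r) = x # evens r"
| "evens [x] = [x]"
| "evens [] = []"

lemma opb_simps: "opb b x y = (if b then x \<and> y else x \<or> y)"
  by (cases b) auto

lemma foldr_opb: "foldr (opb b) S z = (if b then False \<notin> set S \<and> z else True \<in> set S \<or> z)"
  by (induction S) (auto simp: opb_simps)

lemma foldr_opb_init: "foldr (opb b) xs (opb b y z) = opb b z (foldr (opb b) xs y)"
  unfolding foldr_opb by (auto simp: opb_simps)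

text \<open>By idempotence every second literal of \<open>u\<close> may be used twice; this keeps the operators of both parts aligned.\<close>

lemma altv_split:
  "even (length u) \<Longrightarrow> altv (\<not> b) (u @ y # r) =
     opb b (altv (\<not> b) u) (foldr (opb (\<not> b)) (evens u @ [y]) (altv b r))"
  by (induction u rule: evens.induct) (auto simp: opb_simps foldr_opb)

text \<open>The reused literals \<open>evens u\<close> and the splitting literal \<open>y\<close>
  are all joined by \<open>\<not> b\<close> at the head of the right part; hence they become its
  symmetric literals.\<close>

lemma ext_split:
  assumes "even (length u)"
  shows "ext b S (u @ y # r) = opb b (ext b S u) (ext (\<not> b) (evens u @ [y]) r)"
  using altv_split[OF assms, of b y r] unfolding ext_def by (auto simp: foldr_opb opb_simps)

section \<open>Weights and the binary counter of pending formulas\<close>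

definition wsum :: "('a \<times> nat) list \<Rightarrow> nat" where
  "wsum t = sum_list (map snd t)"

lemma wsum_simps [simp]: "wsum [] = 0" "wsum (x # t) = snd x + wsum t" "wsum (s @ t) = wsum s + wsum t"
  by (auto simp: wsum_def)

lemma wsum_evens: "wsum (evens u) \<le> wsum u"
  by (induction u rule: evens.induct) auto

lemma length_evens: "even (length u) \<Longrightarrow> 2 * length (evens u) = length u"
  by (induction u rule: evens.induct) auto

lemma set_evens: "set (evens u) \<subseteq> set u"
  by (induction u rule: evens.induct) auto

lemma map_evens: "map f (evens u) = evens (map f u)"
  by (induction u rule: evens.induct) auto

text \<open>A time bound \<open>e + c\<close> of a signal is recorded as the weight \<open>2 ^ e\<close>.\<close>

definition timed :: "int \<Rightarrow> int \<Rightarrow> nat \<Rightarrow> bool" where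
  "timed c x w \<longleftrightarrow> (\<exists>e. w = 2 ^ e \<and> x \<le> int e + c)"

text \<open>Binary addition: entries of equal weight are joined by a gate and carried to the double
  weight, which raises the time bound by exactly the one level spent.\<close>

fun ins :: "bool \<Rightarrow> fm \<Rightarrow> nat \<Rightarrow> (fm \<times> nat) list \<Rightarrow> (fm \<times> nat) list" where
  "ins b f w [] = [(f, w)]"
| "ins b f w (gv # S) =
     (if w < snd gv then (f, w) # gv # S
      else if w = snd gv then ins b (Op b f (fst gv)) (w + w) S
      else gv # ins b f w S)"

fun insall :: "bool \<Rightarrow> (nat \<times> nat) list \<Rightarrow> (fm \<times> nat) list" where
  "insall b [] = []"
| "insall b (x # t) = ins b (Lf (fst x)) (snd x) (insall b t)"

text \<open>The accumulator runs from the lightest entry to the heavier ones, so that each new level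
  is covered by the next larger power of two.\<close>

fun chn :: "bool \<Rightarrow> fm \<Rightarrow> (fm \<times> nat) list \<Rightarrow> fm" where
  "chn b f [] = f"
| "chn b f (g # S) = chn b (Op b f (fst g)) S"

definition leaves :: "(fm \<times> nat) list \<Rightarrow> nat" where
  "leaves S = sum_list (map (\<lambda>x. gates (fst x) + 1) S)"

lemma leaves_simps [simp]: "leaves [] = 0" "leaves (x # S) = gates (fst x) + 1 + leaves S"
  "leaves (S @ S') = leaves S + leaves S'"
  by (auto simp: leaves_def)

definition counter :: "(nat \<Rightarrow> int) \<Rightarrow> int \<Rightarrow> nat set \<Rightarrow> (fm \<times> nat) list \<Rightarrow> bool" where
  "counter r c V S \<longleftrightarrow> sorted_wrt (<) (map snd S) \<and>
     (\<forall>x\<in>set S. timed c (farr r (fst x)) (snd x) \<and> fvars (fst x) \<subseteq> V)"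

lemma counter_Nil [simp]: "counter r c V []"
  by (simp add: counter_def)

lemma counter_Cons: "counter r c V (x # S) \<longleftrightarrow>
   (\<forall>y\<in>set S. snd x < snd y) \<and> timed c (farr r (fst x)) (snd x) \<and> fvars (fst x) \<subseteq> V \<and> counter r c V S"
  by (auto simp: counter_def)

lemma timed_Op: "timed c (farr r f) w \<Longrightarrow> timed c (farr r g) w \<Longrightarrow> timed c (farr r (Op b f g)) (w + w)"
  unfolding timed_def
proof (elim exE conjE)
  fix e e' assume "w = 2 ^ e" "farr r f \<le> int e + c" "w = 2 ^ e'" "farr r g \<le> int e' + c"
  then show "\<exists>e. w + w = 2 ^ e \<and> farr r (Op b f g) \<le> int e + c"
    by (intro exI[of _ "Suc e"]) auto
qed

lemma power2_less: "(2::nat) ^ a < 2 ^ b \<Longrightarrow> 2 * 2 ^ a \<le> (2::nat) ^ b"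
  by (metis Suc_leI nat_power_less_imp_less pos2 power_Suc power_increasing one_le_numeral)

lemma wsum_ins: "wsum (ins b f w S) = w + wsum S"
  by (induction b f w S rule: ins.induct) auto

lemma leaves_ins: "leaves (ins b f w S) = gates f + 1 + leaves S"
  by (induction b f w S rule: ins.induct) auto

lemma ins_ge: "x \<in> set (ins b f w S) \<Longrightarrow> snd x \<ge> w \<or> x \<in> set S"
  by (induction b f w S rule: ins.induct) (auto split: if_splits)

lemma ins_gt: "(\<forall>y\<in>set S. k < snd y) \<Longrightarrow> k < w \<Longrightarrow> x \<in> set (ins b f w S) \<Longrightarrow> k < snd x"
  using ins_ge[of x b f w S] by force

lemma counter_ins:
  "counter r c V S \<Longrightarrow> timed c (farr r f) w \<Longrightarrow> fvars f \<subseteq> V \<Longrightarrow> counter r c V (ins b f w S)"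
proof (induction b f w S rule: ins.induct)
  case (1 b f w)
  then show ?case by (auto simp: counter_Cons)
next
  case (2 b f w gv S)
  consider "w < snd gv" | "w = snd gv" | "w > snd gv" by linarith
  then show ?case
  proof cases
    case 1
    then show ?thesis using 2 by (auto simp: counter_Cons)
  next
    case 2
    have "timed c (farr r (Op b f (fst gv))) (w + w)"
      using "2.prems" 2 by (intro timed_Op) (auto simp: counter_Cons)
    then show ?thesis using 2 "2.IH" "2.prems" by (auto simp: counter_Cons)
  next
    case 3
    then show ?thesis using 2 by (auto simp: counter_Cons dest: ins_gt[of _ "snd gv"])
  qed
qed

definition sval :: "(nat \<Rightarrow> bool) \<Rightarrow> (fm \<times> nat) list \<Rightarrow> bool list" where
  "sval r S = map (\<lambda>x. fval r (fst x)) S"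

lemma sval_simps [simp]: "sval r [] = []" "sval r (x # S) = fval r (fst x) # sval r S"
  "sval r (S @ S') = sval r S @ sval r S'"
  by (auto simp: sval_def)

lemma foldr_ins: "foldr (opb b) (sval r (ins b f w S)) z = opb b (fval r f) (foldr (opb b) (sval r S) z)"
  by (induction b f w S rule: ins.induct) (auto simp: sval_def opb_simps)

lemma ins_nonempty [simp]: "ins b f w S \<noteq> []"
  by (induction b f w S rule: ins.induct) auto

lemma insall_empty [simp]: "insall b t = [] \<longleftrightarrow> t = []"
  by (cases t) auto

lemma wsum_insall: "wsum (insall b t) = wsum t"
  by (induction t) (auto simp: wsum_ins)

lemma leaves_insall: "leaves (insall b t) = length t"
  by (induction t) (auto simp: leaves_ins)

lemma counter_insall:
  "\<forall>x\<in>set t. timed c (r (fst x)) (snd x) \<and> fst x \<in> V \<Longrightarrow> counter r c V (insall b t)"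
  by (induction t) (auto intro!: counter_ins)

lemma foldr_insall: "foldr (opb b) (sval r (insall b t)) z = foldr (opb b) (map (\<lambda>x. r (fst x)) t) z"
  by (induction t) (simp_all add: foldr_ins)

lemma fval_chn: "fval r (chn b f S) = foldr (opb b) (sval r S) (fval r f)"
proof (induction b f S rule: chn.induct)
  case (2 b f g S)
  then show ?case by (simp add: foldr_opb_init)
qed simp

lemma gates_chn: "gates (chn b f S) = gates f + leaves S"
  by (induction b f S rule: chn.induct) auto

lemma fvars_chn: "fvars (chn b f S) = fvars f \<union> (\<Union>x\<in>set S. fvars (fst x))"
  by (induction b f S rule: chn.induct) auto

text \<open>After an entry of weight \<open>2 ^ e\<close> has been joined, the accumulator is ready
  by \<open>e + 1 + c\<close>, and strictly increasing exponents allow at least that much for the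
  next entry.\<close>

lemma farr_chn:
  "counter r c V S \<Longrightarrow> \<forall>x\<in>set S. \<forall>e. snd x = 2 ^ e \<longrightarrow> farr r f \<le> int e + c \<and> e < d \<Longrightarrow>
   farr r f \<le> int d + c \<Longrightarrow> farr r (chn b f S) \<le> int d + c"
proof (induction b f S rule: chn.induct)
  case (2 b f g S)
  from 2(2) obtain e where e: "snd g = 2 ^ e" "farr r (fst g) \<le> int e + c"
    by (auto simp: counter_Cons timed_def)
  have "farr r f \<le> int e + c" "e < d" using 2(3) e by auto
  moreover have "e < e'" if "x \<in> set S" "snd x = 2 ^ e'" for x e'
    using 2(2) that e by (auto simp: counter_Cons)
  ultimately show ?case
    using e 2(2,3) by (simp, intro 2(1)) (force simp: counter_Cons)+
qed simp

text \<open>The largest of distinct powers below \<open>2 ^ d\<close> is at most half of it, and by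
  induction it exceeds the sum of all the others.\<close>

lemma sorted_powers_sum:
  assumes "sorted_wrt (<) (map snd S)" "\<forall>x\<in>set S. timed c (g x) (snd x)" "\<forall>x\<in>set S. snd x < p"
    "p = 2 ^ d"
  shows "wsum S < p"
  using assms
proof (induction S arbitrary: p d rule: rev_induct)
  case Nil then show ?case by simp
next
  case (snoc x S)
  obtain e where e: "snd x = 2 ^ e" using snoc.prems by (auto simp: timed_def)
  have "wsum S < snd x"
    by (rule snoc.IH[of _ e]) (use snoc.prems e in \<open>auto simp: sorted_wrt_append\<close>)
  moreover have "2 * snd x \<le> p" using snoc.prems e power2_less by auto
  ultimately show ?case by simp
qed

text \<open>The lightest entry has positive weight, so every other weight is strictly below
  \<open>2 ^ d\<close>, which leaves room for the gate that joins it.\<close>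

lemma counter_chn:
  assumes "counter r c V S" "S \<noteq> []" "wsum S \<le> 2 ^ d"
  shows "farr r (chn b (fst (hd S)) (tl S)) \<le> int d + c"
proof -
  obtain x S' where S: "S = x # S'" using assms by (cases S) auto
  obtain e where e: "snd x = 2 ^ e" "farr r (fst x) \<le> int e + c"
    using assms(1) by (auto simp: S counter_Cons timed_def)
  have "(2::nat) ^ e \<le> 2 ^ d" using assms(3) e(1) unfolding S wsum_simps by linarith
  then have ed: "e \<le> d" by simp
  have "e < e' \<and> e' < d" if y: "y \<in> set S'" "snd y = 2 ^ e'" for y e'
  proof -
    have "snd y \<le> wsum S'" using y(1) unfolding wsum_def by (simp add: member_le_sum_list)
    then have "2 ^ e' < (2::nat) ^ d" using assms(3) e(1) y(2) zero_less_power[of "2::nat" e]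
      unfolding S wsum_simps by linarith
    then have "e' < d" by simp
    moreover have "e < e'" using assms(1) y e(1) by (auto simp: S counter_Cons)
    ultimately show ?thesis by simp
  qed
  then show ?thesis unfolding S using assms(1) e ed
    by (simp add: S counter_Cons, intro farr_chn[where V = V]) (force simp: counter_Cons)+
qed

section \<open>The recursive construction of alternating formulas\<close>

fun cut :: "nat \<Rightarrow> nat \<Rightarrow> nat \<Rightarrow> (nat \<times> nat) list \<Rightarrow> (nat \<times> nat) list \<times> (nat \<times> nat) list" where
  "cut c p m (x # y # z # t) =
     (if m + c * snd x + 2 * snd y \<le> p
      then let r = cut c p (m + c * (snd x + snd y)) (z # t) in (x # y # fst r, snd r)
      else ([], x # y # z # t))"
| "cut c p m [] = ([], [])"
| "cut c p m [x] = ([], [x])"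
| "cut c p m [x, y] = ([], [x, y])"

text \<open>The last two facts bracket the greedy choice: what was taken fits into \<open>p\<close>,
  its last literal being charged twice only, and two more literals would overflow. Literals are
  taken in pairs to keep \<open>u\<close> even, and at least one is left to serve as the splitting
  literal.\<close>

lemma cut_correct:
  assumes "cut c p m t = (u, z)"
  shows "t = u @ z" "even (length u)" "t \<noteq> [] \<Longrightarrow> z \<noteq> []"
    "u \<noteq> [] \<Longrightarrow> m + c * wsum (butlast u) + 2 * snd (last u) \<le> p"
    "length z \<ge> 3 \<Longrightarrow> p < m + c * wsum u + c * snd (z ! 0) + 2 * snd (z ! 1)"
proof -
  have "t = fst (cut c p m t) @ snd (cut c p m t) \<and> even (length (fst (cut c p m t))) \<and>
    (t \<noteq> [] \<longrightarrow> snd (cut c p m t) \<noteq> []) \<and>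
    (fst (cut c p m t) \<noteq> [] \<longrightarrow>
       m + c * wsum (butlast (fst (cut c p m t))) + 2 * snd (last (fst (cut c p m t))) \<le> p) \<and>
    (length (snd (cut c p m t)) \<ge> 3 \<longrightarrow>
       p < m + c * wsum (fst (cut c p m t)) + c * snd (snd (cut c p m t) ! 0) + 2 * snd (snd (cut c p m t) ! 1))"
    by (induction c p m t rule: cut.induct) (auto simp: Let_def algebra_simps)
  note this[unfolded assms fst_conv snd_conv]
  then show "t = u @ z" "even (length u)" "t \<noteq> [] \<Longrightarrow> z \<noteq> []"
    "u \<noteq> [] \<Longrightarrow> m + c * wsum (butlast u) + 2 * snd (last u) \<le> p"
    "length z \<ge> 3 \<Longrightarrow> p < m + c * wsum u + c * snd (z ! 0) + 2 * snd (z ! 1)"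
    by auto
qed

text \<open>
  A state is the operator to start with, the powers of two that are still available as budgets, the
  counter of formulas to be combined by this operator, and the remaining alternating literals.
  Carrying the list of powers avoids any exponentiation in the construction.
\<close>

type_synonym pstate = "bool \<times> nat list \<times> (fm \<times> nat) list \<times> (nat \<times> nat) list"

text \<open>An entry that fills the sub-budget \<open>hd ps\<close> alone, next to further entries,
  would overflow the left half of any cut; it is detached by a gate of its own.\<close>

definition peel :: "pstate \<Rightarrow> bool" where
  "peel = (\<lambda>(b, ps, S, t). S \<noteq> [] \<and> butlast S \<noteq> [] \<and> snd (last S) = hd ps)"

definition pcut :: "pstate \<Rightarrow> (nat \<times> nat) list \<times> (nat \<times> nat) list" where
  "pcut = (\<lambda>(b, ps, S, t). cut (2 * length ps) (hd ps) (wsum S) t)"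

text \<open>When peeling, the detached entry is passed on as a state without budgets and literals,
  which \<open>build\<close> returns unchanged. So both kinds of step are the same binary
  recursion.\<close>

definition lsub :: "pstate \<Rightarrow> pstate" where
  "lsub x = (case x of (b, ps, S, t) \<Rightarrow>
     if peel x then (b, [], [last S], []) else (b, tl ps, S, fst (pcut x)))"

definition rsub :: "pstate \<Rightarrow> pstate" where
  "rsub x = (case x of (b, ps, S, t) \<Rightarrow>
     if peel x then (b, tl ps, butlast S, t)
     else (\<not> b, tl ps, insall (\<not> b) (evens (fst (pcut x)) @ [hd (snd (pcut x))]), tl (snd (pcut x))))"

definition pbase :: "pstate \<Rightarrow> bool" where
  "pbase = (\<lambda>(b, ps, S, t). ps = [] \<or> t = [] \<or> tl t = [])"

definition pend :: "pstate \<Rightarrow> fm" where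
  "pend = (\<lambda>(b, ps, S, t).
     let S' = (if t = [] then S else ins b (Lf (fst (hd t))) (snd (hd t)) S)
     in chn b (fst (hd S')) (tl S'))"

function (domintros) build :: "pstate \<Rightarrow> fm" where
  "build x = (if pbase x then pend x else Op (fst x) (build (lsub x)) (build (rsub x)))"
  by pat_completeness auto
termination
  by (relation "measure (\<lambda>x. length (fst (snd x)))")
     (auto simp: pbase_def lsub_def rsub_def split: prod.splits)

declare build.simps [simp del]

text \<open>The invariant of the recursion is \<open>wsum S + cst (2 * (d + 1)) t \<le> 2 ^ d\<close> at depth \<open>d\<close>; the last
  literal is never duplicated and hence is charged twice only.\<close>

definition cst :: "nat \<Rightarrow> (nat \<times> nat) list \<Rightarrow> nat" where
  "cst c t = (if t = [] then 0 else if tl t = [] then snd (hd t)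
     else c * wsum (butlast t) + 2 * snd (last t))"

definition pows :: "nat \<Rightarrow> nat list" where
  "pows d = map (\<lambda>i. 2 ^ i) (rev [0..<d])"

lemma pows_simps [simp]: "pows 0 = []" "pows (Suc d) = 2 ^ d # pows d" "length (pows d) = d"
  by (auto simp: pows_def)

fun svalue :: "(nat \<Rightarrow> bool) \<Rightarrow> pstate \<Rightarrow> bool" where
  "svalue r (b, ps, S, t) = ext b (sval r S) (map (\<lambda>x. r (fst x)) t)"

definition pok :: "(nat \<Rightarrow> int) \<Rightarrow> int \<Rightarrow> nat set \<Rightarrow> nat \<Rightarrow> pstate \<Rightarrow> bool" where
  "pok r c V d = (\<lambda>(b, ps, S, t). ps = pows d \<and> S \<noteq> [] \<and> counter r c V S \<and>
     (\<forall>x\<in>set t. timed c (r (fst x)) (snd x) \<and> fst x \<in> V) \<and>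
     wsum S + cst (2 * (d + 1)) t \<le> 2 ^ d)"

lemma timed_pos: "timed c x w \<Longrightarrow> 0 < w"
  by (auto simp: timed_def)

lemma counter_append: "counter r c V (S @ S') \<longleftrightarrow>
   counter r c V S \<and> counter r c V S' \<and> (\<forall>x\<in>set S. \<forall>y\<in>set S'. snd x < snd y)"
  by (auto simp: counter_def sorted_wrt_append)

lemma counter_lt:
  assumes "counter r c V S" "S \<noteq> []" "snd (last S) < 2 ^ d"
  shows "wsum S < 2 ^ d"
proof -
  obtain S' x where S: "S = S' @ [x]" using assms(2) by (cases S rule: rev_cases) auto
  show ?thesis
    by (rule sorted_powers_sum[OF _ _ _ refl, where c = c and g = "\<lambda>x. farr r (fst x)"])
       (use assms in \<open>auto simp: S counter_def sorted_wrt_append intro: less_trans\<close>)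
qed

text \<open>The left half fits by the choice of the cut. For the right half the overflow inequality
  is subtracted from the invariant: the coefficient falls from \<open>2 * (d + 2)\<close> to
  \<open>2 * (d + 1)\<close>, and the difference of 2 per unit of weight pays for
  \<open>evens u\<close> and the splitting literal.\<close>

lemma split_ok:
  assumes ok: "pok r c V (Suc d) (b, ps, S, t)" and nb: "\<not> pbase (b, ps, S, t)" and
    np: "\<not> peel (b, ps, S, t)" and uz: "pcut (b, ps, S, t) = (u, z)"
  shows "pok r c V d (b, tl ps, S, u)"
    "pok r c V d (\<not> b, tl ps, insall (\<not> b) (evens u @ [hd z]), tl z)"
proof -
  have ps: "ps = pows (Suc d)" and S: "S \<noteq> []" "counter r c V S"
    and t: "\<forall>x\<in>set t. timed c (r (fst x)) (snd x) \<and> fst x \<in> V"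
    and cost: "wsum S + cst (2 * (d + 2)) t \<le> 2 * 2 ^ d"
    using ok by (auto simp: pok_def)
  have tl: "t \<noteq> []" "tl t \<noteq> []" using nb by (auto simp: pbase_def)
  have "cut (2 * Suc d) (2 ^ d) (wsum S) t = (u, z)" using uz ps by (simp add: pcut_def)
  note uz = cut_correct[OF this]
  have z: "z \<noteq> []" using uz(3) tl by simp
  let ?p = "2 ^ d :: nat"
  have cost: "wsum S + 2 * (d + 2) * wsum (butlast t) + 2 * snd (last t) \<le> 2 * ?p"
    using cost tl by (simp add: cst_def)
  have lastpos: "snd (last t) > 0" using t tl timed_pos last_in_set by blast
  obtain S' x where Sx: "S = S' @ [x]" using S by (cases S rule: rev_cases) auto
  obtain e where e: "snd x = 2 ^ e" using S by (auto simp: Sx counter_append counter_Cons timed_def)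
  \<comment> \<open>Strict, because the last literal of \<open>t\<close> has positive weight; this
    is what yields \<open>e \<le> d\<close>.\<close>
  have "2 ^ e < (2::nat) ^ Suc d" using cost lastpos e by (simp add: Sx)
  then have "e < Suc d" by (rule power_less_imp_less_exp[rotated]) simp
  then have ed: "e \<le> d" by simp
  \<comment> \<open>Either the counter has a single entry, of exponent at most \<open>d\<close>, or,
    as nothing is to be peeled, its top weight is below \<open>2 ^ d\<close> and distinct smaller
    powers cannot reach \<open>2 ^ d\<close>.\<close>
  have sS: "wsum S \<le> ?p"
  proof (cases "S' = []")
    case True then show ?thesis using ed e by (simp add: Sx)
  next
    case False
    then have "snd x \<noteq> ?p" using np ps by (auto simp: peel_def Sx)
    then have "e < d" using ed e by (metis le_neq_implies_less)
    then show ?thesis using counter_lt[OF S(2,1), of d] e by (simp add: Sx)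
  qed
  have "wsum S + cst (2 * (d + 1)) u \<le> ?p"
  proof (cases "u = []")
    case True then show ?thesis using sS by (simp add: cst_def)
  next
    case False
    then have "tl u \<noteq> []" using uz(2) by (cases u) auto
    then show ?thesis using uz(4) False by (simp add: cst_def)
  qed
  then show "pok r c V d (b, tl ps, S, u)" using ps S t uz(1) by (auto simp: pok_def)
  have le: "wsum (evens u) \<le> wsum u" by (rule wsum_evens)
  have "wsum (evens u) + snd (hd z) + cst (2 * (d + 1)) (tl z) \<le> ?p"
  proof (cases "length z \<ge> 3")
    case True
    then obtain z0 z1 z2 r' where z: "z = z0 # z1 # z2 # r'"
      by (metis Suc_le_length_iff numeral_3_eq_3)
    have b: "wsum (butlast t) = wsum u + snd z0 + snd z1 + wsum (butlast (z2 # r'))" "last t = last z"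
      using z uz(1) by (auto simp: butlast_append)
    \<comment> \<open>The products with \<open>d\<close> are named so that the remaining argument is
      linear.\<close>
    define A B where "A = d * wsum u + d * snd z0" and "B = d * snd z1 + d * wsum (butlast (z2 # r'))"
    have "wsum S + 2 * A + 2 * B + 4 * (wsum u + snd z0 + snd z1 + wsum (butlast (z2 # r'))) + 2 * snd (last z) \<le> 2 * ?p"
      using cost unfolding b A_def B_def by (simp add: algebra_simps)
    moreover have "?p < wsum S + 2 * A + 2 * (wsum u + snd z0) + 2 * snd z1"
      using uz(5)[OF True] unfolding A_def z by (simp add: algebra_simps)
    moreover have "cst (2 * (d + 1)) (tl z) = 2 * B + 2 * (snd z1 + wsum (butlast (z2 # r'))) + 2 * snd (last z)"
      using z by (simp add: cst_def B_def algebra_simps)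
    ultimately show ?thesis using z le by simp
  next
    case False
    \<comment> \<open>The cut ended for lack of literals, so no overflow is available; instead the
      coefficient \<open>2 * (d + 2)\<close>, being at least 4, is halved.\<close>
    have c: "2 * wsum (butlast t) + snd (last t) \<le> ?p"
    proof -
      have "2 * 2 * wsum (butlast t) \<le> 2 * (d + 2) * wsum (butlast t)" by (intro mult_right_mono) auto
      then show ?thesis using cost by linarith
    qed
    show ?thesis
    proof (cases "tl z = []")
      case True
      then have "z = [hd z]" using z by (cases z) auto
      then have "butlast t = u" "last t = hd z" using uz(1) by (metis butlast_snoc, metis last_snoc)
      then show ?thesis using True c le by (simp add: cst_def)
    next
      case F: False
      then obtain z0 z1 where z: "z = [z0, z1]" using False
        by (cases z; cases "tl z"; cases "tl (tl z)") auto
      then have "butlast t = u @ [z0]" "last t = z1" using uz(1) by (auto simp: butlast_append)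
      then show ?thesis using z c le by (simp add: cst_def)
    qed
  qed
  moreover have "\<forall>x\<in>set (evens u @ [hd z]). timed c (r (fst x)) (snd x) \<and> fst x \<in> V"
    using t uz(1) z set_evens[of u] by auto
  ultimately show "pok r c V d (\<not> b, tl ps, insall (\<not> b) (evens u @ [hd z]), tl z)"
    using ps t uz(1) z by (auto simp: pok_def wsum_insall intro!: counter_insall dest: list.set_sel(2)[OF z])
qed

text \<open>The detached entry uses up exactly one of the two halves \<open>2 ^ d\<close> of the
  budget.\<close>

lemma peel_ok:
  assumes ok: "pok r c V (Suc d) (b, ps, S, t)" and nb: "\<not> pbase (b, ps, S, t)" and
    np: "peel (b, ps, S, t)"
  shows "pok r c V d (b, tl ps, butlast S, t)" "counter r c V [last S]" "snd (last S) = 2 ^ d"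
proof -
  have ps: "ps = pows (Suc d)" and S: "S \<noteq> []" "counter r c V S"
    and t: "\<forall>x\<in>set t. timed c (r (fst x)) (snd x) \<and> fst x \<in> V"
    and cost: "wsum S + cst (2 * (d + 2)) t \<le> 2 * 2 ^ d"
    using ok by (auto simp: pok_def)
  obtain S' x where Sx: "S = S' @ [x]" using S by (cases S rule: rev_cases) auto
  have x: "snd x = 2 ^ d" "S' \<noteq> []" using np ps by (auto simp: peel_def Sx)
  have "cst (2 * (d + 1)) t \<le> cst (2 * (d + 2)) t" by (simp add: cst_def)
  then have "wsum S' + cst (2 * (d + 1)) t \<le> 2 ^ d" using cost x by (simp add: Sx)
  then show "pok r c V d (b, tl ps, butlast S, t)" "counter r c V [last S]" "snd (last S) = 2 ^ d"
    using ps S t x by (auto simp: pok_def Sx counter_append)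
qed

lemma pend_ok:
  assumes ok: "pok r c V d (b, ps, S, t)" and base: "pbase (b, ps, S, t)"
  shows "farr r (pend (b, ps, S, t)) \<le> int d + c" "fvars (pend (b, ps, S, t)) \<subseteq> V"
    "fval \<rho> (pend (b, ps, S, t)) = svalue \<rho> (b, ps, S, t)"
    "gates (pend (b, ps, S, t)) + 1 = leaves S + length t"
proof -
  have ps: "ps = pows d" and S: "S \<noteq> []" "counter r c V S"
    and t: "\<forall>x\<in>set t. timed c (r (fst x)) (snd x) \<and> fst x \<in> V"
    and cost: "wsum S + cst (2 * (d + 1)) t \<le> 2 ^ d"
    using ok by (auto simp: pok_def)
  \<comment> \<open>With no power left the budget is 1, but two literals would already cost at least
    2.\<close>
  have tl: "tl t = []"
  proof (rule ccontr)
    assume "tl t \<noteq> []"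
    moreover have "d = 0" using base calculation ps by (cases d) (auto simp: pbase_def)
    moreover have "0 < snd (last t)" using t calculation timed_pos last_in_set
      by (metis list.sel(2))
    ultimately show False using cost by (auto simp: cst_def split: if_splits)
  qed
  define S' where "S' = (if t = [] then S else ins b (Lf (fst (hd t))) (snd (hd t)) S)"
  have pe: "pend (b, ps, S, t) = chn b (fst (hd S')) (tl S')" by (simp add: pend_def S'_def Let_def)
  have S': "S' \<noteq> []" "counter r c V S'" "wsum S' \<le> 2 ^ d"
    using S cost t tl by (auto simp: S'_def wsum_ins cst_def intro!: counter_ins)
  obtain x S'' where x: "S' = x # S''" using S' by (cases S') auto
  show "farr r (pend (b, ps, S, t)) \<le> int d + c" unfolding pe by (rule counter_chn[OF S'(2,1,3)])
  show "fvars (pend (b, ps, S, t)) \<subseteq> V" using S'(2) unfolding pe x by (auto simp: fvars_chn counter_def)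
  have "leaves S' = leaves S + length t" using tl by (cases t) (auto simp: S'_def leaves_ins)
  then show "gates (pend (b, ps, S, t)) + 1 = leaves S + length t" unfolding pe x by (simp add: gates_chn)
  have "fval \<rho> (pend (b, ps, S, t)) = foldr (opb b) (sval \<rho> S') b"
    unfolding pe x by (cases b) (auto simp: fval_chn foldr_opb)
  also have "\<dots> = svalue \<rho> (b, ps, S, t)"
  proof (cases t)
    case Nil then show ?thesis by (cases b) (simp_all add: S'_def ext_def)
  next
    case (Cons y t')
    then have t: "t = [y]" using tl by simp
    show ?thesis
      by (simp add: t S'_def ext_def foldr_ins, cases b)
         (simp_all add: foldr_opb conj_commute disj_commute)
  qed
  finally show "fval \<rho> (pend (b, ps, S, t)) = svalue \<rho> (b, ps, S, t)" .
qed

lemma build_single: "build (b, [], [x], []) = fst x"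
  by (subst build.simps) (simp add: pbase_def pend_def)

text \<open>The gate count is doubled to avoid fractions: a cut repeats every second literal of
  \<open>u\<close>, that is half a leaf per literal and level.\<close>

theorem build_ok:
  assumes "pok r c V d (b, ps, S, t)"
  shows "farr r (build (b, ps, S, t)) \<le> int d + c \<and> fvars (build (b, ps, S, t)) \<subseteq> V \<and>
    fval \<rho> (build (b, ps, S, t)) = svalue \<rho> (b, ps, S, t) \<and>
    2 * (gates (build (b, ps, S, t)) + 1) \<le> 2 * leaves S + length t * (d + 2)"
  using assms
proof (induction d arbitrary: b ps S t)
  case 0
  then have base: "pbase (b, ps, S, t)" by (simp add: pok_def pbase_def)
  then show ?case using pend_ok[OF 0 base] by (subst (1 2 3 4) build.simps) auto
next
  case (Suc d)
  show ?case
  proof (cases "pbase (b, ps, S, t)")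
    case True
    then show ?thesis using pend_ok[OF Suc.prems True] by (subst (1 2 3 4) build.simps) auto
  next
    case nb: False
    have S: "S \<noteq> []" "counter r c V S" using Suc.prems by (auto simp: pok_def)
    show ?thesis
    proof (cases "peel (b, ps, S, t)")
      case True
      note p = peel_ok[OF Suc.prems nb True]
      have sub: "build (b, ps, S, t) = Op b (fst (last S)) (build (b, tl ps, butlast S, t))"
        using nb True by (subst build.simps) (simp add: lsub_def rsub_def build_single)
      note IH = Suc.IH[OF p(1)]
      have Sl: "S = butlast S @ [last S]" using S by simp
      have "farr r (fst (last S)) \<le> int d + c" "fvars (fst (last S)) \<subseteq> V"
        using p(2,3) by (auto simp: counter_Cons timed_def)
      moreover have "leaves S = leaves (butlast S) + gates (fst (last S)) + 1"
        by (subst Sl) simp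
      moreover have "svalue \<rho> (b, ps, S, t) = opb b (fval \<rho> (fst (last S))) (svalue \<rho> (b, tl ps, butlast S, t))"
        by (simp, subst Sl) (cases b; auto simp: ext_def foldr_opb)
      ultimately show ?thesis using IH unfolding sub by (auto simp: algebra_simps)
    next
      case False
      obtain u z where uz: "pcut (b, ps, S, t) = (u, z)" by (cases "pcut (b, ps, S, t)")
      note p = split_ok[OF Suc.prems nb False uz]
      let ?S = "insall (\<not> b) (evens u @ [hd z])"
      have sub: "build (b, ps, S, t) = Op b (build (b, tl ps, S, u)) (build (\<not> b, tl ps, ?S, tl z))"
        using nb False uz by (subst build.simps) (simp add: lsub_def rsub_def)
      note IH = Suc.IH[OF p(1)] Suc.IH[OF p(2)]
      have t: "t \<noteq> []" using nb by (auto simp: pbase_def)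
      have c: "t = u @ z" "even (length u)" "z \<noteq> []"
        using cut_correct[of _ _ _ t u z] uz t by (auto simp: pcut_def)
      have ev: "t = u @ hd z # tl z" using c by simp
      have val: "svalue \<rho> (b, ps, S, t) = opb b (svalue \<rho> (b, tl ps, S, u)) (svalue \<rho> (\<not> b, tl ps, ?S, tl z))"
        using ext_split[of "map (\<lambda>x. \<rho> (fst x)) u" b "sval \<rho> S" "\<rho> (fst (hd z))" "map (\<lambda>x. \<rho> (fst x)) (tl z)"] c(2)
        by (subst ev) (simp add: ext_def foldr_insall map_evens)
      have "2 * leaves ?S = length u + 2" using length_evens[OF c(2)] by (simp add: leaves_insall)
      moreover have "length t = length u + 1 + length (tl z)" using ev by (metis add.assoc length_Cons length_append plus_1_eq_Suc)
      ultimately show ?thesis using IH val unfolding sub by (auto simp: algebra_simps)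
    qed
  qed
qed

text \<open>An item consists of the vertices of a generate and a propagate signal and their common weight.\<close>

type_synonym item = "nat \<times> nat \<times> nat"

section \<open>Carries across a list of items, with scaled weights\<close>

fun gcomb :: "(nat \<Rightarrow> bool) \<Rightarrow> item list \<Rightarrow> bool" where
  "gcomb r [] = False"
| "gcomb r (x # ls) = (r (fst x) \<or> (r (fst (snd x)) \<and> gcomb r ls))"

definition pcomb :: "(nat \<Rightarrow> bool) \<Rightarrow> item list \<Rightarrow> bool" where
  "pcomb r ls \<longleftrightarrow> (\<forall>x\<in>set ls. r (fst (snd x)))"

text \<open>The literals of \<open>g0 \<or> (p0 \<and> (g1 \<or> ...))\<close> in order. The
  propagate signal of the last item is dropped, since no carry enters there.\<close>

fun altl :: "item list \<Rightarrow> (nat \<times> nat) list" where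
  "altl [] = []"
| "altl (x # ls) = (fst x, snd (snd x)) #
     (if ls = [] then [] else (fst (snd x), snd (snd x)) # altl ls)"

text \<open>Serves twice: its length is the number of binary digits of \<open>m\<close>, and at a
  power of two its tail is the list of budgets \<open>pows\<close>.\<close>

function hl :: "nat \<Rightarrow> nat list" where
  "hl m = (if m = 0 then [] else m # hl (m div 2))"
  by pat_completeness auto
termination by (relation "measure id") auto

declare hl.simps [simp del]

lemma hl_power: "hl (2 ^ k) = 2 ^ k # pows k"
proof (induction k)
  case 0 then show ?case by (simp add: hl.simps)
next
  case (Suc k) then show ?case by (subst hl.simps) simp
qed

definition halve :: "item list \<Rightarrow> item list" where
  "halve ls = map (\<lambda>x. (fst x, fst (snd x), (snd (snd x) + 1) div 2)) ls"

definition itemsum :: "item list \<Rightarrow> nat" where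
  "itemsum ls = sum_list (map (\<lambda>x. snd (snd x)) ls)"

text \<open>The 4 is a product 2 * 2: the invariant charges a literal \<open>2 * (K + 1)\<close>
  times its weight, and an item supplies up to two literals.\<close>

definition fits :: "nat \<Rightarrow> item list \<Rightarrow> bool" where
  "fits M ls \<longleftrightarrow> 4 * length (hl M) * itemsum ls \<le> M"

text \<open>
  The weights are halved, rounding up, until their sum meets the invariant of the recursion with
  budget \<open>M\<close>; \<open>q\<close> is the accumulated factor and the third argument bounds the number of halvings.
\<close>

fun scal :: "nat \<Rightarrow> nat \<Rightarrow> nat \<Rightarrow> item list \<Rightarrow> nat \<times> item list" where
  "scal M q 0 ls = (q, ls)"
| "scal M q (Suc f) ls = (if fits M ls then (q, ls) else scal M (2 * q) f (halve ls))"

definition gform :: "nat \<Rightarrow> nat \<Rightarrow> item list \<Rightarrow> fm" where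
  "gform M f ls = (let t = altl (snd (scal M 1 f ls))
     in build (False, tl (hl M), [(Lf (fst (hd t)), snd (hd t))], tl t))"

definition pform :: "nat \<Rightarrow> nat \<Rightarrow> item list \<Rightarrow> fm" where
  "pform M f ls = (let S = insall True (map snd (snd (scal M 1 f ls)))
     in chn True (fst (hd S)) (tl S))"

definition wform :: "nat \<Rightarrow> nat \<Rightarrow> item list \<Rightarrow> nat" where
  "wform M f ls = fst (scal M 1 f ls) * M"

definition itemok :: "(nat \<Rightarrow> int) \<Rightarrow> int \<Rightarrow> nat set \<Rightarrow> item list \<Rightarrow> bool" where
  "itemok r c V ls \<longleftrightarrow> (\<forall>x\<in>set ls. timed c (r (fst x)) (snd (snd x)) \<and>
     timed c (r (fst (snd x))) (snd (snd x)) \<and> fst x \<in> V \<and> fst (snd x) \<in> V)"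

text \<open>Halving lowers the exponent by one, which the offset gives back. Rounding up keeps
  weight 1 at 1, where the larger offset is mere slack.\<close>

lemma timed_halve: "timed c x w \<Longrightarrow> timed (c + 1) x ((w + 1) div 2)"
proof -
  assume "timed c x w"
  then obtain e where e: "w = 2 ^ e" "x \<le> int e + c" by (auto simp: timed_def)
  show ?thesis
  proof (cases e)
    case 0 then show ?thesis using e by (auto simp: timed_def intro!: exI[of _ 0])
  next
    case (Suc e') then show ?thesis using e by (auto simp: timed_def intro!: exI[of _ e'])
  qed
qed

lemma itemok_halve: "itemok r c V ls \<Longrightarrow> itemok r (c + 1) V (halve ls)"
  using timed_halve by (auto simp: itemok_def halve_def)

lemma halve_comb: "gcomb \<rho> (halve ls) = gcomb \<rho> ls" "pcomb \<rho> (halve ls) = pcomb \<rho> ls" "length (halve ls) = length ls"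
proof -
  show "gcomb \<rho> (halve ls) = gcomb \<rho> ls" by (induction ls) (auto simp: halve_def)
qed (auto simp: halve_def pcomb_def)

lemma itemsum_halve: "2 * itemsum (halve ls) \<le> itemsum ls + length ls"
  by (induction ls) (auto simp: itemsum_def halve_def)

lemma fits_unit:
  assumes "\<forall>x\<in>set ls. snd (snd x) \<le> 1" "4 * length (hl M) * length ls \<le> M"
  shows "fits M ls"
proof -
  have "itemsum ls \<le> length ls" using assms(1) by (induction ls) (fastforce simp: itemsum_def)+
  then have "4 * length (hl M) * itemsum ls \<le> 4 * length (hl M) * length ls"
    by (rule mult_left_mono) simp
  then show ?thesis using assms(2) unfolding fits_def by linarith
qed

text \<open>After \<open>f\<close> halvings all weights are at most 1, and then the condition on the
  number of items alone guarantees a fit; so the recursion never ends without one.\<close>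

lemma scal_ok:
  assumes "scal M q f ls = (q', ls')" "itemok r c V ls" "\<forall>x\<in>set ls. snd (snd x) \<le> 2 ^ f"
    "4 * length (hl M) * length ls \<le> M"
  shows "\<exists>k. q' = q * 2 ^ k \<and> itemok r (c + int k) V ls' \<and> fits M ls' \<and> length ls' = length ls \<and>
    (\<forall>\<rho>. gcomb \<rho> ls' = gcomb \<rho> ls \<and> pcomb \<rho> ls' = pcomb \<rho> ls)"
  using assms
proof (induction M q f ls arbitrary: c rule: scal.induct)
  case (1 M q ls)
  then have "fits M ls" by (intro fits_unit) auto
  then show ?case using 1 by (intro exI[of _ 0]) auto
next
  case (2 M q f ls)
  show ?case
  proof (cases "fits M ls")
    case True then show ?thesis using 2 by (intro exI[of _ 0]) auto
  next
    case False
    have "\<forall>x\<in>set (halve ls). snd (snd x) \<le> 2 ^ f" using 2 by (force simp: halve_def)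
    then obtain k where "q' = 2 * q * 2 ^ k \<and> itemok r (c + 1 + int k) V ls' \<and> fits M ls' \<and> length ls' = length ls \<and>
      (\<forall>\<rho>. gcomb \<rho> ls' = gcomb \<rho> ls \<and> pcomb \<rho> ls' = pcomb \<rho> ls)"
      using 2(1)[of "c + 1"] 2(2-) False by (auto simp: itemok_halve halve_comb)
    then show ?thesis by (intro exI[of _ "Suc k"]) (auto simp: algebra_simps)
  qed
qed

text \<open>The list before the last halving did not fit, and a halving turns a sum \<open>s\<close>
  over \<open>m\<close> items into at most \<open>(s + m) / 2\<close>. Solved for the initial sum,
  this bounds \<open>M * q'\<close>; the two terms with \<open>length ls\<close> sum the geometric
  series of rounding errors exactly, as the induction requires.\<close>

lemma scal_bound:
  assumes "scal M q f ls = (q', ls')"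
  defines "T \<equiv> 4 * length (hl M)"
  shows "q' = q \<or> M * q' + 2 * T * length ls * q \<le> 2 * T * q * itemsum ls + T * length ls * q'"
  unfolding T_def using assms(1)
proof (induction M q f ls rule: scal.induct[case_names 1 2])
  case (1 M q ls) then show ?case by simp
next
  case (2 M q f ls)
  let ?T = "4 * length (hl M)"
  show ?case
  proof (cases "fits M ls")
    case True then show ?thesis using 2 by simp
  next
    case False
    define m where "m = length ls"
    have M: "M * q \<le> ?T * itemsum ls * q" using False by (intro mult_right_mono) (auto simp: fits_def)
    have "2 * ?T * q * (2 * itemsum (halve ls)) \<le> 2 * ?T * q * (itemsum ls + m)"
      unfolding m_def by (intro mult_left_mono itemsum_halve) auto
    then have h: "2 * ?T * (2 * q) * itemsum (halve ls) \<le> 2 * ?T * q * itemsum ls + 2 * ?T * q * m"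
      by (simp add: algebra_simps)
    have "q' = 2 * q \<or> M * q' + 2 * ?T * m * (2 * q) \<le>
       2 * ?T * (2 * q) * itemsum (halve ls) + ?T * m * q'"
      using 2 False by (simp add: halve_comb m_def)
    then show ?thesis
    proof
      assume "q' = 2 * q"
      then show ?thesis using M by (simp add: algebra_simps)
    next
      assume "M * q' + 2 * ?T * m * (2 * q) \<le> 2 * ?T * (2 * q) * itemsum (halve ls) + ?T * m * q'"
      then have "M * q' + 2 * ?T * m * (2 * q) \<le> 2 * ?T * q * itemsum ls + 2 * ?T * q * m + ?T * m * q'"
        using h by linarith
      then have "M * q' + 2 * ?T * m * q \<le> 2 * ?T * q * itemsum ls + ?T * m * q'"
        by (simp add: algebra_simps)
      then show ?thesis unfolding m_def by blast
    qed
  qed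
qed

lemma altv_altl: "ls \<noteq> [] \<Longrightarrow> altv False (map (\<lambda>x. \<rho> (fst x)) (altl ls)) = gcomb \<rho> ls"
  by (induction ls) auto

lemma altl_simps [simp]: "altl ls = [] \<longleftrightarrow> ls = []" "ls \<noteq> [] \<Longrightarrow> length (altl ls) = 2 * length ls - 1"
  by (induction ls) auto

lemma wsum_altl: "wsum (altl ls) \<le> 2 * itemsum ls"
  by (induction ls) (auto simp: itemsum_def)

lemma altl_itemok: "itemok r c V ls \<Longrightarrow> x \<in> set (altl ls) \<Longrightarrow> timed c (r (fst x)) (snd x) \<and> fst x \<in> V"
  by (induction ls) (auto simp: itemok_def split: if_splits)

lemma cst_le: "2 \<le> c \<Longrightarrow> cst c t \<le> c * wsum t"
proof (cases t rule: rev_cases)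
  case (snoc t' x)
  assume "2 \<le> c"
  then have "2 * snd x \<le> c * snd x" "snd x \<le> c * snd x" by auto
  then show ?thesis using snoc by (cases t') (auto simp: cst_def algebra_simps)
qed (simp add: cst_def)

text \<open>The \<open>k\<close> halvings shift the offset by \<open>k\<close>, and the recursion
  spends the budget exponent \<open>K\<close>. Relative to the original offset \<open>c\<close> the
  result thus has weight \<open>2 ^ (k + K)\<close>, which is \<open>wform\<close>.\<close>

theorem gform_ok:
  assumes "ls \<noteq> []" "itemok r c V ls" "\<forall>x\<in>set ls. snd (snd x) \<le> 2 ^ f" "4 * (K + 1) * length ls \<le> 2 ^ K"
  shows "timed c (farr r (gform (2 ^ K) f ls)) (wform (2 ^ K) f ls)"
    "timed c (farr r (pform (2 ^ K) f ls)) (wform (2 ^ K) f ls)"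
    "fvars (gform (2 ^ K) f ls) \<subseteq> V" "fvars (pform (2 ^ K) f ls) \<subseteq> V"
    "fval \<rho> (gform (2 ^ K) f ls) = gcomb \<rho> ls" "fval \<rho> (pform (2 ^ K) f ls) = pcomb \<rho> ls"
    "gates (gform (2 ^ K) f ls) \<le> (length ls - 1) * (K + 2)" "gates (pform (2 ^ K) f ls) = length ls - 1"
proof -
  obtain q ls' where sc: "scal (2 ^ K) 1 f ls = (q, ls')" by (cases "scal (2 ^ K) 1 f ls")
  have len: "length (hl (2 ^ K)) = K + 1" by (simp add: hl_power)
  obtain k where k: "q = 2 ^ k" "itemok r (c + int k) V ls'" "fits (2 ^ K) ls'" "length ls' = length ls"
    "\<And>\<rho>. gcomb \<rho> ls' = gcomb \<rho> ls" "\<And>\<rho>. pcomb \<rho> ls' = pcomb \<rho> ls"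
    using scal_ok[OF sc assms(2,3)] assms(4) len by auto
  have ls': "ls' \<noteq> []" using k(4) assms(1) by auto
  define t where "t = altl ls'"
  define S where "S = insall True (map snd ls')"
  have g: "gform (2 ^ K) f ls = build (False, pows K, [(Lf (fst (hd t)), snd (hd t))], tl t)"
    unfolding gform_def Let_def sc t_def hl_power snd_conv list.sel ..
  have p: "pform (2 ^ K) f ls = chn True (fst (hd S)) (tl S)"
    unfolding pform_def Let_def sc S_def snd_conv ..
  have w: "wform (2 ^ K) f ls = 2 ^ (k + K)" unfolding wform_def sc by (simp add: k power_add)
  have t: "t \<noteq> []" using ls' by (simp add: t_def)
  then have tt: "t = hd t # tl t" by simp
  have tok: "timed (c + int k) (r (fst x)) (snd x) \<and> fst x \<in> V" if "x \<in> set t" for x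
    using altl_itemok[OF k(2)] that by (simp add: t_def)
  have "(2 * (K + 1)) * wsum t \<le> (2 * (K + 1)) * (2 * itemsum ls')"
    using wsum_altl[of ls'] unfolding t_def by (intro mult_left_mono) auto
  also have "\<dots> \<le> 2 ^ K" using k(3) unfolding fits_def len by (simp add: algebra_simps)
  finally have cost: "(2 * (K + 1)) * wsum t \<le> 2 ^ K" .
  have "cst (2 * (K + 1)) (tl t) \<le> 2 * (K + 1) * wsum (tl t)" by (rule cst_le) simp
  moreover have "wsum t = snd (hd t) + wsum (tl t)" by (subst tt) simp
  moreover have "1 * snd (hd t) \<le> 2 * (K + 1) * snd (hd t)" by (intro mult_right_mono) auto
  ultimately have c: "snd (hd t) + cst (2 * (K + 1)) (tl t) \<le> 2 ^ K"
    using cost by (simp add: algebra_simps)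
  have pok: "pok r (c + int k) V K (False, pows K, [(Lf (fst (hd t)), snd (hd t))], tl t)"
    unfolding pok_def using c tok t tok[OF list.set_sel(2)[OF t]] by (auto simp: counter_Cons)
  note B = build_ok[OF pok]
  show "timed c (farr r (gform (2 ^ K) f ls)) (wform (2 ^ K) f ls)"
    unfolding w g timed_def using conjunct1[OF B] by (intro exI[of _ "k + K"] conjI refl) simp
  show "fvars (gform (2 ^ K) f ls) \<subseteq> V" unfolding g using B by auto
  have "svalue \<rho> (False, pows K, [(Lf (fst (hd t)), snd (hd t))], tl t) = altv False (map (\<lambda>x. \<rho> (fst x)) t)" for \<rho>
    using arg_cong[OF tt, of "\<lambda>t. altv False (map (\<lambda>x. \<rho> (fst x)) t)"] by (simp add: ext_def)
  then show "fval \<rho> (gform (2 ^ K) f ls) = gcomb \<rho> ls"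
    unfolding g using B k altv_altl[OF ls'] by (auto simp: t_def)
  define m where "m = length ls - 1"
  have "length (tl t) = 2 * m" using k(4) ls' by (simp add: t_def m_def)
  then have "2 * (gates (gform (2 ^ K) f ls) + 1) \<le> 2 + 2 * (m * (K + 2))"
    unfolding g using B[of \<rho>] by (simp add: algebra_simps)
  then show "gates (gform (2 ^ K) f ls) \<le> (length ls - 1) * (K + 2)" unfolding m_def by simp
  have SS: "S \<noteq> []" using ls' by (simp add: S_def)
  have cS: "counter r (c + int k) V S" unfolding S_def
    using k(2) by (intro counter_insall) (auto simp: itemok_def)
  have "wsum S = itemsum ls'" unfolding S_def wsum_insall by (simp add: wsum_def itemsum_def comp_def)
  moreover have "itemsum ls' \<le> 4 * (K + 1) * itemsum ls'" by simp
  ultimately have "wsum S \<le> 2 ^ K" using k(3) unfolding len fits_def by linarith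
  from counter_chn[OF cS SS this]
  show "timed c (farr r (pform (2 ^ K) f ls)) (wform (2 ^ K) f ls)"
    unfolding w p timed_def by (intro exI[of _ "k + K"]) (auto simp: algebra_simps)
  obtain x S' where x: "S = x # S'" using SS by (cases S) auto
  show "fvars (pform (2 ^ K) f ls) \<subseteq> V" unfolding p using cS by (auto simp: x fvars_chn counter_def)
  have "leaves S = length ls" using k by (simp add: S_def leaves_insall)
  then show "gates (pform (2 ^ K) f ls) = length ls - 1" unfolding p by (simp add: x gates_chn)
  have "fval \<rho> (chn True (fst (hd S)) (tl S)) = foldr (opb True) (sval \<rho> S) True"
    by (simp only: x fval_chn foldr_opb) auto
  also have "\<dots> = pcomb \<rho> ls'" unfolding S_def foldr_insall by (auto simp: foldr_opb pcomb_def)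
  finally show "fval \<rho> (pform (2 ^ K) f ls) = pcomb \<rho> ls" unfolding p using k by simp
qed

text \<open>The factor 32 keeps the rounding term below an eighth of \<open>2 ^ K * q\<close>, so
  7/8 of it remains on the left and \<open>8 * (K + 1)\<close> turns into
  \<open>64 / 7 * (K + 1)\<close>. If nothing was halved, the weight is \<open>2 ^ K\<close>
  itself.\<close>

theorem wform_bound:
  assumes "32 * (K + 1) * length ls \<le> 2 ^ K"
  shows "7 * wform (2 ^ K) f ls \<le> 7 * 2 ^ K + 64 * (K + 1) * itemsum ls"
proof -
  obtain q ls' where sc: "scal (2 ^ K) 1 f ls = (q, ls')" by (cases "scal (2 ^ K) 1 f ls")
  have len: "length (hl (2 ^ K)) = K + 1" by (simp add: hl_power)
  consider "q = 1" | "2 ^ K * q + 2 * (4 * (K + 1)) * length ls \<le> 2 * (4 * (K + 1)) * itemsum ls + 4 * (K + 1) * length ls * q"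
    using scal_bound[OF sc] unfolding len by auto
  then show ?thesis
  proof cases
    case 1 then show ?thesis unfolding wform_def sc by simp
  next
    case 2
    have "32 * (K + 1) * length ls * q \<le> 2 ^ K * q" using assms by (rule mult_right_mono) simp
    then have "8 * (4 * (K + 1) * length ls * q) \<le> 2 ^ K * q" by (simp add: algebra_simps)
    then have "7 * (2 ^ K * q) \<le> 64 * (K + 1) * itemsum ls" using 2 by (simp add: algebra_simps)
    then show ?thesis unfolding wform_def sc by (simp add: algebra_simps)
  qed
qed

section \<open>Circuits from formulas\<close>

text \<open>A formula is laid out in postorder from vertex \<open>k\<close> on; its leaves refer to earlier vertices.\<close>

fun gate :: "bool \<Rightarrow> nat \<Rightarrow> nat \<Rightarrow> signal node" where
  "gate True u v = AndGate u v" | "gate False u v = OrGate u v"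

fun root :: "nat \<Rightarrow> fm \<Rightarrow> nat" where
  "root k (Lf v) = v"
| "root k (Op b A B) = k + gates A + gates B"

fun flat :: "nat \<Rightarrow> fm \<Rightarrow> signal node list" where
  "flat k (Lf v) = []"
| "flat k (Op b A B) = flat k A @ flat (k + gates A) B @ [gate b (root k A) (root (k + gates A) B)]"

fun flats :: "nat \<Rightarrow> fm list \<Rightarrow> signal node list" where
  "flats k [] = []"
| "flats k (F # Fs) = flat k F @ flats (k + gates F) Fs"

fun roots :: "nat \<Rightarrow> fm list \<Rightarrow> nat list" where
  "roots k [] = []"
| "roots k (F # Fs) = root k F # roots (k + gates F) Fs"

definition size_fms :: "fm list \<Rightarrow> nat" where
  "size_fms Fs = sum_list (map gates Fs)"

lemma size_fms_simps [simp]: "size_fms [] = 0" "size_fms (F # Fs) = gates F + size_fms Fs"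
  "size_fms (Fs @ Fs') = size_fms Fs + size_fms Fs'"
  by (auto simp: size_fms_def)

lemma length_flat [simp]: "length (flat k F) = gates F"
  by (induction F arbitrary: k) auto

lemma length_flats [simp]: "length (flats k Fs) = size_fms Fs"
  by (induction Fs arbitrary: k) auto

lemma length_roots [simp]: "length (roots k Fs) = length Fs"
  by (induction Fs arbitrary: k) auto

definition topo :: "nat \<Rightarrow> signal node list \<Rightarrow> bool" where
  "topo k xs \<longleftrightarrow> (\<forall>i<length xs. \<forall>u\<in>preds (xs ! i). u < k + i)"

lemma topo_Nil [simp]: "topo k []" by (simp add: topo_def)

lemma topo_append: "topo k (xs @ ys) \<longleftrightarrow> topo k xs \<and> topo (k + length xs) ys"
proof
  assume l: "topo k (xs @ ys)"
  have "topo k xs" unfolding topo_def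
  proof (intro allI impI)
    fix i assume "i < length xs"
    then show "\<forall>u\<in>preds (xs ! i). u < k + i" using l by (auto simp: topo_def nth_append dest!: spec[of _ i])
  qed
  moreover have "topo (k + length xs) ys" unfolding topo_def
  proof (intro allI impI)
    fix i assume "i < length ys"
    then show "\<forall>u\<in>preds (ys ! i). u < k + length xs + i"
      using l by (auto simp: topo_def nth_append add.assoc dest!: spec[of _ "length xs + i"])
  qed
  ultimately show "topo k xs \<and> topo (k + length xs) ys" ..
next
  assume r: "topo k xs \<and> topo (k + length xs) ys"
  show "topo k (xs @ ys)" unfolding topo_def
  proof (intro allI impI)
    fix i assume i: "i < length (xs @ ys)"
    show "\<forall>u\<in>preds ((xs @ ys) ! i). u < k + i"
    proof (cases "i < length xs")
      case True then show ?thesis using r by (auto simp: topo_def nth_append)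
    next
      case False
      then show ?thesis using r i by (auto simp: topo_def nth_append dest!: spec[of _ "i - length xs"])
    qed
  qed
qed

lemma root_less: "fvars F \<subseteq> {..<k} \<Longrightarrow> root k F < k + gates F"
  by (cases F) auto

lemma gate_simps [simp]: "preds (gate b u v) = {u, v}" "is_gate (gate b u v)"
  by (cases b; simp)+

lemma topo_single: "topo k [x] \<longleftrightarrow> (\<forall>u\<in>preds x. u < k)"
  by (simp add: topo_def)

lemma topo_flat: "fvars F \<subseteq> {..<k} \<Longrightarrow> topo k (flat k F)"
proof (induction F arbitrary: k)
  case (Op b A B)
  have "fvars B \<subseteq> {..<k + gates A}" using Op.prems by fastforce
  then have "root (k + gates A) B < k + gates A + gates B" by (rule root_less)
  moreover have "root k A < k + gates A" using Op.prems by (intro root_less) auto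
  ultimately show ?case using Op by (auto simp: topo_append topo_single \<open>fvars B \<subseteq> {..<k + gates A}\<close>)
qed simp

text \<open>The formulas of one stage refer only to vertices below \<open>k\<close> and never to
  each other, so they may be laid out from any \<open>k'\<close> beyond \<open>k\<close>.\<close>

lemma topo_flats: "\<forall>F\<in>set Fs. fvars F \<subseteq> {..<k} \<Longrightarrow> topo k' (flats k' Fs)" if "k \<le> k'"
  using that
proof (induction Fs arbitrary: k')
  case (Cons F Fs)
  then have "fvars F \<subseteq> {..<k'}" by fastforce
  moreover have "topo (k' + gates F) (flats (k' + gates F) Fs)" using Cons by (intro Cons.IH) auto
  ultimately show ?case by (simp add: topo_append topo_flat)
qed simp

lemma flat_gates: "z \<in> set (flat k F) \<Longrightarrow> is_gate z"
  by (induction F arbitrary: k) auto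

lemma flats_gates: "z \<in> set (flats k Fs) \<Longrightarrow> is_gate z"
  by (induction Fs arbitrary: k) (auto dest: flat_gates)

lemma roots_less:
  "\<forall>F\<in>set Fs. fvars F \<subseteq> {..<k} \<Longrightarrow> k \<le> k' \<Longrightarrow> v \<in> set (roots k' Fs) \<Longrightarrow> v < k' + size_fms Fs"
proof (induction Fs arbitrary: k')
  case (Cons F Fs)
  have "fvars F \<subseteq> {..<k'}" using Cons.prems by fastforce
  then show ?case using Cons.prems Cons.IH[of "k' + gates F"] root_less[of F k'] by (auto simp: trans_le_add1)
qed simp

definition seg :: "signal circuit \<Rightarrow> nat \<Rightarrow> signal node list \<Rightarrow> bool" where
  "seg C k xs \<longleftrightarrow> (\<forall>i<length xs. k + i \<in> verts C \<and> nodes C ! (k + i) = xs ! i)"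

lemma seg_append: "seg C k (xs @ ys) \<longleftrightarrow> seg C k xs \<and> seg C (k + length xs) ys"
proof
  assume l: "seg C k (xs @ ys)"
  have "seg C k xs" unfolding seg_def
  proof (intro allI impI)
    fix i assume "i < length xs"
    then show "k + i \<in> verts C \<and> nodes C ! (k + i) = xs ! i"
      using l by (auto simp: seg_def nth_append dest!: spec[of _ i])
  qed
  moreover have "seg C (k + length xs) ys" unfolding seg_def
  proof (intro allI impI)
    fix i assume "i < length ys"
    then show "k + length xs + i \<in> verts C \<and> nodes C ! (k + length xs + i) = ys ! i"
      using l by (auto simp: seg_def nth_append add.assoc dest!: spec[of _ "length xs + i"])
  qed
  ultimately show "seg C k xs \<and> seg C (k + length xs) ys" ..
next
  assume r: "seg C k xs \<and> seg C (k + length xs) ys"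
  show "seg C k (xs @ ys)" unfolding seg_def
  proof (intro allI impI)
    fix i assume i: "i < length (xs @ ys)"
    show "k + i \<in> verts C \<and> nodes C ! (k + i) = (xs @ ys) ! i"
    proof (cases "i < length xs")
      case True then show ?thesis using r by (auto simp: seg_def nth_append)
    next
      case False
      then show ?thesis using r i by (auto simp: seg_def nth_append dest!: spec[of _ "i - length xs"])
    qed
  qed
qed

lemma seg_all: "nodes C = xs \<Longrightarrow> seg C 0 xs"
  by (simp add: seg_def verts_def)

lemma seg_nth: "seg C k xs \<Longrightarrow> i < length xs \<Longrightarrow> k + i \<in> verts C \<and> nodes C ! (k + i) = xs ! i"
  by (simp add: seg_def)

lemma gate_rec:
  assumes "wf_circuit C" "v \<in> verts C" "nodes C ! v = gate b u w"
  shows "vertex_value C x v = opb b (vertex_value C x u) (vertex_value C x w)"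
    "int (arrival C a v) = max (int (arrival C a u)) (int (arrival C a w)) + 1"
  using assms value_rec[of C v x] arrival_rec[of C v a] by (cases b; simp)+

lemma flat_correct:
  assumes "wf_circuit C" "seg C k (flat k F)"
  shows "vertex_value C x (root k F) = fval (vertex_value C x) F \<and>
    int (arrival C a (root k F)) = farr (\<lambda>v. int (arrival C a v)) F"
  using assms(2)
proof (induction F arbitrary: k)
  case (Op b A B)
  have s: "seg C k (flat k A)" "seg C (k + gates A) (flat (k + gates A) B)"
    "seg C (k + gates A + gates B) [gate b (root k A) (root (k + gates A) B)]"
    using Op.prems by (auto simp: seg_append add.assoc)
  have "root k (Op b A B) \<in> verts C" "nodes C ! root k (Op b A B) = gate b (root k A) (root (k + gates A) B)"
    using seg_nth[OF s(3), of 0] by auto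
  note gate_rec[OF assms(1) this]
  then show ?case using Op.IH(1)[OF s(1)] Op.IH(2)[OF s(2)] by simp
qed simp

lemma flats_correct:
  assumes "wf_circuit C" "seg C k (flats k Fs)" "i < length Fs"
  shows "vertex_value C x (roots k Fs ! i) = fval (vertex_value C x) (Fs ! i)"
    "int (arrival C a (roots k Fs ! i)) = farr (\<lambda>v. int (arrival C a v)) (Fs ! i)"
proof -
  have "vertex_value C x (roots k Fs ! i) = fval (vertex_value C x) (Fs ! i) \<and>
    int (arrival C a (roots k Fs ! i)) = farr (\<lambda>v. int (arrival C a v)) (Fs ! i)"
    using assms(2,3)
  proof (induction Fs arbitrary: k i)
    case (Cons F Fs)
    then show ?case using flat_correct[OF assms(1), of k F x a]
      by (cases i) (auto simp: seg_append)
  qed simp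
  then show "vertex_value C x (roots k Fs ! i) = fval (vertex_value C x) (Fs ! i)"
    "int (arrival C a (roots k Fs ! i)) = farr (\<lambda>v. int (arrival C a v)) (Fs ! i)" by auto
qed

lemma topo_wf:
  assumes "topo 0 (nodes C)" "outputs C \<noteq> []" "set (outputs C) \<subseteq> verts C"
    "\<And>i j x. i < length (nodes C) \<Longrightarrow> j < length (nodes C) \<Longrightarrow> nodes C ! i = Input x \<Longrightarrow> nodes C ! j = Input x \<Longrightarrow> i = j"
  shows "wf_circuit C"
proof -
  have "edges C \<subseteq> {(u, v). u < v}" using assms(1) by (force simp: edges_def verts_def topo_def)
  moreover have "acyclic {(u, v :: nat). u < v}"
    using wf_acyclic[OF wf_less] by simp
  ultimately have "acyclic (edges C)" by (metis acyclic_subset)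
  moreover have "edges C \<subseteq> verts C \<times> verts C"
    using assms(1) by (force simp: edges_def verts_def topo_def)
  ultimately show ?thesis using assms unfolding wf_circuit_def by (auto simp: verts_def)
qed

section \<open>Generate and propagate over ranges of positions\<close>

definition pspan :: "(signal \<Rightarrow> bool) \<Rightarrow> nat \<Rightarrow> nat \<Rightarrow> bool" where
  "pspan x l h \<longleftrightarrow> (\<forall>j. l \<le> j \<and> j < h \<longrightarrow> x (P j))"

text \<open>The carry that leaves the range \<open>[l, h)\<close> when none enters it.\<close>

definition gspan :: "(signal \<Rightarrow> bool) \<Rightarrow> nat \<Rightarrow> nat \<Rightarrow> bool" where
  "gspan x l h \<longleftrightarrow> (\<exists>j. l \<le> j \<and> j < h \<and> x (G j) \<and> pspan x (Suc j) h)"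

text \<open>The ranges may overlap in \<open>[m', m)\<close>: a carry generated there is merely
  found by both sides of the disjunction. A carry generated below \<open>m'\<close> has to be
  propagated through all of \<open>[m', h)\<close>.\<close>

lemma gspan_overlap:
  assumes "l \<le> m'" "m' \<le> m" "m \<le> h"
  shows "gspan x l h \<longleftrightarrow> gspan x m' h \<or> (pspan x m' h \<and> gspan x l m)"
proof
  assume "gspan x l h"
  then obtain j where j: "l \<le> j" "j < h" "x (G j)" "pspan x (Suc j) h" by (auto simp: gspan_def)
  show "gspan x m' h \<or> (pspan x m' h \<and> gspan x l m)"
  proof (cases "m' \<le> j")
    case True then show ?thesis using j by (auto simp: gspan_def)
  next
    case False
    then have "pspan x m' h" "pspan x (Suc j) m" using j assms by (auto simp: pspan_def)
    then show ?thesis using j False assms by (auto simp: gspan_def intro!: exI[of _ j])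
  qed
next
  assume "gspan x m' h \<or> (pspan x m' h \<and> gspan x l m)"
  then show "gspan x l h"
  proof
    assume "gspan x m' h" then show ?thesis using assms unfolding gspan_def by (meson le_trans)
  next
    assume a: "pspan x m' h \<and> gspan x l m"
    then obtain j where j: "l \<le> j" "j < m" "x (G j)" "pspan x (Suc j) m" by (auto simp: gspan_def)
    then have "pspan x (Suc j) h" using a assms unfolding pspan_def by (meson le_trans not_le_imp_less)
    then show ?thesis using j assms by (auto simp: gspan_def)
  qed
qed

lemma pspan_overlap: "l \<le> m' \<Longrightarrow> m' \<le> m \<Longrightarrow> m \<le> h \<Longrightarrow> pspan x l h \<longleftrightarrow> pspan x m' h \<and> pspan x l m"
  unfolding pspan_def by (metis le_trans less_le_trans linorder_not_le)

lemma span_single: "gspan x i (Suc i) = x (G i)" "pspan x i (Suc i) = x (P i)" "\<not> gspan x i i" "pspan x i i"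
  by (auto simp: gspan_def pspan_def less_Suc_eq_le)

lemma carry_gspan: "carry x i = gspan x 0 i"
proof (induction i)
  case (Suc i)
  then show ?case using gspan_overlap[of 0 i i "Suc i" x] by (simp add: span_single)
qed (simp add: gspan_def)

section \<open>Doubling inside the blocks\<close>

text \<open>
  The vertices form arrays of length \<open>n\<close>. After \<open>t\<close> doubling steps the propagate and generate
  signals of the last \<open>2 ^ t\<close> positions, truncated at the boundary of the block of length \<open>L\<close>,
  start at \<open>3 * t * n\<close> and \<open>(3 * t + 1) * n\<close>. Overlapping ranges are harmless for carries.
\<close>

definition before :: "nat \<Rightarrow> nat \<Rightarrow> nat \<Rightarrow> nat" where
  "before L t i = i - min (2 ^ t) (i mod L)"

text \<open>The first array, at \<open>(3 * t + 2) * n\<close>, holds auxiliary conjunctions; the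
  other two are the new propagate and generate signals and land exactly where step
  \<open>t + 1\<close> looks for them.\<close>

definition layer :: "nat \<Rightarrow> nat \<Rightarrow> nat \<Rightarrow> signal node list" where
  "layer n L t =
     map (\<lambda>i. AndGate (3 * t * n + i) ((3 * t + 1) * n + before L t i)) [0..<n] @
     map (\<lambda>i. AndGate (3 * t * n + i) (3 * t * n + before L t i)) [0..<n] @
     map (\<lambda>i. OrGate ((3 * t + 1) * n + i) ((3 * t + 2) * n + i)) [0..<n]"

definition layers :: "nat \<Rightarrow> nat \<Rightarrow> nat \<Rightarrow> signal node list" where
  "layers n L m = map (\<lambda>i. Input (P i)) [0..<n] @ map (\<lambda>i. Input (G i)) [0..<n] @
     concat (map (layer n L) [0..<m])"

lemma length_layer [simp]: "length (layer n L t) = 3 * n"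
  by (simp add: layer_def)

lemma length_layers [simp]: "length (layers n L m) = (3 * m + 2) * n"
  by (simp add: layers_def length_concat comp_def sum_list_triv algebra_simps)

lemma layers_0: "layers n L 0 = map (\<lambda>i. Input (P i)) [0..<n] @ map (\<lambda>i. Input (G i)) [0..<n]"
  by (simp add: layers_def)

lemma layers_Suc: "layers n L (Suc m) = layers n L m @ layer n L m"
  by (simp add: layers_def)

lemma before_le: "before L t i \<le> i"
  by (simp add: before_def)

lemma topo_layer: "(3 * t + 2) * n \<le> k \<Longrightarrow> topo k (layer n L t)"
proof -
  assume k: "(3 * t + 2) * n \<le> k"
  have b: "3 * t * n + i < k + i" "(3 * t + 1) * n + before L t i < k + i"
    "3 * t * n + i < k + n + i" "3 * t * n + before L t i < k + n + i"
    "(3 * t + 1) * n + i < k + 2 * n + i" "(3 * t + 2) * n + i < k + 2 * n + i" if "i < n" for i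
    using that k before_le[of L t i] by (auto simp: algebra_simps)
  have "topo k (map (\<lambda>i. AndGate (3 * t * n + i) ((3 * t + 1) * n + before L t i)) [0..<n])"
    using b(1,2) by (simp add: topo_def)
  moreover have "topo (k + n) (map (\<lambda>i. AndGate (3 * t * n + i) (3 * t * n + before L t i)) [0..<n])"
    using b(3,4) by (simp add: topo_def)
  moreover have "topo (k + 2 * n) (map (\<lambda>i. OrGate ((3 * t + 1) * n + i) ((3 * t + 2) * n + i)) [0..<n])"
    using b(5,6) by (simp add: topo_def)
  moreover have "k + n + n = k + 2 * n" by simp
  ultimately show ?thesis unfolding layer_def topo_append length_map length_upt diff_zero by metis
qed

lemma topo_layers: "topo 0 (layers n L m)"
proof (induction m)
  case 0 then show ?case by (auto simp: layers_0 topo_def nth_append)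
next
  case (Suc m)
  then show ?case by (simp add: layers_Suc topo_append topo_layer)
qed

lemma layer_gates: "z \<in> set (layer n L t) \<Longrightarrow> is_gate z"
  by (auto simp: layer_def)

lemma layers_inputs: "{z \<in> set (layers n L m). \<not> is_gate z} = Input ` signals n"
  by (auto simp: layers_def signals_def dest: layer_gates)

lemma layers_count: "length (filter is_gate (layers n L m)) = 3 * m * n"
proof (induction m)
  case 0
  then show ?case by (simp add: layers_0 filter_map comp_def)
next
  case (Suc m)
  have "filter is_gate (layer n L m) = layer n L m" by (rule filter_True) (auto dest: layer_gates)
  then show ?case using Suc by (simp add: layers_Suc algebra_simps)
qed

lemma layers_distinct:
  assumes "i < (3 * m + 2) * n" "j < (3 * m + 2) * n" "layers n L m ! i = Input x" "layers n L m ! j = Input x"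
  shows "i = j"
proof -
  have gate: "is_gate (layers n L m ! i)" if "2 * n \<le> i" "i < (3 * m + 2) * n" for i
  proof -
    have "layers n L m ! i = concat (map (layer n L) [0..<m]) ! (i - 2 * n)"
      using that by (simp add: layers_def nth_append) (simp only: mult_2, simp)
    also have "\<dots> \<in> set (concat (map (layer n L) [0..<m]))"
      using that by (intro nth_mem) (simp add: length_concat comp_def sum_list_triv algebra_simps)
    finally show ?thesis by (auto dest: layer_gates)
  qed
  have "i < 2 * n" "j < 2 * n" using gate[of i] gate[of j] assms by (auto simp: not_less[symmetric])
  moreover have "layers n L m ! i = (if i < n then Input (P i) else Input (G (i - n)))" if "i < 2 * n" for i
    using that by (auto simp: layers_def nth_append)
  ultimately show ?thesis using assms(3,4) by (auto split: if_splits)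
qed

text \<open>The exponent term is one less than in \<open>before\<close>, because the
  \<open>2 ^ t\<close> positions of the range that ends at \<open>i\<close> include \<open>i\<close>
  itself.\<close>

definition start :: "nat \<Rightarrow> nat \<Rightarrow> nat \<Rightarrow> nat" where
  "start L t i = i - min (2 ^ t - 1) (i mod L)"

lemma before_mod:
  assumes "0 < (L::nat)" shows "(i - min k (i mod L)) mod L = i mod L - min k (i mod L)"
proof -
  define q r where "q = i div L" and "r = i mod L"
  have i: "i = q * L + r" by (simp add: q_def r_def)
  define s where "s = r - min k r"
  have "s < L" using assms mod_less_divisor[OF assms, of i] unfolding s_def r_def by linarith
  have "i - min k r = q * L + s" unfolding i s_def by simp
  then show ?thesis using \<open>s < L\<close> unfolding r_def[symmetric] s_def[symmetric] by simp
qed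

text \<open>These are the hypotheses of \<open>gspan_overlap\<close> for the ranges that end at
  \<open>i\<close> and at \<open>before L t i\<close>. At the block boundary the minimum truncates
  both, and they overlap.\<close>

lemma start_before:
  assumes "0 < L"
  shows "start L t (before L t i) = start L (Suc t) i" "start L t i \<le> Suc (before L t i)"
    "start L t (before L t i) \<le> start L t i"
proof -
  define p r j where "p = (2::nat) ^ t" and "r = i mod L" and "j = before L t i"
  have pr: "1 \<le> p" "r \<le> i" "j = i - min p r" "(2::nat) ^ Suc t = p + p"
    by (auto simp: p_def r_def j_def before_def)
  have jr: "j mod L = r - min p r"
    unfolding r_def pr(3) by (rule before_mod[OF assms])
  have "j - min (p - 1) (r - min p r) = i - min (p + p - 1) r \<and> i - min (p - 1) r \<le> Suc j \<and>
    j - min (p - 1) (r - min p r) \<le> i - min (p - 1) r"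
    using pr(1,2) unfolding pr(3) by (cases "r \<le> p") auto
  then show "start L t (before L t i) = start L (Suc t) i" "start L t i \<le> Suc (before L t i)"
    "start L t (before L t i) \<le> start L t i"
    unfolding start_def j_def[symmetric] jr pr(4) p_def[symmetric] r_def[symmetric] by auto
qed

lemma before_div:
  assumes "0 < (L::nat)" shows "before L t i div L = i div L"
proof -
  define q r where "q = i div L" and "r = i mod L"
  have i: "i = q * L + r" by (simp add: q_def r_def)
  define s where "s = r - min (2 ^ t) r"
  have "s < L" using assms mod_less_divisor[OF assms, of i] unfolding s_def r_def by linarith
  have "before L t i = q * L + s" unfolding before_def r_def[symmetric] s_def unfolding i by simp
  then show ?thesis using \<open>s < L\<close> unfolding q_def[symmetric] by simp
qed

text \<open>The bound \<open>\<beta>\<close> is per block: \<open>before\<close> never leaves a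
  block, so late inputs elsewhere do no harm. Without this the weights of the blocks could not be
  treated separately later.\<close>

lemma layers_correct:
  assumes wf: "wf_circuit C" and seg: "seg C 0 (layers n L m)" and L: "0 < L"
    and \<beta>: "\<And>j. j < n \<Longrightarrow> int (a (P j)) \<le> \<beta> (j div L) \<and> int (a (G j)) \<le> \<beta> (j div L)"
    and t: "t \<le> m" and i: "i < n"
  shows "vertex_value C x (3 * t * n + i) = pspan x (start L t i) (Suc i) \<and>
    vertex_value C x ((3 * t + 1) * n + i) = gspan x (start L t i) (Suc i) \<and>
    int (arrival C a (3 * t * n + i)) \<le> \<beta> (i div L) + 2 * int t \<and>
    int (arrival C a ((3 * t + 1) * n + i)) \<le> \<beta> (i div L) + 2 * int t"
  using t i
proof (induction t arbitrary: i)
  case 0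
  have "seg C 0 (map (\<lambda>i. Input (P i)) [0..<n])" "seg C n (map (\<lambda>i. Input (G i)) [0..<n])"
    using seg by (auto simp: layers_def seg_append)
  from seg_nth[OF this(1), of i] seg_nth[OF this(2), of i]
  have "i \<in> verts C" "nodes C ! i = Input (P i)" "n + i \<in> verts C" "nodes C ! (n + i) = Input (G i)"
    using 0 by auto
  then show ?case using value_rec[OF wf, of i x] value_rec[OF wf, of "n + i" x]
      arrival_rec[OF wf, of i a] arrival_rec[OF wf, of "n + i" a] \<beta>[OF 0(2)]
    by (simp add: start_def span_single)
next
  case (Suc t)
  have "seg C 0 (layers n L m)" "m = Suc t + (m - Suc t)" using seg Suc.prems by auto
  moreover have "\<exists>ys. layers n L (Suc t + k) = layers n L t @ layer n L t @ ys" for k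
  proof (induction k)
    case 0 show ?case by (simp add: layers_Suc)
  next
    case (Suc k)
    then show ?case using layers_Suc[of n L "Suc t + k"] by (metis add_Suc_right append_assoc)
  qed
  ultimately have s: "seg C ((3 * t + 2) * n) (layer n L t)"
    by (metis add_0 length_layers seg_append)
  define j where "j = before L t i"
  have j: "j < n" "j \<le> i" using before_le[of L t i] Suc.prems by (auto simp: j_def)
  define p g q where "p = 3 * t * n" and "g = (3 * t + 1) * n" and "q = (3 * t + 2) * n"
  have idx: "3 * Suc t * n = q + n" "(3 * Suc t + 1) * n = q + 2 * n" by (auto simp: q_def algebra_simps)
  have s1: "seg C q (map (\<lambda>i. gate True (p + i) (g + before L t i)) [0..<n])"
    "seg C (q + n) (map (\<lambda>i. gate True (p + i) (p + before L t i)) [0..<n])"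
    "seg C (q + 2 * n) (map (\<lambda>i. gate False (g + i) (q + i)) [0..<n])"
    using s unfolding layer_def seg_append p_def g_def q_def by (auto simp: algebra_simps)
  have v: "q + i \<in> verts C" "nodes C ! (q + i) = gate True (p + i) (g + j)"
    "q + n + i \<in> verts C" "nodes C ! (q + n + i) = gate True (p + i) (p + j)"
    "q + 2 * n + i \<in> verts C" "nodes C ! (q + 2 * n + i) = gate False (g + i) (q + i)"
    using seg_nth[OF s1(1), of i] seg_nth[OF s1(2), of i] seg_nth[OF s1(3), of i] Suc.prems
    by (auto simp: j_def)
  note r = gate_rec(1)[OF wf v(1,2), of x] gate_rec(1)[OF wf v(3,4), of x] gate_rec(1)[OF wf v(5,6), of x]
    gate_rec(2)[OF wf v(1,2), of a] gate_rec(2)[OF wf v(3,4), of a] gate_rec(2)[OF wf v(5,6), of a]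
  have IHi: "vertex_value C x (p + i) = pspan x (start L t i) (Suc i)"
    "vertex_value C x (g + i) = gspan x (start L t i) (Suc i)"
    "int (arrival C a (p + i)) \<le> \<beta> (i div L) + 2 * int t"
    "int (arrival C a (g + i)) \<le> \<beta> (i div L) + 2 * int t"
    using Suc.IH[of i] Suc.prems unfolding p_def g_def by auto
  have IHj: "vertex_value C x (p + j) = pspan x (start L t j) (Suc j)"
    "vertex_value C x (g + j) = gspan x (start L t j) (Suc j)"
    "int (arrival C a (p + j)) \<le> \<beta> (i div L) + 2 * int t"
    "int (arrival C a (g + j)) \<le> \<beta> (i div L) + 2 * int t"
    using Suc.IH[of j] Suc.prems j before_div[OF L, of t i] unfolding p_def g_def by (auto simp: j_def)
  note sb = start_before[OF L, of t i, folded j_def]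
  have "gspan x (start L (Suc t) i) (Suc i) \<longleftrightarrow>
     gspan x (start L t i) (Suc i) \<or> (pspan x (start L t i) (Suc i) \<and> gspan x (start L t j) (Suc j))"
    unfolding sb(1)[symmetric] by (rule gspan_overlap) (use sb j in auto)
  moreover have "pspan x (start L (Suc t) i) (Suc i) \<longleftrightarrow>
     pspan x (start L t i) (Suc i) \<and> pspan x (start L t j) (Suc j)"
    unfolding sb(1)[symmetric] by (rule pspan_overlap) (use sb j in auto)
  ultimately show ?case unfolding idx using r IHi IHj by auto
qed

lemma start_full: "L \<le> 2 ^ t \<Longrightarrow> start L t i = i - i mod L" if "0 < L"
proof -
  assume "L \<le> 2 ^ t"
  then have "i mod L \<le> 2 ^ t - 1" using mod_less_divisor[OF that, of i] by linarith
  then show ?thesis by (simp add: start_def)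
qed

section \<open>Dyadic intervals and the chains that cover prefixes\<close>

function low :: "nat \<Rightarrow> nat" where
  "low b = (if b = 0 \<or> odd b then 1 else 2 * low (b div 2))"
  by pat_completeness auto
termination by (relation "measure id") auto

declare low.simps [simp del]

text \<open>The endpoints \<open>b\<close>, \<open>b - low b\<close>, ... of a Fenwick query.
  Recursion on binary digits gives the logarithmic length at once; \<open>chain_unfold\<close>
  recovers the description by clearing lowest bits.\<close>

function chain :: "nat \<Rightarrow> nat list" where
  "chain b = (if b = 0 then [] else (if odd b then [b] else []) @ map ((*) 2) (chain (b div 2)))"
  by pat_completeness auto
termination by (relation "measure id") auto

declare chain.simps [simp del]

text \<open>Includes 0 thanks to the default value 1, so that lists of \<open>low b\<close> items
  are never empty.\<close>

lemma low_pos: "0 < low b"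
  by (induction b rule: low.induct) (subst low.simps, auto)

lemma low_le: "0 < b \<Longrightarrow> low b \<le> b"
proof (induction b rule: low.induct)
  case (1 b)
  then show ?case by (subst low.simps) (auto elim!: evenE)
qed

lemma low_even: "0 < b \<Longrightarrow> low (2 * b) = 2 * low b"
  by (subst low.simps) auto

lemma low_odd: "low (Suc (2 * b)) = 1"
  by (subst low.simps) auto

lemma chain_unfold: "0 < b \<Longrightarrow> chain b = b # chain (b - low b)"
proof (induction b rule: chain.induct)
  case (1 b)
  show ?case
  proof (cases "odd b")
    case True
    then obtain c where b: "b = Suc (2 * c)" by (metis oddE Suc_eq_plus1)
    have "chain b = b # map ((*) 2) (chain c)" using b by (subst chain.simps) auto
    moreover have "chain (2 * c) = map ((*) 2) (chain c)" by (subst chain.simps) (auto simp: chain.simps[of 0])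
    ultimately show ?thesis using b by (simp add: low_odd)
  next
    case False
    then obtain c where b: "b = 2 * c" "0 < c" using 1 by auto
    have "chain b = map ((*) 2) (chain c)" using b by (subst chain.simps) auto
    also have "chain c = c # chain (c - low c)" using 1 False b by auto
    moreover have "chain (2 * c - 2 * low c) = map ((*) 2) (chain (c - low c))"
      unfolding diff_mult_distrib2[symmetric] by (subst chain.simps) (auto simp: chain.simps[of 0])
    ultimately show ?thesis using b by (simp add: low_even)
  qed
qed

lemma chain_0 [simp]: "chain 0 = []"
  by (simp add: chain.simps)

lemma chain_bounds: "c \<in> set (chain b) \<Longrightarrow> 0 < c \<and> c \<le> b"
  by (induction b arbitrary: c rule: chain.induct) (subst (asm) (2) chain.simps, force split: if_splits)

lemma chain_length: "b < 2 ^ k \<Longrightarrow> length (chain b) \<le> k"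
proof (induction b arbitrary: k rule: chain.induct)
  case (1 b)
  show ?case
  proof (cases "b = 0")
    case False
    then obtain k' where k: "k = Suc k'" using 1 by (cases k) auto
    have "length (chain (b div 2)) \<le> k'" using 1 False k by auto
    then show ?thesis using k by (subst chain.simps) auto
  qed simp
qed

text \<open>Odd numbers contribute 1 each and even ones twice the sum over their halves, so every
  binary level adds about \<open>B / 2\<close>. This counts the items of all dyadic
  intervals.\<close>

lemma low_sum: "B < 2 ^ k \<Longrightarrow> 2 * (\<Sum>b = 1..B. low b) \<le> B * (k + 1)"
proof (induction k arbitrary: B)
  case 0 then show ?case by simp
next
  case (Suc k)
  define C where "C = B div 2"
  have IH: "2 * (\<Sum>b = 1..C. low b) \<le> C * (k + 1)" using Suc by (auto simp: C_def)
  have ev: "(\<Sum>b = 1..2 * C. low b) = C + 2 * (\<Sum>b = 1..C. low b)" for C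
    by (induction C) (simp_all add: low_odd low_even[of "Suc _", simplified])
  show ?case
  proof (cases "even B")
    case True
    then have B: "B = 2 * C" by (simp add: C_def)
    show ?thesis unfolding B ev using IH by (simp add: algebra_simps)
  next
    case False
    then have B: "B = Suc (2 * C)" by (simp add: C_def)
    show ?thesis unfolding B using ev[of C] low_odd[of C] IH by (simp add: algebra_simps)
  qed
qed

section \<open>The adder circuit\<close>

text \<open>For small \<open>n\<close> a single block suffices and \<open>nb n = 0\<close>.\<close>

definition lg :: "nat \<Rightarrow> nat" where "lg n = length (hl (n - 1))"

text \<open>Beyond the threshold the block length \<open>2 ^ lam n\<close> lies between half of
  \<open>lg n\<close> and \<open>lg n - 1\<close>. The threshold 11 is where the two delay estimates
  meet: \<open>small_delay\<close> handles pure doubling up to it, \<open>large_delay\<close> the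
  blocks above it.\<close>

definition lam :: "nat \<Rightarrow> nat" where
  "lam n = (if lg n \<le> 11 then lg n else length (hl (lg n - 1)) - 1)"

definition bs :: "nat \<Rightarrow> nat" where "bs n = 2 ^ lam n"

text \<open>The last position lies in block \<open>nb n\<close>; the blocks before it are complete,
  and only their carries are handed on.\<close>

definition nb :: "nat \<Rightarrow> nat" where "nb n = (n - 1) div bs n"

fun geta :: "'a \<Rightarrow> 'a list \<Rightarrow> nat \<Rightarrow> 'a" where
  "geta d [] i = d"
| "geta d (x # xs) i = (if i = 0 then x else geta d xs (i - 1))"

text \<open>
  Arrival times are taken relative to the latest one, which has weight \<open>2 ^ (3 * lg n)\<close>; inputs that
  are earlier by more than \<open>3 * lg n\<close> get weight 1. So all weights are polynomial in \<open>n\<close>, and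
  the weights of the early inputs together are negligible.
\<close>

fun wt :: "nat \<Rightarrow> nat \<Rightarrow> nat list \<Rightarrow> nat" where
  "wt m x [] = 1"
| "wt m x (p # ps) = (if m \<le> x then p else wt m (Suc x) ps)"

type_synonym times = "(nat \<times> nat) list"

definition amax :: "times \<Rightarrow> nat" where
  "amax al = foldr (\<lambda>x m. max (max (fst x) (snd x)) m) al 0"

definition ew :: "times \<Rightarrow> nat \<Rightarrow> nat" where
  "ew al i = max (wt (amax al) (fst (geta (0, 0) al i)) (hl (2 ^ (3 * lg (length al)))))
                 (wt (amax al) (snd (geta (0, 0) al i)) (hl (2 ^ (3 * lg (length al)))))"

definition bw :: "times \<Rightarrow> nat \<Rightarrow> nat" where
  "bw al b = foldr (\<lambda>j m. max (ew al (b * bs (length al) + j)) m) [0..<bs (length al)] 1"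

definition parr :: "nat \<Rightarrow> nat \<Rightarrow> nat" where "parr n i = 3 * lam n * n + i"
definition garr :: "nat \<Rightarrow> nat \<Rightarrow> nat" where "garr n i = (3 * lam n + 1) * n + i"

definition blk :: "times \<Rightarrow> nat \<Rightarrow> item" where
  "blk al b = (garr (length al) (b * bs (length al) + (bs (length al) - 1)),
     parr (length al) (b * bs (length al) + (bs (length al) - 1)), bw al b)"

definition xit :: "times \<Rightarrow> nat \<Rightarrow> item list" where
  "xit al b = map (\<lambda>i. blk al (b - 1 - i)) [0..<low b]"

text \<open>Exponents \<open>K\<close> with \<open>32 * (K + 1) * m \<le> 2 ^ K\<close>, where
  \<open>m\<close> is the number of items: at most \<open>nb n\<close> for an interval, and at most
  \<open>lg n\<close> for a chain, which allows the much smaller \<open>yexp\<close>. The 7 is the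
  logarithm of 128 in \<open>xcond\<close> and \<open>ycond\<close>.\<close>

definition xexp :: "nat \<Rightarrow> nat" where "xexp n = lg n + 7"
definition yexp :: "nat \<Rightarrow> nat" where "yexp n = 2 * lam n + 7"

definition gx :: "times \<Rightarrow> nat \<Rightarrow> fm" where
  "gx al b = gform (2 ^ xexp (length al)) (3 * lg (length al)) (xit al b)"
definition px :: "times \<Rightarrow> nat \<Rightarrow> fm" where
  "px al b = pform (2 ^ xexp (length al)) (3 * lg (length al)) (xit al b)"
definition wx :: "times \<Rightarrow> nat \<Rightarrow> nat" where
  "wx al b = wform (2 ^ xexp (length al)) (3 * lg (length al)) (xit al b)"

definition fsX :: "times \<Rightarrow> fm list" where
  "fsX al = map (gx al) [1..<nb (length al) + 1] @ map (px al) [1..<nb (length al) + 1]"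

definition k0 :: "times \<Rightarrow> nat" where "k0 al = (3 * lam (length al) + 2) * length al"
definition k1 :: "times \<Rightarrow> nat" where "k1 al = k0 al + size_fms (fsX al)"

definition rX :: "times \<Rightarrow> nat list" where "rX al = roots (k0 al) (fsX al)"

definition yit :: "times \<Rightarrow> nat \<Rightarrow> item list" where
  "yit al b = map (\<lambda>c. (geta 0 (rX al) (c - 1), geta 0 (rX al) (nb (length al) + c - 1), wx al c)) (chain b)"

text \<open>The weights \<open>wx\<close> are at most \<open>2 ^ (4 * lg n + 7)\<close>, so that
  many halvings suffice. Chains reach down to position 0, where no carry enters, so only generate
  signals are formed.\<close>

definition gy :: "times \<Rightarrow> nat \<Rightarrow> fm" where
  "gy al b = gform (2 ^ yexp (length al)) (4 * lg (length al) + 7) (yit al b)"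

definition fsY :: "times \<Rightarrow> fm list" where
  "fsY al = map (gy al) [1..<nb (length al) + 1]"

definition k2 :: "times \<Rightarrow> nat" where "k2 al = k1 al + size_fms (fsY al)"
definition rY :: "times \<Rightarrow> nat list" where "rY al = roots (k1 al) (fsY al)"

text \<open>In the first block the local signal is the carry itself; elsewhere the carry into the
  block is merged by two more gates. The index is shifted by one since \<open>fsY\<close> begins
  with boundary 1.\<close>

definition zf :: "times \<Rightarrow> nat \<Rightarrow> fm" where
  "zf al i = (let n = length al in if i < bs n then Lf (garr n i)
     else Op False (Lf (garr n i)) (Op True (Lf (parr n i)) (Lf (geta 0 (rY al) (i div bs n - 1)))))"

definition fsZ :: "times \<Rightarrow> fm list" where "fsZ al = map (zf al) [0..<length al]"

definition circ :: "times \<Rightarrow> signal circuit" where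
  "circ al = Circuit (layers (length al) (bs (length al)) (lam (length al)) @
       flats (k0 al) (fsX al) @ flats (k1 al) (fsY al) @ flats (k2 al) (fsZ al))
     (roots (k2 al) (fsZ al))"

section \<open>Weights, block lengths and budget exponents\<close>

lemma geta_nth: "i < length xs \<Longrightarrow> geta d xs i = xs ! i"
  by (induction d xs i rule: geta.induct) (auto simp: nth_Cons split: nat.splits)

text \<open>Walking down the powers while counting up from the arrival time replaces a subtraction
  in the exponent; running off the list means weight 1, which matches truncated subtraction.\<close>

lemma wt_pows: "wt m x (pows (Suc k)) = 2 ^ (k - (m - x))"
proof (induction k arbitrary: x)
  case 0 then show ?case by simp
next
  case (Suc k)
  show ?case by (subst pows_simps(2), subst wt.simps, subst Suc) (auto simp: Suc_diff_le)
qed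

lemma wt_hl: "wt m x (hl (2 ^ k)) = 2 ^ (k - (m - x))"
  using wt_pows[of m x k] by (simp add: hl_power)

lemma le_amax: "x \<in> set al \<Longrightarrow> fst x \<le> amax al \<and> snd x \<le> amax al"
  unfolding amax_def by (induction al) auto

lemma amax_attained: "al \<noteq> [] \<Longrightarrow> \<exists>x\<in>set al. amax al = max (fst x) (snd x)"
  unfolding amax_def
proof (induction al)
  case (Cons x al)
  then show ?case by (cases "al = []") (auto simp: max_def)
qed simp

lemma foldr_max: "(\<forall>x\<in>set xs. f x \<le> foldr (\<lambda>j m. max (f j) m) xs (b :: nat)) \<and> b \<le> foldr (\<lambda>j m. max (f j) m) xs b \<and>
    (foldr (\<lambda>j m. max (f j) m) xs b = b \<or> (\<exists>x\<in>set xs. foldr (\<lambda>j m. max (f j) m) xs b = f x))"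
  by (induction xs) (auto simp: max_def)

lemma ew_eq: "ew al i = max (2 ^ (3 * lg (length al) - (amax al - fst (geta (0, 0) al i))))
    (2 ^ (3 * lg (length al) - (amax al - snd (geta (0, 0) al i))))"
  by (simp add: ew_def wt_hl)

lemma ew_power: "\<exists>e. ew al i = 2 ^ e \<and> e \<le> 3 * lg (length al)"
  unfolding ew_eq by (auto simp: max_def)

lemma bw_power: "\<exists>e. bw al b = 2 ^ e \<and> e \<le> 3 * lg (length al)"
  using foldr_max[of "[0..<bs (length al)]" "\<lambda>j. ew al (b * bs (length al) + j)" 1] ew_power
  unfolding bw_def by (metis power_0 zero_le)

lemma bs_pos: "0 < bs n" by (simp add: bs_def)

lemma ew_le_bw: "ew al i \<le> bw al (i div bs (length al))"
proof -
  have "i mod bs (length al) \<in> set [0..<bs (length al)]" using bs_pos by simp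
  then have "ew al (i div bs (length al) * bs (length al) + i mod bs (length al)) \<le> bw al (i div bs (length al))"
    unfolding bw_def by (rule foldr_max[THEN conjunct1, rule_format])
  then show ?thesis by simp
qed

text \<open>A maximum is charged to the sum over its block. Its initial value 1 is covered too,
  because all weights are at least 1.\<close>

lemma bw_le_sum: "bw al b \<le> (\<Sum>i\<in>{b * bs (length al)..<Suc b * bs (length al)}. ew al i)"
proof -
  let ?L = "bs (length al)"
  let ?S = "\<Sum>i\<in>{b * ?L..<Suc b * ?L}. ew al i"
  have mem: "ew al i \<le> ?S" if "i \<in> {b * ?L..<Suc b * ?L}" for i
    by (rule member_le_sum[OF that]) auto
  have "bw al b = 1 \<or> (\<exists>j<?L. bw al b = ew al (b * ?L + j))"
    using foldr_max[of "[0..<?L]" "\<lambda>j. ew al (b * ?L + j)" 1] unfolding bw_def by auto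
  moreover have "1 \<le> ew al (b * ?L)" using ew_power[of al "b * ?L"] by auto
  ultimately show ?thesis using mem[of "b * ?L"] mem[of "b * ?L + j" for j] bs_pos[of "length al"] by fastforce
qed

lemma hl_length: "0 < m \<Longrightarrow> 2 ^ (length (hl m) - 1) \<le> m \<and> m < 2 ^ length (hl m) \<and> 0 < length (hl m)"
proof (induction m rule: hl.induct)
  case (1 m)
  show ?case
  proof (cases "m = 1")
    case True then show ?thesis by (simp add: hl.simps)
  next
    case False
    then have m: "0 < m div 2" using 1 by auto
    have l: "length (hl m) = Suc (length (hl (m div 2)))" using 1 by (subst hl.simps) simp
    have IH: "2 ^ (length (hl (m div 2)) - 1) \<le> m div 2" "m div 2 < 2 ^ length (hl (m div 2))"
      "0 < length (hl (m div 2))" using 1 m by auto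
    then obtain k where k: "length (hl (m div 2)) = Suc k" by (cases "length (hl (m div 2))") auto
    then show ?thesis using IH unfolding l k by auto
  qed
qed

lemma lg_bounds: "2 \<le> n \<Longrightarrow> n \<le> 2 ^ lg n \<and> 2 ^ (lg n - 1) < n \<and> 0 < lg n"
  using hl_length[of "n - 1"] by (auto simp: lg_def)

lemma lam_small: "lg n \<le> 11 \<Longrightarrow> 2 \<le> n \<Longrightarrow> n \<le> bs n \<and> nb n = 0"
  using lg_bounds[of n] by (auto simp: nb_def bs_def lam_def)

lemma lam_large: "12 \<le> lg n \<Longrightarrow> 3 \<le> lam n \<and> bs n \<le> lg n - 1 \<and> lg n \<le> 2 * bs n"
proof -
  assume l: "12 \<le> lg n"
  define k where "k = length (hl (lg n - 1))"
  have k: "2 ^ (k - 1) \<le> lg n - 1" "lg n - 1 < 2 ^ k" "0 < k"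
    using hl_length[of "lg n - 1"] l by (auto simp: k_def)
  have lam: "lam n = k - 1" using l by (simp add: lam_def k_def)
  have "\<not> k \<le> 3"
  proof
    assume "k \<le> 3"
    then have "(2::nat) ^ k \<le> 2 ^ 3" by (intro power_increasing) auto
    then show False using k l by simp
  qed
  moreover obtain k' where "k = Suc k'" using k by (cases k) auto
  ultimately show ?thesis using k l by (simp add: lam bs_def)
qed

lemma nb_bound: "2 \<le> n \<Longrightarrow> nb n * bs n < n"
  using div_times_less_eq_dividend[of "n - 1" "bs n"] unfolding nb_def by linarith

lemma nb_less: "2 \<le> n \<Longrightarrow> nb n < 2 ^ (lg n - lam n)"
proof (cases "lam n \<le> lg n")
  case True
  assume n: "2 \<le> n"
  have "nb n * bs n < 2 ^ lg n" using nb_bound[OF n] lg_bounds[OF n] by linarith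
  also have "2 ^ lg n = 2 ^ (lg n - lam n) * bs n"
    using True by (simp add: bs_def power_add[symmetric])
  finally show ?thesis by simp
next
  case False
  assume n: "2 \<le> n"
  have "2 ^ lg n < bs n" using False by (simp add: bs_def)
  then have "n - 1 < bs n" using lg_bounds[OF n] by linarith
  then show ?thesis by (simp add: nb_def)
qed

text \<open>Since \<open>xexp n + 1 = lg n + 8\<close> is at most \<open>4 * bs n\<close>, the left
  side is at most \<open>128 * (nb n * bs n)\<close>, and
  \<open>nb n * bs n < n \<le> 2 ^ lg n\<close>.\<close>

lemma xcond: "2 \<le> n \<Longrightarrow> b \<le> nb n \<Longrightarrow> 32 * (xexp n + 1) * b \<le> 2 ^ xexp n"
proof (cases "lg n \<le> 11")
  case True
  assume "2 \<le> n" "b \<le> nb n" then show ?thesis using lam_small[OF True] by simp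
next
  case False
  assume n: "2 \<le> n" and b: "b \<le> nb n"
  have l: "lg n + 8 \<le> 4 * bs n" using lam_large[of n] False by auto
  have "32 * (xexp n + 1) * b \<le> 32 * (4 * bs n) * nb n" unfolding xexp_def using l b
    by (intro mult_mono) auto
  also have "\<dots> = 128 * (nb n * bs n)" by simp
  also have "\<dots> \<le> 128 * 2 ^ lg n" using nb_bound[OF n] lg_bounds[OF n] by (intro mult_left_mono) auto
  finally show ?thesis by (simp add: xexp_def power_add)
qed

text \<open>Both \<open>yexp n + 1\<close> and the length of a chain are at most
  \<open>2 * bs n\<close>, and \<open>32 * (2 * bs n) ^ 2 = 2 ^ (2 * lam n + 7)\<close>.\<close>

lemma ycond: "2 \<le> n \<Longrightarrow> b \<le> nb n \<Longrightarrow> 32 * (yexp n + 1) * length (chain b) \<le> 2 ^ yexp n"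
proof (cases "lg n \<le> 11")
  case True
  assume "2 \<le> n" "b \<le> nb n" then show ?thesis using lam_small[OF True] by simp
next
  case False
  assume n: "2 \<le> n" and b: "b \<le> nb n"
  have l: "lg n \<le> 2 * bs n" "3 \<le> lam n" using lam_large[of n] False by auto
  have "length (chain b) \<le> lg n - lam n" by (rule chain_length) (use nb_less[OF n] b in simp)
  then have "length (chain b) \<le> 2 * bs n" using l by simp
  moreover have "2 * k + 8 \<le> 2 * 2 ^ k" if "3 \<le> k" for k :: nat
    using that by (induction k rule: dec_induct) auto
  then have "2 * lam n + 8 \<le> 2 * bs n" using l(2) by (simp add: bs_def)
  ultimately have "32 * (yexp n + 1) * length (chain b) \<le> 32 * (2 * bs n) * (2 * bs n)"
    unfolding yexp_def by (intro mult_mono) auto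
  also have "(2::nat) ^ (2 * lam n) = 2 ^ lam n * 2 ^ lam n" by (simp only: mult_2 power_add)
  then have "32 * (2 * bs n) * (2 * bs n) = 2 ^ yexp n" by (simp add: yexp_def bs_def power_add)
  finally show ?thesis .
qed

lemma map_down_Suc: "map (\<lambda>i. f (Suc b - 1 - i)) [0..<Suc k] = f b # map (\<lambda>i. f (b - 1 - i)) [0..<k]"
  by (simp add: upt_conv_Cons map_Suc_upt[symmetric] comp_def del: upt_Suc)

lemma gcomb_span:
  assumes "\<And>j. j < b \<Longrightarrow> r (fst (f j)) = gspan x (j * L) (Suc j * L)"
    "\<And>j. j < b \<Longrightarrow> r (fst (snd (f j))) = pspan x (j * L) (Suc j * L)" "k \<le> b"
  shows "gcomb r (map (\<lambda>i. f (b - 1 - i)) [0..<k]) = gspan x ((b - k) * L) (b * L)"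
  using assms
proof (induction k arbitrary: b)
  case 0 then show ?case by (simp add: span_single)
next
  case (Suc k)
  obtain b' where b: "b = Suc b'" using Suc.prems(3) by (cases b) auto
  have "gspan x ((b - Suc k) * L) (b * L) \<longleftrightarrow> gspan x (b' * L) (b * L) \<or>
     pspan x (b' * L) (b * L) \<and> gspan x ((b' - k) * L) (b' * L)"
    unfolding b diff_Suc_Suc by (rule gspan_overlap) auto
  then show ?case unfolding b map_down_Suc using Suc by (auto simp: b)
qed

lemma pcomb_span:
  assumes "\<And>j. j < b \<Longrightarrow> r (fst (snd (f j))) = pspan x (j * L) (Suc j * L)" "k \<le> b"
  shows "pcomb r (map (\<lambda>i. f (b - 1 - i)) [0..<k]) = pspan x ((b - k) * L) (b * L)"
  using assms
proof (induction k arbitrary: b)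
  case 0 then show ?case by (simp add: pcomb_def span_single)
next
  case (Suc k)
  obtain b' where b: "b = Suc b'" using Suc.prems(2) by (cases b) auto
  have "pspan x ((b - Suc k) * L) (b * L) \<longleftrightarrow>
     pspan x (b' * L) (b * L) \<and> pspan x ((b' - k) * L) (b' * L)"
    unfolding b diff_Suc_Suc by (rule pspan_overlap) auto
  moreover have "pcomb r (z # zs) \<longleftrightarrow> r (fst (snd z)) \<and> pcomb r zs" for z zs by (simp add: pcomb_def)
  ultimately show ?case unfolding b map_down_Suc using Suc by (auto simp: b)
qed

lemma gcomb_chain:
  assumes "\<And>c. 0 < c \<Longrightarrow> c \<le> b \<Longrightarrow> r (fst (f c)) = gspan x ((c - low c) * L) (c * L)"
    "\<And>c. 0 < c \<Longrightarrow> c \<le> b \<Longrightarrow> r (fst (snd (f c))) = pspan x ((c - low c) * L) (c * L)"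
  shows "gcomb r (map f (chain b)) = gspan x 0 (b * L)"
  using assms
proof (induction b rule: less_induct)
  case (less b)
  show ?case
  proof (cases "b = 0")
    case True then show ?thesis by (simp add: span_single)
  next
    case False
    then have "b - low b < b" using low_pos[of b] by simp
    then have "gcomb r (map f (chain (b - low b))) = gspan x 0 ((b - low b) * L)"
      using less.IH[of "b - low b"] less.prems by auto
    moreover have "gspan x 0 (b * L) \<longleftrightarrow> gspan x ((b - low b) * L) (b * L) \<or>
       pspan x ((b - low b) * L) (b * L) \<and> gspan x 0 ((b - low b) * L)"
      by (rule gspan_overlap) auto
    ultimately show ?thesis using less.prems[of b] False by (simp add: chain_unfold)
  qed
qed

lemma itemsum_down: "k \<le> b \<Longrightarrow> itemsum (map (\<lambda>i. f (b - 1 - i)) [0..<k]) = (\<Sum>j = b - k..<b. snd (snd (f j)))"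
proof (induction k arbitrary: b)
  case 0 then show ?case by (simp add: itemsum_def)
next
  case (Suc k)
  obtain b' where b: "b = Suc b'" using Suc.prems by (cases b) auto
  then have "(\<Sum>j = b - Suc k..<b. snd (snd (f j))) = (\<Sum>j = b' - k..<b'. snd (snd (f j))) + snd (snd (f b'))"
    by simp
  moreover have "itemsum (z # zs) = snd (snd z) + itemsum zs" for z zs by (simp add: itemsum_def)
  ultimately show ?case unfolding b map_down_Suc using Suc b by simp
qed

text \<open>The intervals of a chain partition \<open>[0, b)\<close>; hence the second stage meets
  the weight of each block only once.\<close>

lemma chain_sum: "(\<Sum>c\<leftarrow>chain b. \<Sum>j = c - low c..<c. f j) = (\<Sum>j<b. f j :: nat)"
proof (induction b rule: less_induct)
  case (less b)
  show ?case
  proof (cases "b = 0")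
    case False
    then have "b - low b < b" using low_pos[of b] by simp
    moreover have "{..<b} = {..<b - low b} \<union> {b - low b..<b}" using low_le[of b] False by auto
    then have "(\<Sum>j<b. f j) = (\<Sum>j<b - low b. f j) + (\<Sum>j = b - low b..<b. f j)"
      by (simp add: sum.union_disjoint ivl_disj_int)
    ultimately show ?thesis using less False by (simp add: chain_unfold)
  qed simp
qed

lemma xit_props:
  assumes "0 < b" "b \<le> nb (length al)"
  shows "xit al b \<noteq> []" "length (xit al b) = low b" "\<forall>x\<in>set (xit al b). snd (snd x) \<le> 2 ^ (3 * lg (length al))"
    "itemsum (xit al b) = (\<Sum>j = b - low b..<b. bw al j)"
proof -
  show "xit al b \<noteq> []" "length (xit al b) = low b" using low_pos[of b] by (auto simp: xit_def)
  show "\<forall>x\<in>set (xit al b). snd (snd x) \<le> 2 ^ (3 * lg (length al))"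
  proof
    fix x assume "x \<in> set (xit al b)"
    then obtain j where "x = blk al j" by (auto simp: xit_def)
    moreover obtain e where "bw al j = 2 ^ e" "e \<le> 3 * lg (length al)" using bw_power by blast
    ultimately show "snd (snd x) \<le> 2 ^ (3 * lg (length al))" by (simp add: blk_def)
  qed
  show "itemsum (xit al b) = (\<Sum>j = b - low b..<b. bw al j)"
    unfolding xit_def using itemsum_down[OF low_le[OF assms(1)], of "blk al"] by (simp add: blk_def)
qed

lemma xcond':
  assumes "3 \<le> length al" "0 < b" "b \<le> nb (length al)"
  shows "4 * (xexp (length al) + 1) * length (xit al b) \<le> 2 ^ xexp (length al)"
    "32 * (xexp (length al) + 1) * length (xit al b) \<le> 2 ^ xexp (length al)"
proof -
  have "32 * (xexp (length al) + 1) * low b \<le> 2 ^ xexp (length al)"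
    using assms low_le[OF assms(2)] by (intro xcond) auto
  then show 32: "32 * (xexp (length al) + 1) * length (xit al b) \<le> 2 ^ xexp (length al)"
    unfolding xit_props(2)[OF assms(2,3)] .
  show "4 * (xexp (length al) + 1) * length (xit al b) \<le> 2 ^ xexp (length al)"
    by (rule le_trans[OF _ 32], intro mult_right_mono) auto
qed

lemmas gx_ok = gform_ok[OF xit_props(1) _ xit_props(3) xcond'(1), folded gx_def px_def wx_def]

lemma scal_le: "fst (scal M q f ls) \<le> q * 2 ^ f"
proof (induction M q f ls rule: scal.induct)
  case (2 M q f ls)
  have "q \<le> q * 2 ^ Suc f" by simp
  then show ?case using 2 by (auto simp: algebra_simps)
qed simp

lemma wx_le: "wx al b \<le> 2 ^ (4 * lg (length al) + 7)"
proof -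
  have "wx al b \<le> 2 ^ (3 * lg (length al)) * 2 ^ xexp (length al)"
    unfolding wx_def wform_def using scal_le[of _ 1] by (intro mult_right_mono) auto
  also have "\<dots> = 2 ^ (4 * lg (length al) + 7)" by (simp add: xexp_def power_add[symmetric])
  finally show ?thesis .
qed

lemma yit_props:
  assumes "0 < b" "b \<le> nb (length al)"
  shows "yit al b \<noteq> []" "length (yit al b) = length (chain b)"
    "\<forall>x\<in>set (yit al b). snd (snd x) \<le> 2 ^ (4 * lg (length al) + 7)"
    "itemsum (yit al b) = (\<Sum>c\<leftarrow>chain b. wx al c)"
  using assms(1) wx_le by (auto simp: yit_def chain_unfold itemsum_def comp_def)

lemma ycond':
  assumes "3 \<le> length al" "0 < b" "b \<le> nb (length al)"
  shows "4 * (yexp (length al) + 1) * length (yit al b) \<le> 2 ^ yexp (length al)"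
    "32 * (yexp (length al) + 1) * length (yit al b) \<le> 2 ^ yexp (length al)"
proof -
  have "32 * (yexp (length al) + 1) * length (chain b) \<le> 2 ^ yexp (length al)"
    using assms by (intro ycond) auto
  then show 32: "32 * (yexp (length al) + 1) * length (yit al b) \<le> 2 ^ yexp (length al)"
    unfolding yit_props(2)[OF assms(2,3)] .
  show "4 * (yexp (length al) + 1) * length (yit al b) \<le> 2 ^ yexp (length al)"
    by (rule le_trans[OF _ 32], intro mult_right_mono) auto
qed

lemmas gy_ok = gform_ok[OF yit_props(1) _ yit_props(3) ycond'(1), folded gy_def]

definition wy :: "times \<Rightarrow> nat \<Rightarrow> nat" where
  "wy al b = wform (2 ^ yexp (length al)) (4 * lg (length al) + 7) (yit al b)"

lemma wx_bound:
  assumes "3 \<le> length al" "0 < b" "b \<le> nb (length al)"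
  shows "7 * wx al b \<le> 7 * 2 ^ xexp (length al) + 64 * (xexp (length al) + 1) * (\<Sum>j = b - low b..<b. bw al j)"
  using wform_bound[OF xcond'(2)[OF assms]] xit_props[OF assms(2,3)] by (simp add: wx_def)

lemma bw_sum: "(\<Sum>j<b. bw al j) \<le> (\<Sum>i<b * bs (length al). ew al i)"
proof (induction b)
  case (Suc b)
  let ?L = "bs (length al)"
  have "(\<Sum>i<Suc b * ?L. ew al i) = (\<Sum>i<b * ?L. ew al i) + (\<Sum>i = b * ?L..<Suc b * ?L. ew al i)"
    unfolding lessThan_atLeast0 by (rule sum.atLeastLessThan_concat[symmetric]) auto
  then show ?case using Suc bw_le_sum[of al b] by simp
qed simp

text \<open>\<open>wform_bound\<close> for the intervals is inserted into \<open>wform_bound\<close>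
  for the chain, whence \<open>49 = 7 * 7\<close> and \<open>64 * 64\<close>. The at most
  \<open>lg n\<close> items of a chain each bring the additive term
  \<open>2 ^ xexp n\<close>.\<close>

lemma wy_bound:
  assumes "3 \<le> length al" "0 < b" "b \<le> nb (length al)"
  defines "n \<equiv> length al"
  shows "49 * wy al b \<le> 49 * 2 ^ yexp n + 64 * (yexp n + 1) *
    (7 * lg n * 2 ^ xexp n + 64 * (xexp n + 1) * (\<Sum>i<n. ew al i))"
proof -
  have "7 * wy al b \<le> 7 * 2 ^ yexp n + 64 * (yexp n + 1) * (\<Sum>c\<leftarrow>chain b. wx al c)"
    using wform_bound[OF ycond'(2)[OF assms(1-3)]] yit_props[OF assms(2,3)] by (simp add: wy_def n_def)
  moreover have "7 * (\<Sum>c\<leftarrow>chain b. wx al c) \<le> 7 * lg n * 2 ^ xexp n + 64 * (xexp n + 1) * (\<Sum>i<n. ew al i)"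
  proof -
    have "7 * (\<Sum>c\<leftarrow>chain b. wx al c) = (\<Sum>c\<leftarrow>chain b. 7 * wx al c)"
      by (simp add: sum_list_const_mult)
    also have "\<dots> \<le> (\<Sum>c\<leftarrow>chain b. 7 * 2 ^ xexp n + 64 * (xexp n + 1) * (\<Sum>j = c - low c..<c. bw al j))"
    proof (rule sum_list_mono)
      fix c assume "c \<in> set (chain b)"
      then show "7 * wx al c \<le> 7 * 2 ^ xexp n + 64 * (xexp n + 1) * (\<Sum>j = c - low c..<c. bw al j)"
        unfolding n_def using assms(1,3) chain_bounds[of c b] by (intro wx_bound) auto
    qed
    also have "\<dots> = length (chain b) * (7 * 2 ^ xexp n) + 64 * (xexp n + 1) * (\<Sum>j<b. bw al j)"
      by (simp only: sum_list_addf sum_list_const_mult sum_list_triv chain_sum) simp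
    also have "\<dots> \<le> lg n * (7 * 2 ^ xexp n) + 64 * (xexp n + 1) * (\<Sum>i<n. ew al i)"
    proof (intro add_mono mult_right_mono mult_left_mono)
      have "length (chain b) \<le> lg n - lam n"
        by (rule chain_length) (use nb_less[of n] assms n_def in simp)
      then show "length (chain b) \<le> lg n" by simp
      have "(\<Sum>j<b. bw al j) \<le> (\<Sum>i<b * bs n. ew al i)" unfolding n_def by (rule bw_sum)
      also have "b * bs n \<le> n" using nb_bound[of n] assms(1) mult_le_mono1[OF assms(3), of "bs n"] unfolding n_def by linarith
      then have "(\<Sum>i<b * bs n. ew al i) \<le> (\<Sum>i<n. ew al i)" by (intro sum_mono2) auto
      finally show "(\<Sum>j<b. bw al j) \<le> (\<Sum>i<n. ew al i)" .
    qed auto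
    finally show ?thesis by (simp add: algebra_simps)
  qed
  then have "64 * (yexp n + 1) * (7 * (\<Sum>c\<leftarrow>chain b. wx al c)) \<le>
     64 * (yexp n + 1) * (7 * lg n * 2 ^ xexp n + 64 * (xexp n + 1) * (\<Sum>i<n. ew al i))"
    by (rule mult_left_mono) simp
  ultimately show ?thesis by linarith
qed

section \<open>Well-formedness of the circuit\<close>

definition itemv :: "nat \<Rightarrow> item list \<Rightarrow> bool" where
  "itemv k ls \<longleftrightarrow> (\<forall>x\<in>set ls. (\<exists>e. snd (snd x) = 2 ^ e) \<and> fst x < k \<and> fst (snd x) < k)"

text \<open>Arrival times can only be computed once the circuit is known to be acyclic. So
  \<open>gform_ok\<close> is first applied to the zero arrival function, for which
  \<open>timed\<close> says no more than that a weight is a power of two; this already gives the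
  vertex bounds.\<close>

lemma itemv_ok: "itemv k ls \<Longrightarrow> itemok (\<lambda>_. 0) 0 {..<k} ls"
  by (auto simp: itemv_def itemok_def timed_def)

lemma length_fsX [simp]: "length (fsX al) = 2 * nb (length al)"
  by (simp add: fsX_def)

lemma length_rX [simp]: "length (rX al) = 2 * nb (length al)"
  by (simp add: rX_def)

lemma length_fsY [simp]: "length (fsY al) = nb (length al)"
  by (simp add: fsY_def)

lemma length_rY [simp]: "length (rY al) = nb (length al)"
  by (simp add: rY_def)

lemma fsX_nth:
  assumes "0 < b" "b \<le> nb (length al)"
  shows "fsX al ! (b - 1) = gx al b" "fsX al ! (nb (length al) + b - 1) = px al b"
  using assms by (auto simp: fsX_def nth_append nth_upt simp del: upt_Suc)

lemma fsY_nth: "0 < b \<Longrightarrow> b \<le> nb (length al) \<Longrightarrow> fsY al ! (b - 1) = gy al b"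
  by (auto simp: fsY_def nth_upt simp del: upt_Suc)

lemma blk_less:
  assumes "j < nb (length al)" "3 \<le> length al"
  shows "j * bs (length al) + (bs (length al) - 1) < length al"
    "(j * bs (length al) + (bs (length al) - 1)) div bs (length al) = j"
    "(j * bs (length al) + (bs (length al) - 1)) mod bs (length al) = bs (length al) - 1"
proof -
  let ?L = "bs (length al)"
  have "Suc j * ?L \<le> nb (length al) * ?L" using assms(1) by (intro mult_le_mono1) simp
  then show "j * ?L + (?L - 1) < length al" using nb_bound[of "length al"] assms(2) bs_pos[of "length al"]
    by (simp add: algebra_simps)
  show "(j * ?L + (?L - 1)) div ?L = j" "(j * ?L + (?L - 1)) mod ?L = ?L - 1"
    using bs_pos[of "length al"] div_mult_self3[of ?L j "?L - 1"] mod_mult_self3[of j ?L "?L - 1"] by auto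
qed

lemma arr_less: "i < length al \<Longrightarrow> garr (length al) i < k0 al \<and> parr (length al) i < k0 al"
  by (auto simp: garr_def parr_def k0_def algebra_simps)

lemma xitv:
  assumes "3 \<le> length al" "0 < b" "b \<le> nb (length al)"
  shows "itemv (k0 al) (xit al b)"
proof -
  have "(\<exists>e. snd (snd (blk al j)) = 2 ^ e) \<and> fst (blk al j) < k0 al \<and> fst (snd (blk al j)) < k0 al"
    if "j < nb (length al)" for j
    using arr_less[OF blk_less(1)[OF that assms(1)]] bw_power[of al j] by (auto simp: blk_def)
  moreover have "b - Suc i < nb (length al)" for i using assms by simp
  ultimately show ?thesis unfolding itemv_def xit_def by auto
qed

lemma fsX_vars:
  assumes "3 \<le> length al"
  shows "\<forall>F\<in>set (fsX al). fvars F \<subseteq> {..<k0 al}"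
proof -
  have "fvars (gx al b) \<subseteq> {..<k0 al} \<and> fvars (px al b) \<subseteq> {..<k0 al}" if "0 < b" "b \<le> nb (length al)" for b
    using gx_ok(3,4)[OF that itemv_ok[OF xitv[OF assms that]] that assms that] by blast
  moreover have "\<exists>b. 0 < b \<and> b \<le> nb (length al) \<and> (F = gx al b \<or> F = px al b)" if "F \<in> set (fsX al)" for F
    using that by (auto simp: fsX_def Suc_le_eq simp del: upt_Suc)
  ultimately show ?thesis by blast
qed

lemma rX_less:
  assumes "3 \<le> length al" "i < 2 * nb (length al)"
  shows "geta 0 (rX al) i < k1 al"
  using roots_less[OF fsX_vars[OF assms(1)] le_refl, of "rX al ! i"] assms(2)
  by (simp add: geta_nth k1_def rX_def)

lemma wx_power:
  assumes "3 \<le> length al" "0 < b" "b \<le> nb (length al)"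
  shows "\<exists>e. wx al b = 2 ^ e"
  using gx_ok(1)[OF assms(2,3) itemv_ok[OF xitv[OF assms]] assms(2,3) assms] by (auto simp: timed_def)

lemma yitv:
  assumes "3 \<le> length al" "0 < b" "b \<le> nb (length al)"
  shows "itemv (k1 al) (yit al b)"
  unfolding itemv_def
proof
  fix x assume "x \<in> set (yit al b)"
  then obtain c where c: "c \<in> set (chain b)" and
    x: "x = (geta 0 (rX al) (c - 1), geta 0 (rX al) (nb (length al) + c - 1), wx al c)"
    by (auto simp: yit_def)
  have "0 < c" "c \<le> nb (length al)" using chain_bounds[OF c] assms by auto
  then show "(\<exists>e. snd (snd x) = 2 ^ e) \<and> fst x < k1 al \<and> fst (snd x) < k1 al"
    unfolding x using assms(1) by (auto intro!: rX_less wx_power)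
qed

lemma fsY_vars:
  assumes "3 \<le> length al"
  shows "\<forall>F\<in>set (fsY al). fvars F \<subseteq> {..<k1 al}"
proof -
  have "fvars (gy al b) \<subseteq> {..<k1 al}" if "0 < b" "b \<le> nb (length al)" for b
    using gy_ok(3)[OF that itemv_ok[OF yitv[OF assms that]] that assms that] by blast
  moreover have "\<exists>b. 0 < b \<and> b \<le> nb (length al) \<and> F = gy al b" if "F \<in> set (fsY al)" for F
    using that by (auto simp: fsY_def Suc_le_eq simp del: upt_Suc)
  ultimately show ?thesis by blast
qed

lemma rY_less:
  assumes "3 \<le> length al" "i < nb (length al)"
  shows "geta 0 (rY al) i < k2 al"
  using roots_less[OF fsY_vars[OF assms(1)] le_refl, of "rY al ! i"] assms(2)
  by (simp add: geta_nth k2_def rY_def)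

lemma div_nb:
  assumes "i < length al" "bs (length al) \<le> i"
  shows "0 < i div bs (length al)" "i div bs (length al) \<le> nb (length al)"
  using assms bs_pos[of "length al"] by (auto simp: nb_def div_greater_zero_iff intro: div_le_mono)

lemma fsZ_vars:
  assumes "3 \<le> length al"
  shows "\<forall>F\<in>set (fsZ al). fvars F \<subseteq> {..<k2 al}"
proof
  fix F assume "F \<in> set (fsZ al)"
  then obtain i where i: "i < length al" "F = zf al i" by (auto simp: fsZ_def)
  have "garr (length al) i < k2 al" "parr (length al) i < k2 al"
    using arr_less[OF i(1)] by (auto simp: k2_def k1_def)
  then show "fvars F \<subseteq> {..<k2 al}" unfolding i(2) zf_def Let_def
    using rY_less[OF assms, of "i div bs (length al) - 1"] div_nb[OF i(1)] by auto
qed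

lemma circ_segs:
  "seg (circ al) 0 (layers (length al) (bs (length al)) (lam (length al)))"
  "seg (circ al) (k0 al) (flats (k0 al) (fsX al))"
  "seg (circ al) (k1 al) (flats (k1 al) (fsY al))"
  "seg (circ al) (k2 al) (flats (k2 al) (fsZ al))"
  using seg_all[of "circ al", OF refl]
  by (simp_all add: circ_def seg_append k0_def k1_def k2_def)

lemma circ_topo:
  assumes "3 \<le> length al"
  shows "topo 0 (nodes (circ al))"
proof -
  have "topo 0 (layers (length al) (bs (length al)) (lam (length al)))" by (rule topo_layers)
  moreover have "topo (k0 al) (flats (k0 al) (fsX al))" by (rule topo_flats[OF le_refl fsX_vars[OF assms]])
  moreover have "topo (k1 al) (flats (k1 al) (fsY al))" by (rule topo_flats[OF le_refl fsY_vars[OF assms]])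
  moreover have "topo (k2 al) (flats (k2 al) (fsZ al))" by (rule topo_flats[OF le_refl fsZ_vars[OF assms]])
  ultimately show ?thesis by (simp add: circ_def topo_append k0_def k1_def k2_def)
qed

lemma length_nodes: "length (nodes (circ al)) = k2 al + size_fms (fsZ al)"
  by (simp add: circ_def k0_def k1_def k2_def)

lemma circ_inputs: "{z \<in> set (nodes (circ al)). \<not> is_gate z} = Input ` signals (length al)"
  using layers_inputs[of "length al" "bs (length al)" "lam (length al)"]
  by (auto simp: circ_def dest: flats_gates)

lemma circ_wf:
  assumes "3 \<le> length al"
  shows "wf_circuit (circ al)"
proof (rule topo_wf[OF circ_topo[OF assms]])
  show "outputs (circ al) \<noteq> []" using assms by (cases al) (auto simp: circ_def fsZ_def upt_conv_Cons simp del: upt_Suc)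
  show "set (outputs (circ al)) \<subseteq> verts (circ al)"
    using roots_less[OF fsZ_vars[OF assms] le_refl] by (auto simp: verts_def length_nodes) (auto simp: circ_def)
  fix i j x
  assume ij: "i < length (nodes (circ al))" "j < length (nodes (circ al))"
    and x: "nodes (circ al) ! i = Input x" "nodes (circ al) ! j = Input x"
  let ?ls = "layers (length al) (bs (length al)) (lam (length al))"
  let ?fs = "flats (k0 al) (fsX al) @ flats (k1 al) (fsY al) @ flats (k2 al) (fsZ al)"
  have C: "nodes (circ al) = ?ls @ ?fs" by (simp add: circ_def)
  have g: "i < length ?ls \<and> ?ls ! i = Input x" if "i < length (nodes (circ al))" "nodes (circ al) ! i = Input x" for i
  proof (rule ccontr)
    assume n: "\<not> (i < length ?ls \<and> ?ls ! i = Input x)"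
    then have "i \<ge> length ?ls" "nodes (circ al) ! i = ?fs ! (i - length ?ls)" "i - length ?ls < length ?fs"
      using that unfolding C nth_append length_append by (auto split: if_splits)
    then have "Input x \<in> set ?fs" using that nth_mem by metis
    then show False by (auto dest: flats_gates)
  qed
  show "i = j" using layers_distinct[of i "lam (length al)" "length al" j "bs (length al)" x] g[OF ij(1) x(1)] g[OF ij(2) x(2)]
    by simp
qed

section \<open>Number of gates of each stage\<close>

lemma circ_size:
  "circuit_size (circ al) = 3 * lam (length al) * length al + size_fms (fsX al) + size_fms (fsY al) + size_fms (fsZ al)"
proof -
  have "circuit_size (circ al) = length (filter is_gate (nodes (circ al)))"
    by (simp add: circuit_size_def verts_def length_filter_conv_card)
  moreover have "filter is_gate (flats k Fs) = flats k Fs" for k Fs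
    by (rule filter_True) (auto dest: flats_gates)
  ultimately show ?thesis by (simp add: circ_def layers_count)
qed

text \<open>The two formulas of an interval of \<open>low b\<close> items have at most
  \<open>low b * (lg n + 10)\<close> gates, namely \<open>xexp n + 2\<close> per item for generate
  and one for propagate; \<open>low_sum\<close> then adds up the \<open>low b\<close>.\<close>

lemma size_fsX:
  assumes "3 \<le> length al"
  defines "n \<equiv> length al"
  shows "2 * size_fms (fsX al) \<le> (lg n + 10) * (nb n * (lg n - lam n + 1))"
proof -
  have "gates (gx al b) + gates (px al b) \<le> low b * (lg n + 10)" if b: "0 < b" "b \<le> nb n" for b
  proof -
    have "gates (gx al b) \<le> (low b - 1) * (lg n + 9)" "gates (px al b) = low b - 1"
      using gx_ok(7,8)[OF b[unfolded n_def] itemv_ok[OF xitv[OF assms(1) b[unfolded n_def]]] b[unfolded n_def] assms(1) b[unfolded n_def]]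
        xit_props(2)[OF b[unfolded n_def]] by (auto simp: xexp_def n_def algebra_simps)
    moreover have "(low b - 1) * (lg n + 9) \<le> low b * (lg n + 9)" by (rule mult_right_mono) auto
    ultimately show ?thesis by (simp add: algebra_simps)
  qed
  then have "(\<Sum>b = 1..nb n. gates (gx al b) + gates (px al b)) \<le> (\<Sum>b = 1..nb n. low b) * (lg n + 10)"
    unfolding sum_distrib_right by (intro sum_mono) auto
  moreover have "size_fms (fsX al) = (\<Sum>b = 1..nb n. gates (gx al b) + gates (px al b))"
    by (simp add: fsX_def size_fms_def comp_def n_def sum.distrib interv_sum_list_conv_sum_set_nat
        atLeastLessThanSuc_atLeastAtMost del: upt_Suc)
  ultimately have "2 * size_fms (fsX al) \<le> (lg n + 10) * (2 * (\<Sum>b = 1..nb n. low b))"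
    by (simp add: mult.commute)
  also have "\<dots> \<le> (lg n + 10) * (nb n * (lg n - lam n + 1))"
    using low_sum[of "nb n" "lg n - lam n"] nb_less[of n] assms by (intro mult_left_mono) auto
  finally show ?thesis .
qed

text \<open>A chain has at most \<open>lg n - lam n\<close> items, with at most
  \<open>yexp n + 2 = 2 * lam n + 9\<close> gates per item.\<close>

lemma size_fsY:
  assumes "3 \<le> length al"
  defines "n \<equiv> length al"
  shows "size_fms (fsY al) \<le> nb n * ((lg n - lam n) * (2 * lam n + 9))"
proof -
  have "gates (gy al b) \<le> (lg n - lam n) * (2 * lam n + 9)" if b: "0 < b" "b \<le> nb n" for b
  proof -
    have "gates (gy al b) \<le> (length (chain b) - 1) * (yexp n + 2)"
      using gy_ok(7)[OF b[unfolded n_def] itemv_ok[OF yitv[OF assms(1) b[unfolded n_def]]] b[unfolded n_def] assms(1) b[unfolded n_def]]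
        yit_props(2)[OF b[unfolded n_def]] by (auto simp: n_def)
    also have "length (chain b) \<le> lg n - lam n"
      by (rule chain_length) (use nb_less[of n] assms b in simp)
    then have "(length (chain b) - 1) * (yexp n + 2) \<le> (lg n - lam n) * (2 * lam n + 9)"
      by (intro mult_mono) (auto simp: yexp_def)
    finally show ?thesis .
  qed
  then have "(\<Sum>b = 1..nb n. gates (gy al b)) \<le> (\<Sum>b = 1..nb n. (lg n - lam n) * (2 * lam n + 9))"
    by (intro sum_mono) auto
  then show ?thesis
    by (simp add: fsY_def size_fms_def comp_def n_def interv_sum_list_conv_sum_set_nat
        atLeastLessThanSuc_atLeastAtMost del: upt_Suc)
qed

lemma size_fsZ: "size_fms (fsZ al) \<le> 2 * length al" "nb (length al) = 0 \<Longrightarrow> size_fms (fsZ al) = 0"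
proof -
  have "gates (zf al i) \<le> 2" for i by (simp add: zf_def Let_def)
  then have "(\<Sum>i\<leftarrow>[0..<length al]. gates (zf al i)) \<le> (\<Sum>i\<leftarrow>[0..<length al]. 2)"
    by (intro sum_list_mono) auto
  then show "size_fms (fsZ al) \<le> 2 * length al" by (simp add: fsZ_def size_fms_def comp_def sum_list_triv)
  assume "nb (length al) = 0"
  then have "length al - 1 < bs (length al)" using bs_pos[of "length al"] by (simp add: nb_def div_eq_0_iff)
  then have "gates (zf al i) = 0" if "i < length al" for i using that by (simp add: zf_def Let_def)
  then show "size_fms (fsZ al) = 0" by (auto simp: fsZ_def size_fms_def)
qed

text \<open>The time that weight 1 stands for: the largest weight \<open>2 ^ (3 * lg n)\<close> is
  then \<open>amax\<close>. It may be negative, which is why times are integers here.\<close>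

definition base :: "times \<Rightarrow> int" where
  "base al = int (amax al) - 3 * int (lg (length al))"

section \<open>Values and arrival times, stage by stage\<close>

definition arrivals :: "nat \<Rightarrow> (signal \<Rightarrow> nat) \<Rightarrow> times" where
  "arrivals n a = map (\<lambda>i. (a (P i), a (G i))) [0..<n]"

lemma length_arrivals [simp]: "length (arrivals n a) = n"
  by (simp add: arrivals_def)

lemma geta_arrivals: "i < n \<Longrightarrow> geta d (arrivals n a) i = (a (P i), a (G i))"
  by (simp add: geta_nth) (simp add: arrivals_def)

lemma arrivals_le: "i < n \<Longrightarrow> a (P i) \<le> amax (arrivals n a) \<and> a (G i) \<le> amax (arrivals n a)"
  using le_amax[of "(a (P i), a (G i))" "arrivals n a"] by (force simp: arrivals_def)

lemma circ_layers:
  fixes n a defines "al \<equiv> arrivals n a" defines "C \<equiv> circ al"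
  assumes n: "3 \<le> n" and i: "i < n"
    and \<beta>: "\<And>j. j < n \<Longrightarrow> int (a (P j)) \<le> \<beta> (j div bs n) \<and> int (a (G j)) \<le> \<beta> (j div bs n)"
  shows "vertex_value C x (parr n i) = pspan x (i - i mod bs n) (Suc i)"
    "vertex_value C x (garr n i) = gspan x (i - i mod bs n) (Suc i)"
    "int (arrival C a (parr n i)) \<le> \<beta> (i div bs n) + 2 * int (lam n)"
    "int (arrival C a (garr n i)) \<le> \<beta> (i div bs n) + 2 * int (lam n)"
proof -
  have "wf_circuit C" "seg C 0 (layers n (bs n) (lam n))"
    using circ_wf[of al] circ_segs(1)[of al] n by (auto simp: C_def al_def)
  from layers_correct[where \<beta> = \<beta>, OF this bs_pos _ le_refl i, where a = a and x = x] \<beta>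
  show "vertex_value C x (parr n i) = pspan x (i - i mod bs n) (Suc i)"
    "vertex_value C x (garr n i) = gspan x (i - i mod bs n) (Suc i)"
    "int (arrival C a (parr n i)) \<le> \<beta> (i div bs n) + 2 * int (lam n)"
    "int (arrival C a (garr n i)) \<le> \<beta> (i div bs n) + 2 * int (lam n)"
    using start_full[OF bs_pos[of n], of "lam n" i] unfolding parr_def garr_def by (auto simp: bs_def)
qed

lemma ew_timed:
  assumes "i < n"
  shows "\<exists>e. ew (arrivals n a) i = 2 ^ e \<and> int (a (P i)) \<le> int e + base (arrivals n a) \<and>
    int (a (G i)) \<le> int e + base (arrivals n a)"
proof -
  let ?m = "amax (arrivals n a)"
  define u v where "u = 3 * lg n - (?m - a (P i))" and "v = 3 * lg n - (?m - a (G i))"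
  have "ew (arrivals n a) i = max (2 ^ u) (2 ^ v)"
    using assms by (simp add: ew_eq geta_arrivals u_def v_def)
  also have "\<dots> = 2 ^ max u v" by (simp add: max_def)
  finally show ?thesis using arrivals_le[OF assms, of a]
    by (intro exI[of _ "max u v"]) (auto simp: base_def u_def v_def)
qed

text \<open>Doubling delays everything by \<open>2 * lam n\<close>. This goes into the offset, so a
  block keeps the weight \<open>bw\<close> of its own inputs.\<close>

lemma blk_ok:
  fixes n a defines "al \<equiv> arrivals n a" defines "C \<equiv> circ al"
  assumes n: "3 \<le> n" and j: "j < nb n"
  shows "vertex_value C x (fst (blk al j)) = gspan x (j * bs n) (Suc j * bs n)"
    "vertex_value C x (fst (snd (blk al j))) = pspan x (j * bs n) (Suc j * bs n)"
    "timed (base al + 2 * int (lam n)) (int (arrival C a (fst (blk al j)))) (snd (snd (blk al j)))"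
    "timed (base al + 2 * int (lam n)) (int (arrival C a (fst (snd (blk al j))))) (snd (snd (blk al j)))"
proof -
  let ?i = "j * bs n + (bs n - 1)"
  have i: "?i < n" "?i div bs n = j" "?i mod bs n = bs n - 1"
    using blk_less[of j al] n j by (auto simp: al_def)
  obtain e where e: "\<And>b. bw al b = 2 ^ e b" using bw_power[of al] by metis
  have \<beta>: "int (a (P k)) \<le> int (e (k div bs n)) + base al \<and> int (a (G k)) \<le> int (e (k div bs n)) + base al" if k: "k < n" for k
  proof -
    obtain f where f: "ew al k = 2 ^ f" "int (a (P k)) \<le> int f + base al" "int (a (G k)) \<le> int f + base al"
      using ew_timed[OF k, of a] unfolding al_def by auto
    have "(2::nat) ^ f \<le> 2 ^ e (k div bs n)" using ew_le_bw[of al k] f(1) e by (simp add: al_def)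
    then have "f \<le> e (k div bs n)" by simp
    then show ?thesis using f by auto
  qed
  have s: "?i - ?i mod bs n = j * bs n" "Suc ?i = Suc j * bs n"
    unfolding i(3) using bs_pos[of n] by auto
  have b: "fst (blk al j) = garr n ?i" "fst (snd (blk al j)) = parr n ?i" "snd (snd (blk al j)) = 2 ^ e j"
    using e by (auto simp: blk_def al_def)
  note L = circ_layers[OF n i(1), where \<beta> = "\<lambda>b. int (e b) + base al" and a = a, OF \<beta>, folded al_def C_def, unfolded s i(2)]
  show "vertex_value C x (fst (blk al j)) = gspan x (j * bs n) (Suc j * bs n)"
    "vertex_value C x (fst (snd (blk al j))) = pspan x (j * bs n) (Suc j * bs n)"
    unfolding b using L(1,2) by auto
  show "timed (base al + 2 * int (lam n)) (int (arrival C a (fst (blk al j)))) (snd (snd (blk al j)))"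
    "timed (base al + 2 * int (lam n)) (int (arrival C a (fst (snd (blk al j))))) (snd (snd (blk al j)))"
    unfolding b timed_def using L(3,4) by (auto intro!: exI[of _ "e j"])
qed

lemma stage_X:
  fixes n a defines "al \<equiv> arrivals n a" defines "C \<equiv> circ al"
  assumes n: "3 \<le> n" and b: "0 < b" "b \<le> nb n"
  shows "vertex_value C x (geta 0 (rX al) (b - 1)) = gspan x ((b - low b) * bs n) (b * bs n)"
    "vertex_value C x (geta 0 (rX al) (nb n + b - 1)) = pspan x ((b - low b) * bs n) (b * bs n)"
    "timed (base al + 2 * int (lam n)) (int (arrival C a (geta 0 (rX al) (b - 1)))) (wx al b)"
    "timed (base al + 2 * int (lam n)) (int (arrival C a (geta 0 (rX al) (nb n + b - 1)))) (wx al b)"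
proof -
  let ?c = "base al + 2 * int (lam n)"
  let ?r = "\<lambda>v. int (arrival C a v)"
  have nal: "length al = n" "3 \<le> length al" "b \<le> nb (length al)" using n b by (auto simp: al_def)
  have wf: "wf_circuit C" using circ_wf nal by (simp add: C_def)
  have seg: "seg C (k0 al) (flats (k0 al) (fsX al))" unfolding C_def by (rule circ_segs)
  have "itemok ?r ?c UNIV (xit al b)"
    unfolding itemok_def
  proof
    fix z assume "z \<in> set (xit al b)"
    then obtain i where "z = blk al (b - 1 - i)" by (auto simp: xit_def)
    then obtain j where "j < nb n" "z = blk al j" using b that[of "b - 1 - i"] by simp
    then show "timed ?c (?r (fst z)) (snd (snd z)) \<and> timed ?c (?r (fst (snd z))) (snd (snd z)) \<and>
      fst z \<in> UNIV \<and> fst (snd z) \<in> UNIV"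
      using blk_ok(3,4)[OF n, of j a] by (simp add: al_def C_def)
  qed
  note g = gx_ok[OF b(1) nal(3) this b(1) nal(3) nal(2) b(1) nal(3)]
  have idx: "b - 1 < length (fsX al)" "nb n + b - 1 < length (fsX al)" using b nal by auto
  have nth: "geta 0 (rX al) (b - 1) = roots (k0 al) (fsX al) ! (b - 1)"
    "geta 0 (rX al) (nb n + b - 1) = roots (k0 al) (fsX al) ! (nb n + b - 1)"
    using idx by (auto simp: geta_nth rX_def)
  have F: "fsX al ! (b - 1) = gx al b" "fsX al ! (nb n + b - 1) = px al b"
    using fsX_nth[OF b(1) nal(3)] nal by auto
  note v = flats_correct(1)[OF wf seg idx(1), of x] flats_correct(2)[OF wf seg idx(1), of a]
    flats_correct(1)[OF wf seg idx(2), of x] flats_correct(2)[OF wf seg idx(2), of a]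
  have G: "gcomb (vertex_value C x) (xit al b) = gspan x ((b - low b) * bs n) (b * bs n)"
    unfolding xit_def by (rule gcomb_span)
      (use blk_ok(1,2)[OF n, of _ a x] b low_le[OF b(1)] in \<open>auto simp: al_def C_def\<close>)
  have Pp: "pcomb (vertex_value C x) (xit al b) = pspan x ((b - low b) * bs n) (b * bs n)"
    unfolding xit_def by (rule pcomb_span)
      (use blk_ok(1,2)[OF n, of _ a x] b low_le[OF b(1)] in \<open>auto simp: al_def C_def\<close>)
  show "vertex_value C x (geta 0 (rX al) (b - 1)) = gspan x ((b - low b) * bs n) (b * bs n)"
    "vertex_value C x (geta 0 (rX al) (nb n + b - 1)) = pspan x ((b - low b) * bs n) (b * bs n)"
    "timed ?c (?r (geta 0 (rX al) (b - 1))) (wx al b)"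
    "timed ?c (?r (geta 0 (rX al) (nb n + b - 1))) (wx al b)"
    unfolding nth v F using g G Pp by auto
qed

lemma stage_Y:
  fixes n a defines "al \<equiv> arrivals n a" defines "C \<equiv> circ al"
  assumes n: "3 \<le> n" and b: "0 < b" "b \<le> nb n"
  shows "vertex_value C x (geta 0 (rY al) (b - 1)) = gspan x 0 (b * bs n)"
    "timed (base al + 2 * int (lam n)) (int (arrival C a (geta 0 (rY al) (b - 1)))) (wy al b)"
proof -
  let ?c = "base al + 2 * int (lam n)"
  let ?r = "\<lambda>v. int (arrival C a v)"
  have nal: "length al = n" "3 \<le> length al" "b \<le> nb (length al)" using n b by (auto simp: al_def)
  have wf: "wf_circuit C" using circ_wf nal by (simp add: C_def)
  have seg: "seg C (k1 al) (flats (k1 al) (fsY al))" unfolding C_def by (rule circ_segs)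
  have "itemok ?r ?c UNIV (yit al b)"
    unfolding itemok_def
  proof
    fix z assume "z \<in> set (yit al b)"
    then obtain c where c: "c \<in> set (chain b)" and
      z: "z = (geta 0 (rX al) (c - 1), geta 0 (rX al) (nb n + c - 1), wx al c)"
      using nal by (auto simp: yit_def)
    have "0 < c" "c \<le> nb n" using chain_bounds[OF c] b by auto
    then show "timed ?c (?r (fst z)) (snd (snd z)) \<and> timed ?c (?r (fst (snd z))) (snd (snd z)) \<and>
      fst z \<in> UNIV \<and> fst (snd z) \<in> UNIV"
      using stage_X(3,4)[OF n, of c a] by (simp add: al_def C_def z)
  qed
  note g = gy_ok[OF b(1) nal(3) this b(1) nal(3) nal(2) b(1) nal(3)]
  have idx: "b - 1 < length (fsY al)" using b nal by auto
  have nth: "geta 0 (rY al) (b - 1) = roots (k1 al) (fsY al) ! (b - 1)"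
    using idx by (auto simp: geta_nth rY_def)
  have F: "fsY al ! (b - 1) = gy al b" using fsY_nth[OF b(1) nal(3)] by auto
  note v = flats_correct(1)[OF wf seg idx, of x] flats_correct(2)[OF wf seg idx, of a]
  have "gcomb (vertex_value C x) (yit al b) = gspan x 0 (b * bs n)"
    unfolding yit_def by (rule gcomb_chain)
      (use stage_X(1,2)[OF n, of _ a x] b nal in \<open>auto simp: al_def C_def\<close>)
  then show "vertex_value C x (geta 0 (rY al) (b - 1)) = gspan x 0 (b * bs n)"
    "timed ?c (?r (geta 0 (rY al) (b - 1))) (wy al b)"
    unfolding nth v F using g by (auto simp: wy_def gy_def)
qed

text \<open>In a later block the exponent is the larger of that of the incoming carry and
  \<open>3 * lg n\<close>; the latter covers the signals of the block itself, bounded through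
  \<open>amax\<close>. The 2 is for the two merging gates.\<close>

lemma stage_Z:
  fixes n a defines "al \<equiv> arrivals n a" defines "C \<equiv> circ al"
  assumes n: "3 \<le> n" and i: "i < n"
  shows "vertex_value C x (outputs C ! i) = carry x (Suc i)"
    "i < bs n \<Longrightarrow> int (arrival C a (outputs C ! i)) \<le> int (amax al) + 2 * int (lam n)"
    "bs n \<le> i \<Longrightarrow> \<exists>e. int (arrival C a (outputs C ! i)) \<le> int e + base al + 2 * int (lam n) + 2 \<and>
       (2 ^ e = wy al (i div bs n) \<or> e = 3 * lg n)"
proof -
  let ?r = "\<lambda>v. int (arrival C a v)"
  have nal: "length al = n" "3 \<le> length al" using n by (auto simp: al_def)
  have wf: "wf_circuit C" using circ_wf nal by (simp add: C_def)
  have seg: "seg C (k2 al) (flats (k2 al) (fsZ al))" unfolding C_def by (rule circ_segs)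
  have idx: "i < length (fsZ al)" using i nal by (simp add: fsZ_def)
  have out: "outputs C ! i = roots (k2 al) (fsZ al) ! i" by (simp add: C_def circ_def)
  have F: "fsZ al ! i = zf al i" using i nal by (simp add: fsZ_def)
  note v = flats_correct(1)[OF wf seg idx, of x, unfolded F, folded out]
    flats_correct(2)[OF wf seg idx, of a, unfolded F, folded out]
  have am: "int (a (P j)) \<le> int (amax al) \<and> int (a (G j)) \<le> int (amax al)" if "j < n" for j
    using arrivals_le[OF that, of a] by (simp add: al_def)
  note L = circ_layers[OF n i, where \<beta> = "\<lambda>_. int (amax al)" and a = a, OF am, folded al_def C_def]
  show "i < bs n \<Longrightarrow> ?r (outputs C ! i) \<le> int (amax al) + 2 * int (lam n)"
    unfolding v using L nal by (simp add: zf_def Let_def)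
  define b where "b = i div bs n"
  have b: "0 < b" "b \<le> nb n" if "bs n \<le> i" using div_nb[of i al] that i nal by (auto simp: b_def)
  have ib: "i - i mod bs n = b * bs n" unfolding b_def by (simp add: minus_mod_eq_div_mult)
  show "vertex_value C x (outputs C ! i) = carry x (Suc i)"
  proof (cases "i < bs n")
    case True
    then have "i - i mod bs n = 0" by simp
    then show ?thesis unfolding v carry_gspan using L nal True by (simp add: zf_def Let_def)
  next
    case False
    have "gspan x 0 (Suc i) \<longleftrightarrow> gspan x (b * bs n) (Suc i) \<or> pspan x (b * bs n) (Suc i) \<and> gspan x 0 (b * bs n)"
      by (rule gspan_overlap) (auto simp: b_def intro: le_trans[OF div_times_less_eq_dividend])
    moreover have "vertex_value C x (geta 0 (rY al) (b - 1)) = gspan x 0 (b * bs n)"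
      using stage_Y(1)[OF n b] False unfolding al_def C_def by auto
    ultimately show ?thesis unfolding v carry_gspan using L(1,2) nal False
      by (simp add: zf_def Let_def ib flip: b_def)
  qed
  assume li: "bs n \<le> i"
  from stage_Y(2)[OF n b[OF li], of a, folded al_def C_def] obtain e where
    e: "wy al b = 2 ^ e" "?r (geta 0 (rY al) (b - 1)) \<le> int e + (base al + 2 * int (lam n))"
    by (auto simp: timed_def)
  have "?r (outputs C ! i) \<le> int (max e (3 * lg n)) + base al + 2 * int (lam n) + 2"
    unfolding v using L(3,4) e li nal by (auto simp: zf_def Let_def base_def simp flip: b_def)
  then show "\<exists>e. ?r (outputs C ! i) \<le> int e + base al + 2 * int (lam n) + 2 \<and>
       (2 ^ e = wy al (i div bs n) \<or> e = 3 * lg n)"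
    using e(1) by (intro exI[of _ "max e (3 * lg n)"]) (auto simp: max_def b_def)
qed

theorem circ_adder:
  assumes "3 \<le> n"
  shows "adder_circuit n (circ (arrivals n a))"
proof -
  let ?C = "circ (arrivals n a)"
  have len: "length (outputs ?C) = n" by (simp add: circ_def fsZ_def)
  have "\<exists>v\<in>set (outputs ?C). \<forall>x. vertex_value ?C x v = carry x i" if "i \<in> {1..n}" for i
    using stage_Z(1)[OF assms, of "i - 1" a] that len
    by (simp del: carry.simps, intro bexI[of _ "outputs ?C ! (i - 1)"] allI nth_mem) auto
  then show ?thesis using circ_wf[of "arrivals n a"] circ_inputs[of "arrivals n a"] assms
    by (auto simp: adder_circuit_def)
qed

lemma delay_le:
  assumes "3 \<le> n" "\<And>i. i < n \<Longrightarrow> arrival (circ (arrivals n a)) a (outputs (circ (arrivals n a)) ! i) \<le> D"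
  shows "delay (circ (arrivals n a)) a \<le> D"
proof -
  let ?C = "circ (arrivals n a)"
  have len: "length (outputs ?C) = n" by (simp add: circ_def fsZ_def)
  have "set (outputs ?C) \<noteq> {}" using len assms(1) by auto
  then show ?thesis unfolding delay_def using assms(2) len
    by (subst Max_le_iff) (auto simp: in_set_conv_nth)
qed

section \<open>Numerical estimates for delay and size\<close>

lemma log2_ge: "0 < c \<Longrightarrow> 2 ^ k \<le> c ^ m \<Longrightarrow> real k \<le> real m * log 2 c"
proof -
  assume c: "0 < c" "2 ^ k \<le> c ^ m"
  have "log 2 (2 ^ k) \<le> log 2 (c ^ m)" using c by (intro log_mono) auto
  then show ?thesis using c by (simp add: log_nat_power)
qed

lemma log2_le: "0 < c \<Longrightarrow> c ^ m \<le> 2 ^ k \<Longrightarrow> real m * log 2 c \<le> real k"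
proof -
  assume c: "0 < c" "c ^ m \<le> 2 ^ k"
  have "log 2 (c ^ m) \<le> log 2 (2 ^ k)" using c by (intro log_mono) auto
  then show ?thesis using c by (simp add: log_nat_power)
qed

lemma log2_mono: "0 < x \<Longrightarrow> x \<le> y \<Longrightarrow> log 2 x \<le> log 2 y"
  by (intro log_mono) auto

lemma log2_lg: "2 \<le> n \<Longrightarrow> real (lg n) - 1 < log 2 (real n)"
proof -
  assume n: "2 \<le> n"
  have "(2::real) ^ (lg n - 1) < real n" using lg_bounds[OF n] by (metis of_nat_less_iff of_nat_numeral of_nat_power)
  then have "log 2 (2 ^ (lg n - 1)) < log 2 (real n)" using n by (subst log_less_cancel_iff) auto
  then show ?thesis using lg_bounds[OF n] by (simp add: of_nat_diff)
qed

text \<open>A single block costs \<open>2 * lg n\<close> levels of doubling. The iterated logarithms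
  are bounded below by rationals, separately for small ranges of \<open>lg n\<close>.\<close>

lemma small_delay:
  assumes "3 \<le> n" "lg n \<le> 11"
  shows "2 * real (lg n) \<le> 3 * log 2 (log 2 (real n)) + 3 * log 2 (log 2 (log 2 (real n))) + 8461 / 1000"
proof -
  \<comment> \<open>Here \<open>u = k / m\<close> is a lower bound of \<open>log 2 c\<close>,
    witnessed by \<open>2 ^ k \<le> c ^ m\<close>, and \<open>(k' - j) / m'\<close> is one of
    \<open>log 2 u\<close>; \<open>j\<close> admits negative values, which occur when
    \<open>u < 1\<close>.\<close>
  have *: "2 * real (lg n) \<le> 3 * log 2 (log 2 (real n)) + 3 * log 2 (log 2 (log 2 (real n))) + 8461 / 1000"
    if "c \<le> log 2 (real n)" "2 ^ k \<le> c ^ m" "0 < m" "0 < c" "u = real k / real m" "0 < u" "2 ^ k' \<le> u ^ m' * 2 ^ j" "0 < m'"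
       "2 * real (lg n) \<le> 3 * u + 3 * ((real k' - real j) / real m') + 8461 / 1000" for c k m u k' m' j
  proof -
    have "u \<le> log 2 c" unfolding that(5) using log2_ge[OF that(4,2)] that(3) by (simp add: pos_divide_le_eq mult.commute)
    also have "\<dots> \<le> log 2 (log 2 (real n))" using that by (intro log2_mono) auto
    finally have u: "u \<le> log 2 (log 2 (real n))" .
    have "log 2 (2 ^ k') \<le> log 2 (u ^ m' * 2 ^ j)" using that by (intro log2_mono) auto
    also have "\<dots> = real m' * log 2 u + real j" using that(6) by (subst log_mult_pos) (simp_all add: log_nat_power)
    finally have "(real k' - real j) / real m' \<le> log 2 u" using that(8) by (simp add: pos_divide_le_eq mult.commute)
    also have "\<dots> \<le> log 2 (log 2 (log 2 (real n)))" using u that by (intro log2_mono) auto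
    finally show ?thesis using that u by linarith
  qed
  have l: "real (lg n) - 1 \<le> log 2 (real n)" using log2_lg[of n] assms by simp
  have "2 \<le> lg n"
  proof (rule ccontr)
    assume "\<not> 2 \<le> lg n"
    then have "(2::nat) ^ lg n \<le> 2 ^ 1" by (intro power_increasing) auto
    then show False using lg_bounds[of n] assms by simp
  qed
  then consider "lg n = 2" | "lg n = 3" | "lg n = 4" | "5 \<le> lg n \<and> lg n \<le> 9" | "lg n = 10" | "lg n = 11"
    using assms by linarith
  then show ?thesis
  proof cases
    case 1
    \<comment> \<open>From \<open>2 ^ 3 \<le> 3 ^ 2\<close> comes
      \<open>log 2 3 \<ge> 3 / 2\<close>, the only case where \<open>lg n - 1\<close> is too weak as
      a lower bound.\<close>
    have "real 3 \<le> real 2 * log 2 (real n)" using assms power_mono[of 3 "real n" 2] by (intro log2_ge) auto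
    then show ?thesis using 1 by (intro *[of "3/2" 1 2 "1/2" 0 1 1]) (auto simp: power2_eq_square)
  next
    case 2 then show ?thesis using l by (intro *[of 2 1 1 1 0 1 0]) auto
  next
    case 3 then show ?thesis using l by (intro *[of 3 3 2 "3/2" 1 2 0]) (auto simp: power2_eq_square)
  next
    case 4
    then show ?thesis
    proof (cases "lg n = 5")
      case True then show ?thesis using l by (intro *[of 4 2 1 2 1 1 0]) auto
    next
      case False
      then have "5 \<le> log 2 (real n)" "lg n \<le> 9" using 4 l by auto
      then show ?thesis by (intro *[of 5 9 4 "9/4" 1 1 0]) auto
    qed
  next
    case 5 then show ?thesis using l by (intro *[of 9 3 1 3 3 2 0]) auto
  next
    case 6 then show ?thesis using l by (intro *[of 10 13 4 "13/4" 3 2 0]) (auto simp: power2_eq_square)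
  qed
qed

text \<open>The constant \<open>17 / 2\<close> consists of \<open>13 / 2\<close> for the factor 85
  and 2 for the final gates. With \<open>u = log 2 x \<ge> 17 / 5\<close> one has
  \<open>2 * (2 * u + 8) \<le> u ^ 3\<close>, so \<open>3 * log 2 u\<close> covers
  \<open>log 2 (2 * u + 8)\<close> and one more unit. That unit pays for
  \<open>log 2 (20 / 11)\<close>, which comes from \<open>x + 9 \<le> 20 / 11 * x\<close>, and for
  the missing 0.039.\<close>

lemma large_delay:
  assumes x: "11 \<le> (x::real)"
  shows "2 * log 2 x + 17 / 2 + log 2 (2 * log 2 x + 8) + log 2 (x + 9) \<le>
    3 * log 2 x + 3 * log 2 (log 2 x) + 8461 / 1000"
proof -
  define u where "u = log 2 x"
  have "real 17 \<le> real 5 * log 2 11" by (rule log2_ge) auto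
  also have "log 2 11 \<le> u" unfolding u_def using x by (intro log2_mono) auto
  finally have u: "17 / 5 \<le> u" by simp
  have "log 2 (x + 9) \<le> log 2 (20 / 11 * x)" using x by (intro log2_mono) auto
  also have "\<dots> = log 2 (20 / 11) + u" unfolding u_def using x by (intro log_mult_pos) auto
  finally have a: "log 2 (x + 9) \<le> log 2 (20 / 11) + u" .
  have b: "39 / 1000 \<le> log 2 (11 / 10 :: real)" using log2_ge[of "11/10" 1 8] by (simp add: power_divide)
  have "(289 / 25) * u \<le> u * u * u" using u mult_mono[of "17 / 5" u "17 / 5" u] by (intro mult_right_mono) auto
  moreover have "2 * (2 * u + 8) \<le> (289 / 25) * u" using u by simp
  ultimately have "2 * (2 * u + 8) \<le> u ^ 3" unfolding power3_eq_cube by (rule order_trans[rotated])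
  then have "log 2 (2 * (2 * u + 8)) \<le> log 2 (u ^ 3)" using u by (intro log2_mono) auto
  also have "\<dots> = 3 * log 2 u" using u by (simp add: log_nat_power)
  also have "2 * (2 * u + 8) = (11 / 10) * ((20 / 11) * (2 * u + 8))" by simp
  also have "log 2 \<dots> = log 2 (11 / 10) + (log 2 (20 / 11) + log 2 (2 * u + 8))"
    using u by (subst log_mult_pos, simp, simp, subst log_mult_pos) auto
  finally show ?thesis using a b unfolding u_def[symmetric] by linarith
qed

text \<open>\<open>V\<close> is \<open>W\<close> on the scale where the latest arrival time has
  weight \<open>2 ^ (3 * lg n)\<close>. Cutting weights off at 1 adds at most 1 per input, which
  makes \<open>2 * n\<close>.\<close>

lemma weight_sum:
  fixes n a defines "al \<equiv> arrivals n a"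
  defines "W \<equiv> (\<Sum>i<n. (2::real) ^ a (P i) + 2 ^ a (G i))"
  defines "V \<equiv> W * 2 ^ (3 * lg n) / 2 ^ amax al"
  assumes "3 \<le> n"
  shows "2 ^ amax al \<le> W" "2 ^ (3 * lg n) \<le> V" "real (\<Sum>i<n. ew al i) \<le> V + 2 * real n"
    "2 ^ (3 * lg n) \<le> (\<Sum>i<n. ew al i)"
proof -
  have "al \<noteq> []" using assms by (auto simp: al_def arrivals_def)
  then obtain i where i: "i < n" "amax al = max (a (P i)) (a (G i))"
    using amax_attained[of al] by (auto simp: al_def arrivals_def)
  have "(2::real) ^ amax al \<le> 2 ^ a (P i) + 2 ^ a (G i)" unfolding i(2) by (auto simp: max_def)
  also have "\<dots> \<le> W" unfolding W_def using i(1)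
    by (intro member_le_sum[where f = "\<lambda>i. (2::real) ^ a (P i) + 2 ^ a (G i)"]) auto
  finally show W: "2 ^ amax al \<le> W" .
  then show "2 ^ (3 * lg n) \<le> V" unfolding V_def by (simp add: field_simps)
  have "amax al = a (P i) \<or> amax al = a (G i)" using i(2) by (simp add: max_def)
  moreover have "ew al i = max (2 ^ (3 * lg n - (amax al - a (P i)))) (2 ^ (3 * lg n - (amax al - a (G i))))"
    using i(1) by (simp add: ew_eq al_def geta_arrivals)
  ultimately have "2 ^ (3 * lg n) \<le> ew al i" by (elim disjE) (simp_all only: diff_self_eq_0 diff_zero max.cobounded1 max.cobounded2)
  also have "\<dots> \<le> (\<Sum>i<n. ew al i)" using i(1) by (intro member_le_sum) auto
  finally show "2 ^ (3 * lg n) \<le> (\<Sum>i<n. ew al i)" .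
  have t: "(2::real) ^ (3 * lg n - (amax al - y)) \<le> 2 ^ y * 2 ^ (3 * lg n) / 2 ^ amax al + 1" if "y \<le> amax al" for y
  proof (cases "amax al - y \<le> 3 * lg n")
    case True
    then have "(2::real) ^ (3 * lg n - (amax al - y)) * 2 ^ amax al = 2 ^ y * 2 ^ (3 * lg n)"
      using that by (simp add: power_add[symmetric])
    then show ?thesis by (simp add: field_simps)
  next
    case False then show ?thesis by simp
  qed
  have "real (ew al i) \<le> (2 ^ a (P i) + 2 ^ a (G i)) * 2 ^ (3 * lg n) / 2 ^ amax al + 2" if "i < n" for i
  proof -
    have "real (ew al i) = max (2 ^ (3 * lg n - (amax al - a (P i)))) (2 ^ (3 * lg n - (amax al - a (G i))))"
      using that by (simp add: ew_eq al_def geta_arrivals of_nat_max)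
    also have "\<dots> \<le> 2 ^ (3 * lg n - (amax al - a (P i))) + 2 ^ (3 * lg n - (amax al - a (G i)))" by simp
    also have "\<dots> \<le> (2 ^ a (P i) * 2 ^ (3 * lg n) / 2 ^ amax al + 1) + (2 ^ a (G i) * 2 ^ (3 * lg n) / 2 ^ amax al + 1)"
      using arrivals_le[OF that, of a] by (intro add_mono t) (auto simp: al_def)
    also have "\<dots> = (2 ^ a (P i) + 2 ^ a (G i)) * 2 ^ (3 * lg n) / 2 ^ amax al + 2"
      by (simp add: distrib_right add_divide_distrib)
    finally show ?thesis .
  qed
  then have "(\<Sum>i<n. real (ew al i)) \<le> (\<Sum>i<n. (2 ^ a (P i) + 2 ^ a (G i)) * 2 ^ (3 * lg n) / 2 ^ amax al + 2)"
    by (intro sum_mono) auto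
  also have "\<dots> = (\<Sum>i<n. (2 ^ a (P i) + 2 ^ a (G i)) * 2 ^ (3 * lg n) / 2 ^ amax al) + 2 * real n"
    by (simp only: sum.distrib) simp
  also have "\<dots> = V + 2 * real n" unfolding V_def W_def by (simp only: sum_distrib_right sum_divide_distrib)
  finally show "real (\<Sum>i<n. ew al i) \<le> V + 2 * real n" by simp
qed

text \<open>The leading coefficient is \<open>64 * 64 = 4096\<close>, and
  \<open>49 * 85 = 4165\<close> exceeds it by 69. This surplus swallows all other terms, because
  \<open>V \<ge> 2 ^ (3 * l)\<close> is at least \<open>2 ^ 24 * 2 ^ l\<close>; the scale
  \<open>3 * lg n\<close> of the weights is chosen for this.\<close>

lemma absorb:
  fixes V :: real and l k :: nat
  assumes l: "12 \<le> l" "2 ^ k \<le> l" and V: "2 ^ (3 * l) \<le> V"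
  shows "49 * 2 ^ (2 * k + 7) + 64 * (2 * real k + 8) * (7 * real l * 2 ^ (l + 7) + 64 * (real l + 8) * (V + 2 * 2 ^ l))
    \<le> 49 * 85 * (2 * real k + 8) * (real l + 8) * V"
proof -
  define K where "K = 2 * real k + 8"
  define N where "N = (2::real) ^ l"
  have N: "0 < N" by (simp add: N_def)
  have K: "1 \<le> K" by (simp add: K_def)
  have lN: "real l \<le> N" unfolding N_def by (metis less_exp less_imp_le of_nat_le_iff of_nat_numeral of_nat_power)
  have kl: "(2::real) ^ k \<le> real l" using l(2) by (metis of_nat_le_iff of_nat_numeral of_nat_power)
  have "1 * (real l + 8) \<le> K * (real l + 8)" using K by (intro mult_right_mono) auto
  then have "real l + 8 \<le> K * (real l + 8)" by (simp only: mult_1)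
  then have lK: "real l \<le> K * (real l + 8)" by (rule order_trans[rotated]) simp
  have "(2::real) ^ k * 2 ^ k \<le> real l * N" by (intro mult_mono kl order_trans[OF kl lN]) auto
  also have "\<dots> \<le> K * (real l + 8) * N" using lK N by (intro mult_right_mono) auto
  finally have "(2::real) ^ k * 2 ^ k \<le> K * (real l + 8) * N" .
  then have "2 ^ k * 2 ^ k * 2 ^ 7 \<le> 128 * (K * (real l + 8) * N)" by simp
  then have 1: "(2::real) ^ (2 * k + 7) \<le> 128 * (K * (real l + 8) * N)"
    by (simp only: mult_2 power_add)
  have 2: "K * real l * N \<le> K * (real l + 8) * N" using K N by (intro mult_right_mono mult_left_mono) auto
  have "(2::real) ^ 24 \<le> 2 ^ (2 * l)" using l by (intro power_increasing) auto
  then have "2 ^ 24 * N \<le> 2 ^ (2 * l) * N" using N by simp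
  also have "\<dots> = 2 ^ (3 * l)" by (simp add: N_def power_add[symmetric])
  finally have "2 ^ 24 * N \<le> V" using V by linarith
  then have 3: "K * (real l + 8) * (2 ^ 24 * N) \<le> K * (real l + 8) * V" using K by (intro mult_left_mono) auto
  define A B D where "A = K * (real l + 8) * N" and "B = K * real l * N" and "D = K * (real l + 8) * V"
  have "64 * K * (7 * real l * 2 ^ (l + 7) + 64 * (real l + 8) * (V + 2 * 2 ^ l)) = 57344 * B + 4096 * D + 8192 * A"
    unfolding A_def B_def D_def power_add N_def[symmetric] by (simp add: algebra_simps)
  moreover have "49 * 85 * K * (real l + 8) * V = 4165 * D" by (simp add: D_def)
  moreover have "K * (real l + 8) * (2 ^ 24 * N) = 16777216 * A" by (simp add: A_def)
  moreover have "0 \<le> A" using K N by (simp add: A_def)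
  ultimately show ?thesis unfolding K_def[symmetric]
    using 1 2 3 unfolding A_def[symmetric] B_def[symmetric] D_def[symmetric] by linarith
qed

theorem circ_delay:
  fixes n a defines "W \<equiv> (\<Sum>i<n. (2::real) ^ a (P i) + 2 ^ a (G i))"
  assumes n: "3 \<le> n"
  shows "real (delay (circ (arrivals n a)) a) \<le> log 2 W + 3 * log 2 (log 2 (real n)) +
    3 * log 2 (log 2 (log 2 (real n))) + 8461 / 1000"
proof -
  define al where "al = arrivals n a"
  define C where "C = circ al"
  define x where "x = log 2 (real n)"
  define R where "R = log 2 W + 3 * log 2 x + 3 * log 2 (log 2 x) + 8461 / 1000"
  note ws = weight_sum[OF n, of a, folded al_def W_def]
  define V where "V = W * 2 ^ (3 * lg n) / 2 ^ amax al"
  have Wpos: "0 < W" using ws(1) by (meson less_le_trans zero_less_numeral zero_less_power)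
  have "log 2 (2 ^ amax al) \<le> log 2 W" using ws(1) by (intro log2_mono) auto
  then have lW: "real (amax al) \<le> log 2 W" by simp
  have "real (arrival C a (outputs C ! i)) \<le> R" if i: "i < n" for i
  proof (cases "lg n \<le> 11")
    case True
    then have "n \<le> bs n" "lam n = lg n" using lam_small[OF True] n by (auto simp: lam_def)
    then have "int (arrival C a (outputs C ! i)) \<le> int (amax al) + 2 * int (lg n)"
      using stage_Z(2)[OF n i, of a] i by (simp add: al_def C_def)
    then have "real (arrival C a (outputs C ! i)) \<le> real (amax al) + 2 * real (lg n)" by linarith
    then show ?thesis using small_delay[OF n True] lW by (simp add: R_def x_def)
  next
    case False
    then have l: "12 \<le> lg n" by simp
    have x: "real (lg n) - 1 < x" "11 \<le> x" using log2_lg[of n] n l by (auto simp: x_def)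
    note ll = lam_large[OF l]
    have "real (bs n) \<le> real (lg n - 1)" using ll by simp
    then have "real (bs n) \<le> x" using l x by (simp add: of_nat_diff)
    then have "log 2 (2 ^ lam n) \<le> log 2 x" by (intro log2_mono) (auto simp: bs_def)
    then have lam: "real (lam n) \<le> log 2 x" by simp
    note ld = large_delay[OF x(2)]
    have pos: "0 \<le> log 2 x" using x by (simp add: zero_le_log_cancel_iff)
    show ?thesis
    proof (cases "i < bs n")
      case True
      then have "int (arrival C a (outputs C ! i)) \<le> int (amax al) + 2 * int (lam n)"
        using stage_Z(2)[OF n i, of a] by (simp add: al_def C_def)
      then have "real (arrival C a (outputs C ! i)) \<le> real (amax al) + 2 * real (lam n)" by linarith
      moreover have "0 \<le> log 2 (2 * log 2 x + 8)" "0 \<le> log 2 (x + 9)"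
        using x pos log2_mono[of 1 "2 * log 2 x + 8"] log2_mono[of 1 "x + 9"] by auto
      ultimately show ?thesis using ld lam lW unfolding R_def by linarith
    next
      case False
      then obtain e where e: "int (arrival C a (outputs C ! i)) \<le> int e + base al + 2 * int (lam n) + 2"
        "2 ^ e = wy al (i div bs n) \<or> e = 3 * lg n"
        using stage_Z(3)[OF n i, of a] by (auto simp: al_def C_def)
      have b: "0 < i div bs n" "i div bs n \<le> nb n" using div_nb[of i al] i False by (auto simp: al_def)
      \<comment> \<open>Also covers the alternative \<open>e = 3 * lg n\<close>, as the sum of the
        weights is at least \<open>2 ^ (3 * lg n)\<close>: the latest input alone contributes that
        much.\<close>
      have "49 * 2 ^ e \<le> 49 * 2 ^ yexp n + 64 * (yexp n + 1) *
        (7 * lg n * 2 ^ xexp n + 64 * (xexp n + 1) * (\<Sum>i<n. ew al i))"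
      proof -
        have "2 ^ e = wy al (i div bs n) \<or> 49 * 2 ^ e \<le> 64 * 64 * (\<Sum>i<n. ew al i)"
          using e(2) ws(4) by auto
        moreover have "64 * 64 * (\<Sum>i<n. ew al i) \<le> 64 * (yexp n + 1) * (64 * (xexp n + 1)) * (\<Sum>i<n. ew al i)"
          by (intro mult_right_mono mult_mono) auto
        ultimately show ?thesis using wy_bound[of al "i div bs n"] b n
          by (auto simp: al_def algebra_simps)
      qed
      then have "real (49 * 2 ^ e) \<le> real (49 * 2 ^ yexp n + 64 * (yexp n + 1) *
        (7 * lg n * 2 ^ xexp n + 64 * (xexp n + 1) * (\<Sum>i<n. ew al i)))" by (rule of_nat_mono)
      then have "49 * 2 ^ e \<le> 49 * 2 ^ (2 * lam n + 7) + 64 * (2 * real (lam n) + 8) *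
        (7 * real (lg n) * 2 ^ (lg n + 7) + 64 * (real (lg n) + 8) * real (\<Sum>i<n. ew al i))"
        by (simp add: yexp_def xexp_def add.commute)
      also have "\<dots> \<le> 49 * 2 ^ (2 * lam n + 7) + 64 * (2 * real (lam n) + 8) *
        (7 * real (lg n) * 2 ^ (lg n + 7) + 64 * (real (lg n) + 8) * (V + 2 * 2 ^ lg n))"
      proof -
        have "real n \<le> 2 ^ lg n" using lg_bounds[of n] n by (metis of_nat_le_iff of_nat_numeral of_nat_power Suc_leD numeral_3_eq_3 numeral_2_eq_2)
        then have "real (\<Sum>i<n. ew al i) \<le> V + 2 * 2 ^ lg n" using ws(3) unfolding V_def by linarith
        then show ?thesis by (intro add_left_mono mult_left_mono) auto
      qed
      also have "\<dots> \<le> 49 * 85 * (2 * real (lam n) + 8) * (real (lg n) + 8) * V"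
      proof -
        have "2 ^ lam n \<le> lg n" using ll unfolding bs_def by linarith
        then show ?thesis using absorb[OF l _ ws(2)[folded V_def], of "lam n"] by blast
      qed
      finally have "49 * 2 ^ e \<le> 49 * (85 * (2 * real (lam n) + 8) * (real (lg n) + 8) * V)"
        by (simp only: mult.assoc)
      then have "2 ^ e \<le> 85 * (2 * real (lam n) + 8) * (real (lg n) + 8) * V"
        by (rule mult_left_le_imp_le) simp
      then have "log 2 (2 ^ e) \<le> log 2 (85 * (2 * real (lam n) + 8) * (real (lg n) + 8) * V)"
        by (intro log2_mono) auto
      also have "\<dots> = log 2 85 + log 2 (2 * real (lam n) + 8) + log 2 (real (lg n) + 8) +
          (log 2 W + 3 * real (lg n) - real (amax al))"
      proof -
        define A B where "A = 2 * real (lam n) + 8" and "B = real (lg n) + 8"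
        have "0 < A" "0 < B" by (auto simp: A_def B_def)
        moreover have "0 < V" using Wpos by (simp add: V_def)
        moreover have "log 2 V = log 2 W + 3 * real (lg n) - real (amax al)"
          using Wpos by (simp add: V_def log_mult_pos log_divide_pos log_nat_power)
        ultimately show ?thesis unfolding A_def[symmetric] B_def[symmetric] by (simp add: log_mult_pos)
      qed
      finally have "real e \<le> log 2 85 + log 2 (2 * real (lam n) + 8) + log 2 (real (lg n) + 8) +
          (log 2 W + 3 * real (lg n) - real (amax al))" by simp
      moreover have "2 * log 2 85 \<le> (13::real)" using log2_le[of 85 2 13] by simp
      moreover have "log 2 (2 * real (lam n) + 8) \<le> log 2 (2 * log 2 x + 8)" using lam by (intro log2_mono) auto
      moreover have "log 2 (real (lg n) + 8) \<le> log 2 (x + 9)" using x by (intro log2_mono) auto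
      moreover have "real (arrival C a (outputs C ! i)) \<le> real e + (real (amax al) - 3 * real (lg n)) + 2 * real (lam n) + 2"
        using e(1) unfolding base_def by (simp add: al_def)
      ultimately show ?thesis using ld lam unfolding R_def by linarith
    qed
  qed
  \<comment> \<open>The maximum is taken over natural numbers, so the real bound passes through its
    floor; that it is nonnegative is seen from output 0.\<close>
  then have "arrival C a (outputs C ! i) \<le> nat \<lfloor>R\<rfloor>" if "i < n" for i using that by (simp add: le_nat_floor)
  then have D: "delay C a \<le> nat \<lfloor>R\<rfloor>" unfolding C_def al_def by (intro delay_le[OF n]) auto
  have "real (arrival C a (outputs C ! 0)) \<le> R" using \<open>\<And>i. i < n \<Longrightarrow> real (arrival C a (outputs C ! i)) \<le> R\<close> n by simp
  then have "0 \<le> R" by (meson of_nat_0_le_iff order_trans)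
  then have "real (nat \<lfloor>R\<rfloor>) \<le> R" by simp
  then show ?thesis using D unfolding C_def al_def R_def x_def by linarith
qed

text \<open>The gate count for \<open>l = lg n\<close>, \<open>k = lam n\<close>, with
  \<open>n\<close> divided out and multiplied by \<open>1000 * 2 ^ k\<close>; the summand
  \<open>4442 * 2 ^ k\<close> turns \<open>l\<close> into \<open>l - 1\<close> on the right. For
  \<open>k = 3\<close> and \<open>k = 4\<close> the bounds \<open>l \<le> 16\<close> and
  \<open>l \<le> 32\<close> give \<open>d + 1 \<le> 14\<close> and \<open>d + 1 \<le> 29\<close>;
  from 5 on \<open>32 * k \<le> 5 * 2 ^ k\<close> controls the lower-order terms.\<close>

lemma size_num:
  assumes "12 \<le> l" "3 \<le> k" "2 ^ k \<le> l - 1" "l \<le> 2 * 2 ^ k" "l = k + d"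
  shows "500 * ((l + 10) * (d + 1) + 2 * d * (2 * k + 9)) + 2 ^ k * (3000 * k + 2000) + 4442 * 2 ^ k \<le> 4442 * 2 ^ k * (l::nat)"
proof -
  consider "k = 3" | "k = 4" | "5 \<le> k" using assms by linarith
  then show ?thesis
  proof cases
    case 1
    then have "(l + 10) * (d + 1) \<le> (l + 10) * 14" using assms by (intro mult_left_mono) auto
    then show ?thesis using 1 assms by simp
  next
    case 2
    then have "(l + 10) * (d + 1) \<le> (l + 10) * 29" using assms by (intro mult_left_mono) auto
    then show ?thesis using 2 assms by simp
  next
    case 3
    define L where "L = (2::nat) ^ k"
    have "32 * k \<le> 5 * L" using 3 unfolding L_def
      by (induction k rule: dec_induct) auto
    have l: "l \<le> 2 * L" "L + 1 \<le> l" using assms by (auto simp: L_def)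
    have "d + 1 \<le> 2 * L" "d \<le> 2 * L" using l assms 3 by auto
    then have "(l + 10) * (d + 1) \<le> (l + 10) * (2 * L)" "d * (2 * k + 9) \<le> (2 * L) * (2 * k + 9)"
      by (intro mult_mono; simp)+
    then have "500 * ((l + 10) * (d + 1) + 2 * d * (2 * k + 9)) \<le> L * (1000 * (l + 10) + 2000 * (2 * k + 9))"
      by (simp add: algebra_simps)
    then have "500 * ((l + 10) * (d + 1) + 2 * d * (2 * k + 9)) + L * (3000 * k + 2000) + 4442 * L \<le>
      L * (1000 * (l + 10) + 2000 * (2 * k + 9) + (3000 * k + 2000) + 4442)" by (simp add: algebra_simps)
    also have "\<dots> \<le> L * (4442 * l)" proof (intro mult_left_mono)
      have "34442 + 7000 * k \<le> 3442 * l" using \<open>32 * k \<le> 5 * L\<close> l 3 by linarith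
      then show "1000 * (l + 10) + 2000 * (2 * k + 9) + (3000 * k + 2000) + 4442 \<le> 4442 * l" by simp
    qed simp
    finally show ?thesis unfolding L_def by (simp add: algebra_simps)
  qed
qed

theorem circ_size_bound:
  assumes "3 \<le> n"
  shows "lg n \<le> 11 \<Longrightarrow> circuit_size (circ (arrivals n a)) \<le> 3 * lg n * n"
    "12 \<le> lg n \<Longrightarrow> 1000 * circuit_size (circ (arrivals n a)) \<le> 4442 * n * (lg n - 1)"
proof -
  define al where "al = arrivals n a"
  have nal: "length al = n" "3 \<le> length al" using assms by (auto simp: al_def)
  note X = size_fsX[OF nal(2), unfolded nal(1)] and Y = size_fsY[OF nal(2), unfolded nal(1)]
    and Z = size_fsZ[of al, unfolded nal(1)] and S = circ_size[of al, unfolded nal(1)]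
  show "circuit_size (circ (arrivals n a)) \<le> 3 * lg n * n" if "lg n \<le> 11"
    using lam_small[OF that] X Y Z S assms that unfolding al_def[symmetric] by (simp add: lam_def)
  assume l: "12 \<le> lg n"
  define L where "L = (2::nat) ^ lam n"
  define d where "d = lg n - lam n"
  define T where "T = (lg n + 10) * (d + 1) + 2 * d * (2 * lam n + 9)"
  note ll = lam_large[OF l]
  have "lam n < L" by (simp add: L_def)
  then have "lg n = lam n + d" using ll unfolding d_def L_def[symmetric] bs_def by linarith
  then have num: "500 * T + L * (3000 * lam n + 2000) + 4442 * L \<le> 4442 * L * lg n"
    using size_num[OF l, of "lam n" d] ll unfolding T_def L_def bs_def by simp
  have BL: "nb n * L \<le> n" using nb_bound[of n] assms by (simp add: L_def bs_def)
  have "2 * circuit_size (circ al) \<le> 2 * (3 * lam n * n + 2 * n) + nb n * T"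
    using X Y Z(1) unfolding S T_def d_def[symmetric] by (simp add: algebra_simps)
  \<comment> \<open>Multiplying by the block length lets \<open>nb n * L\<close> be replaced by
    \<open>n\<close>; the factor is cancelled at the end.\<close>
  then have "500 * L * (2 * circuit_size (circ al)) \<le> 500 * L * (2 * (3 * lam n * n + 2 * n) + nb n * T)"
    by (rule mult_left_mono) simp
  also have "\<dots> = L * (n * (3000 * lam n + 2000)) + 500 * T * (nb n * L)" by (simp add: algebra_simps)
  also have "\<dots> \<le> L * (n * (3000 * lam n + 2000)) + 500 * T * n" using BL by (intro add_left_mono mult_left_mono) auto
  also have "\<dots> = n * (500 * T + L * (3000 * lam n + 2000))" by (simp add: algebra_simps)
  also have "\<dots> \<le> n * (4442 * L * (lg n - 1))" using num l by (intro mult_left_mono) (auto simp: diff_mult_distrib2)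
  finally have "L * (1000 * circuit_size (circ al)) \<le> L * (4442 * n * (lg n - 1))" by (simp add: algebra_simps)
  then show "1000 * circuit_size (circ (arrivals n a)) \<le> 4442 * n * (lg n - 1)"
    unfolding al_def[symmetric] by (simp add: L_def)
qed

theorem circ_size_log:
  assumes "3 \<le> n"
  shows "real (circuit_size (circ (arrivals n a))) \<le> (if n \<le> 2 ^ 21 then 31 / 5 else 2221 / 500) * real n * log 2 (real n)"
proof -
  have l: "real (lg n) - 1 \<le> log 2 (real n)" using log2_lg[of n] assms by simp
  have lg2: "2 \<le> lg n"
  proof (rule ccontr)
    assume "\<not> 2 \<le> lg n"
    then have "(2::nat) ^ lg n \<le> 2 ^ 1" by (intro power_increasing) auto
    then show False using lg_bounds[of n] assms by simp
  qed
  show ?thesis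
  proof (cases "lg n \<le> 11")
    case True
    have "n \<le> 2 ^ lg n" using lg_bounds[of n] assms by simp
    also have "(2::nat) ^ lg n \<le> 2 ^ 11" using True by (intro power_increasing) auto
    finally have n: "n \<le> 2 ^ 21" by simp
    \<comment> \<open>From \<open>l = 2\<close> on, \<open>3 * l \<le> 6.2 * (l - 1)\<close>; so 6.2
      is just enough for pure doubling at the smallest \<open>n\<close>.\<close>
    have "3 * real (lg n) \<le> (31 / 5) * log 2 (real n)" using l lg2 by linarith
    then have "real (3 * lg n * n) \<le> (31 / 5) * log 2 (real n) * real n"
      using mult_right_mono[of "3 * real (lg n)" "(31 / 5) * log 2 (real n)" "real n"] by simp
    moreover have "real (circuit_size (circ (arrivals n a))) \<le> real (3 * lg n * n)"
      using circ_size_bound(1)[OF assms True] by (intro of_nat_mono)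
    ultimately show ?thesis using n by (simp add: mult_ac)
  next
    case False
    then have "1000 * circuit_size (circ (arrivals n a)) \<le> 4442 * n * (lg n - 1)"
      using circ_size_bound(2)[OF assms] by simp
    then have "real (1000 * circuit_size (circ (arrivals n a))) \<le> real (4442 * n * (lg n - 1))" by (rule of_nat_mono)
    also have "\<dots> \<le> 4442 * real n * log 2 (real n)" using l lg2 by (simp add: of_nat_diff mult_left_mono)
    finally have *: "real (circuit_size (circ (arrivals n a))) \<le> (2221 / 500) * (real n * log 2 (real n))" by simp
    moreover have "0 \<le> real n * log 2 (real n)" using assms by simp
    ultimately show ?thesis by (auto simp: mult.assoc)
  qed
qed

section \<open>Functions computable in polynomial time\<close>

fun shift :: "nat \<Rightarrow> expr \<Rightarrow> expr" where
  "shift k (Var i) = Var i"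
| "shift k EAtom = EAtom"
| "shift k (EPair e1 e2) = EPair (shift k e1) (shift k e2)"
| "shift k (Left e) = Left (shift k e)"
| "shift k (Right e) = Right (shift k e)"
| "shift k (IfAtom e e1 e2) = IfAtom (shift k e) (shift k e1) (shift k e2)"
| "shift k (Call f es) = Call (k + f) (map (shift k) es)"

lemma shift_0: "shift 0 e = e"
  by (induction "0 :: nat" e rule: shift.induct) (auto intro: map_idI)

text \<open>A program embedded between \<open>A\<close> and \<open>B\<close> keeps its results and
  times, so that a new function can call functions of several independently built programs.\<close>

lemma eval_shift:
  "eval Q env e d t \<Longrightarrow> eval (A @ map (shift (length A)) Q @ B) env (shift (length A) e) d t"
  "evals Q env es ds t \<Longrightarrow> evals (A @ map (shift (length A)) Q @ B) env (map (shift (length A)) es) ds t"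
proof (induction rule: eval_evals.inducts)
  case (eval_Call env es ds t f d t')
  then have "(A @ map (shift (length A)) Q @ B) ! (length A + f) = shift (length A) (Q ! f)"
    "length A + f < length (A @ map (shift (length A)) Q @ B)"
    by (simp_all add: nth_append)
  then show ?case unfolding shift.simps using eval_Call
    by (intro eval_evals.eval_Call[where ds = ds]) simp_all
next
  case eval_Var then show ?case unfolding shift.simps by (rule eval_evals.eval_Var)
next
  case eval_Atom show ?case unfolding shift.simps by (rule eval_evals.eval_Atom)
next
  case eval_Pair then show ?case unfolding shift.simps by (intro eval_evals.eval_Pair)
next
  case eval_Left then show ?case unfolding shift.simps by (intro eval_evals.eval_Left)
next
  case eval_Right then show ?case unfolding shift.simps by (intro eval_evals.eval_Right)
next
  case eval_If_True then show ?case unfolding shift.simps by (intro eval_evals.eval_If_True)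
next
  case eval_If_False then show ?case unfolding shift.simps by (intro eval_evals.eval_If_False)
next
  case evals_Nil show ?case unfolding list.map by (rule eval_evals.evals_Nil)
next
  case evals_Cons then show ?case unfolding list.map by (intro eval_evals.evals_Cons)
qed

lemma eval_append: "eval Q env e d t \<Longrightarrow> eval (Q @ B) env e d t"
  using eval_shift(1)[of Q env e d t "[]" B] by (simp add: shift_0 map_idI)

type_synonym data_rel = "data \<Rightarrow> data \<Rightarrow> bool"

text \<open>The base \<open>size x + 2\<close> is at least 2, so a single exponent absorbs sums and
  constants. The size of the result is included because sharing can make a tree far larger than the
  time spent on it.\<close>

definition computes :: "program \<Rightarrow> nat \<Rightarrow> nat \<Rightarrow> data_rel \<Rightarrow> bool" where
  "computes Q i k R \<longleftrightarrow> (\<forall>x y. R x y \<longrightarrow>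
     (\<exists>t. eval Q [x] (Call i [Var 0]) y t \<and> t + size y \<le> (size x + 2) ^ k))"

definition ptime :: "data_rel \<Rightarrow> bool" where
  "ptime R \<longleftrightarrow> (\<exists>Q i k. computes Q i k R)"

lemma computes_append: "computes Q i k R \<Longrightarrow> computes (Q @ B) i k R"
  unfolding computes_def using eval_append by blast

lemma computes_shift: "computes Q i k R \<Longrightarrow> computes (A @ map (shift (length A)) Q) (length A + i) k R"
proof -
  assume *: "computes Q i k R"
  have "eval Q [x] (Call i [Var 0]) y t \<Longrightarrow>
     eval (A @ map (shift (length A)) Q) [x] (Call (length A + i) [Var 0]) y t" for x y t
    using eval_shift(1)[where B = "[]" and e = "Call i [Var 0]" and A = A and Q = Q] by simp
  then show ?thesis using * unfolding computes_def by blast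
qed

lemma ptime_common: "\<forall>R\<in>set Rs. ptime R \<Longrightarrow> \<exists>Q. \<forall>R\<in>set Rs. \<exists>i k. computes Q i k R"
proof (induction Rs)
  case (Cons R Rs)
  then obtain Q Q' i k where Q: "\<forall>R\<in>set Rs. \<exists>i k. computes Q i k R" "computes Q' i k R"
    by (auto simp: ptime_def)
  show ?case
  proof (intro exI[of _ "Q' @ map (shift (length Q')) Q"] ballI)
    fix R' assume "R' \<in> set (R # Rs)"
    then consider "R' = R" | "R' \<in> set Rs" by auto
    then show "\<exists>i k. computes (Q' @ map (shift (length Q')) Q) i k R'"
      by cases (use computes_append[OF Q(2)] Q(1) computes_shift in blast)+
  qed
qed simp

definition runs :: "program \<Rightarrow> data list \<Rightarrow> expr \<Rightarrow> data \<Rightarrow> nat \<Rightarrow> bool" where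
  "runs Q env e d T \<longleftrightarrow> (\<exists>t\<le>T. eval Q env e d t)"

lemma runs_mono: "runs Q env e d T \<Longrightarrow> T \<le> T' \<Longrightarrow> runs Q env e d T'"
  unfolding runs_def by (meson order_trans)

lemma runs_Var: "i < length env \<Longrightarrow> runs Q env (Var i) (env ! i) 1"
  by (auto simp: runs_def simp del: One_nat_def intro!: exI[of _ 1] eval_Var)

lemma runs_Var0: "runs Q [x] (Var 0) x 1"
  using runs_Var[of 0 "[x]" Q] by simp

lemma runs_Atom: "runs Q env EAtom Atom 1"
  by (auto simp: runs_def simp del: One_nat_def intro!: exI[of _ 1] eval_Atom)

lemma runs_Pair: "runs Q env e1 d1 T1 \<Longrightarrow> runs Q env e2 d2 T2 \<Longrightarrow> runs Q env (EPair e1 e2) (Pair d1 d2) (T1 + T2 + 1)"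
  unfolding runs_def using eval_Pair by (meson add_mono le_refl)

lemma runs_Left: "runs Q env e d T \<Longrightarrow> runs Q env (Left e) (left d) (T + 1)"
  unfolding runs_def using eval_Left by (meson add_mono le_refl)

lemma runs_Right: "runs Q env e d T \<Longrightarrow> runs Q env (Right e) (right d) (T + 1)"
  unfolding runs_def using eval_Right by (meson add_mono le_refl)

lemma runs_If_Atom: "runs Q env e Atom T \<Longrightarrow> runs Q env e1 d T' \<Longrightarrow> runs Q env (IfAtom e e1 e2) d (T + T' + 1)"
  unfolding runs_def using eval_If_True by (meson add_mono le_refl)

lemma runs_If_Pair: "runs Q env e (Pair d1 d2) T \<Longrightarrow> runs Q env e2 d T' \<Longrightarrow> runs Q env (IfAtom e e1 e2) d (T + T' + 1)"
  unfolding runs_def using eval_If_False by (meson add_mono le_refl)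

lemma runs_Call:
  assumes "runs Q env e x T" "f < length Q" "runs Q [x] (Q ! f) d T'"
  shows "runs Q env (Call f [e]) d (T + T' + 3)"
proof -
  obtain t t' where t: "t \<le> T" "eval Q env e x t" "t' \<le> T'" "eval Q [x] (Q ! f) d t'"
    using assms by (auto simp: runs_def)
  have "evals Q env [e] [x] (t + 1 + 1)" by (intro evals_Cons t evals_Nil)
  then have "eval Q env (Call f [e]) d (t + 1 + 1 + t' + 1)" by (rule eval_Call[OF _ assms(2) t(4)])
  then show ?thesis unfolding runs_def using t by (intro exI[of _ "t + 1 + 1 + t' + 1"]) simp
qed

lemma call_inverts:
  assumes "eval Q [x] (Call f [Var 0]) d t"
  shows "f < length Q \<and> runs Q [x] (Q ! f) d t"
  using assms
proof cases
  case (eval_Call ds t1 t2)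
  from eval_Call(2) have "ds = [x]"
    by (auto elim!: evals.cases[of _ _ "[Var 0]"] evals.cases[of _ _ "[]"] eval.cases[of _ _ "Var 0"])
  then show ?thesis using eval_Call unfolding runs_def by (intro conjI exI[of _ t2]) auto
qed

lemma runs_computes:
  assumes "computes Q i k R" "R x y" "runs Q env e x T"
  shows "runs Q env (Call i [e]) y (T + (size x + 2) ^ k + 3)" "size y \<le> (size x + 2) ^ k"
proof -
  obtain t where t: "eval Q [x] (Call i [Var 0]) y t" "t + size y \<le> (size x + 2) ^ k"
    using assms by (auto simp: computes_def)
  from call_inverts[OF t(1)] have "i < length Q" "runs Q [x] (Q ! i) y ((size x + 2) ^ k)"
    using t(2) by (auto elim: runs_mono)
  then show "runs Q env (Call i [e]) y (T + (size x + 2) ^ k + 3)" using assms(3) by (intro runs_Call)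
  show "size y \<le> (size x + 2) ^ k" using t by simp
qed

definition pbound :: "(nat \<Rightarrow> nat) \<Rightarrow> bool" where
  "pbound f \<longleftrightarrow> (\<exists>k. \<forall>s. f s \<le> (s + 2) ^ k)"

lemma pow_ge_2: "(k::nat) < (s + 2) ^ k"
  by (rule less_le_trans[of _ "2 ^ k"]) (auto intro: power_mono)

lemma pbound_const: "pbound (\<lambda>_. c)"
  unfolding pbound_def using pow_ge_2 less_imp_le by blast

lemma pbound_id: "pbound (\<lambda>s. s)"
  unfolding pbound_def by (intro exI[of _ 1]) auto

lemma pbound_mult: "pbound f \<Longrightarrow> pbound g \<Longrightarrow> pbound (\<lambda>s. f s * g s)"
  unfolding pbound_def
proof (elim exE)
  fix k j assume "\<forall>s. f s \<le> (s + 2) ^ k" "\<forall>s. g s \<le> (s + 2) ^ j"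
  then show "\<exists>k. \<forall>s. f s * g s \<le> (s + 2) ^ k"
    by (intro exI[of _ "k + j"]) (simp only: power_add, auto intro: mult_mono)
qed

lemma pbound_le: "pbound g \<Longrightarrow> (\<And>s. f s \<le> g s) \<Longrightarrow> pbound f"
  unfolding pbound_def by (meson order_trans)

lemma pbound_add: "pbound f \<Longrightarrow> pbound g \<Longrightarrow> pbound (\<lambda>s. f s + g s)"
proof -
  assume "pbound f" "pbound g"
  then have "pbound (\<lambda>s. f s + 1)" "pbound (\<lambda>s. g s + 1)"
  proof -
    have *: "pbound (\<lambda>s. h s + 1)" if h: "pbound h" for h
    proof -
      from h obtain k where k: "\<forall>s. h s \<le> (s + 2) ^ k" by (auto simp: pbound_def)
      have "h s + 1 \<le> (s + 2) ^ Suc k" for s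
      proof -
        have "h s + 1 \<le> (s + 2) ^ k + (s + 2) ^ k" using k[rule_format, of s] one_le_power[of "s + 2" k] by linarith
        also have "\<dots> \<le> (s + 2) ^ Suc k" by simp
        finally show ?thesis .
      qed
      then show ?thesis unfolding pbound_def by blast
    qed
    show "pbound f \<Longrightarrow> pbound g \<Longrightarrow> pbound (\<lambda>s. f s + 1)" "pbound f \<Longrightarrow> pbound g \<Longrightarrow> pbound (\<lambda>s. g s + 1)"
      by (intro *; assumption)+
  qed
  from pbound_mult[OF this] show ?thesis by (rule pbound_le) (simp add: algebra_simps)
qed

lemma pbound_power: "pbound f \<Longrightarrow> pbound (\<lambda>s. f s ^ k)"
  by (induction k) (auto intro: pbound_const pbound_mult)

lemma pbound_Suc: "pbound f \<Longrightarrow> pbound (\<lambda>s. Suc (f s))"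
  using pbound_add[of f "\<lambda>_. 1"] pbound_const by simp

lemmas pbound_intros = pbound_Suc pbound_const pbound_id pbound_add pbound_mult pbound_power

text \<open>A program is constrained only on codes of elements of \<open>D\<close>; preconditions
  such as nonemptiness are thus expressed by the domain.\<close>

definition graph :: "'a set \<Rightarrow> ('a \<Rightarrow> data) \<Rightarrow> ('b \<Rightarrow> data) \<Rightarrow> ('a \<Rightarrow> 'b) \<Rightarrow> data_rel" where
  "graph D e e' f x y \<longleftrightarrow> (\<exists>u\<in>D. x = e u \<and> y = e' (f u))"

definition polytime :: "'a set \<Rightarrow> ('a \<Rightarrow> data) \<Rightarrow> ('b \<Rightarrow> data) \<Rightarrow> ('a \<Rightarrow> 'b) \<Rightarrow> bool" where
  "polytime D e e' f \<longleftrightarrow> ptime (graph D e e' f)"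

lemma polytime_runs:
  assumes "computes Q i k (graph D e e' f)" "u \<in> D" "runs Q env ex (e u) T"
  shows "runs Q env (Call i [ex]) (e' (f u)) (T + (size (e u) + 2) ^ k + 3)"
    "size (e' (f u)) \<le> (size (e u) + 2) ^ k"
  using runs_computes[OF assms(1) _ assms(3)] assms(2) by (auto simp: graph_def)

text \<open>The body of a new function, appended to a program, may call the functions of that program.\<close>

lemma polytimeI:
  assumes "pbound B" "\<And>u. u \<in> D \<Longrightarrow> runs (Q @ [ex]) [e u] ex (e' (f u)) (B (size (e u)))"
    "\<And>u. u \<in> D \<Longrightarrow> size (e' (f u)) \<le> B (size (e u))"
  shows "polytime D e e' f"
proof -
  have "pbound (\<lambda>s. B s + 4 + B s)" using assms(1) by (intro pbound_intros)
  then obtain k where k: "\<And>s. B s + 4 + B s \<le> (s + 2) ^ k" by (auto simp: pbound_def)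
  have "computes (Q @ [ex]) (length Q) k (graph D e e' f)"
    unfolding computes_def graph_def
  proof (intro allI impI, elim bexE conjE)
    fix x y u assume u: "u \<in> D" "x = e u" "y = e' (f u)"
    have "runs (Q @ [ex]) [x] (Call (length Q) [Var 0]) y (1 + B (size x) + 3)"
      using assms(2)[OF u(1)] by (intro runs_Call[OF runs_Var0]) (auto simp: u)
    then obtain t where "t \<le> 1 + B (size x) + 3" "eval (Q @ [ex]) [x] (Call (length Q) [Var 0]) y t"
      unfolding runs_def by blast
    moreover have "size y \<le> B (size x)" using assms(3)[OF u(1)] by (simp add: u)
    ultimately show "\<exists>t. eval (Q @ [ex]) [x] (Call (length Q) [Var 0]) y t \<and> t + size y \<le> (size x + 2) ^ k"
      using k[of "size x"] by (intro exI[of _ t]) auto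
  qed
  then show ?thesis unfolding polytime_def ptime_def by blast
qed

lemma polytime_size:
  assumes "polytime D e e' f"
  shows "\<exists>k. \<forall>u\<in>D. size (e' (f u)) \<le> (size (e u) + 2) ^ k"
  using assms unfolding polytime_def ptime_def computes_def graph_def by (metis add_leD2)

lemma polytime_subset: "polytime D e e' f \<Longrightarrow> D' \<subseteq> D \<Longrightarrow> polytime D' e e' f"
  unfolding polytime_def ptime_def computes_def graph_def by (meson subsetD)

text \<open>Only codes matter: a function may be exchanged for one between other types, or an
  encoding reread, without any computation.\<close>

lemma polytime_cong: "polytime D e e' f \<Longrightarrow> (\<And>u. u \<in> D \<Longrightarrow> e2 u = e u) \<Longrightarrow> (\<And>u. u \<in> D \<Longrightarrow> e2' (f2 u) = e' (f u)) \<Longrightarrow> polytime D e2 e2' f2"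
proof -
  assume "polytime D e e' f" "\<And>u. u \<in> D \<Longrightarrow> e2 u = e u" "\<And>u. u \<in> D \<Longrightarrow> e2' (f2 u) = e' (f u)"
  moreover have "(graph D e2 e2' f2) = (graph D e e' f)"
    using calculation by (intro ext) (auto simp: graph_def)
  ultimately show ?thesis by (simp add: polytime_def)
qed

lemma polytime_id: "polytime D e e (\<lambda>u. u)"
  by (rule polytimeI[where B = "\<lambda>s. s + 1" and Q = "[]" and ex = "Var 0"], intro pbound_intros)
     (auto intro: runs_mono[OF runs_Var0])

fun quote :: "data \<Rightarrow> expr" where
  "quote Atom = EAtom"
| "quote (Pair d d') = EPair (quote d) (quote d')"

lemma runs_quote: "runs Q env (quote d) d (2 * size d + 1)"
proof (induction d)
  case Atom then show ?case using runs_Atom by simp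
next
  case (Pair d d')
  then have "runs Q env (quote (Pair d d')) (Pair d d') (2 * size d + 1 + (2 * size d' + 1) + 1)"
    by (simp only: quote.simps) (rule runs_Pair)
  then show ?case by (auto simp: runs_def intro: order_trans)
qed

lemma polytime_const: "polytime D e e' (\<lambda>_. c)"
  by (rule polytimeI[where B = "\<lambda>s. 2 * size (e' c) + 1" and Q = "[]" and ex = "quote (e' c)"])
     (auto intro!: pbound_intros runs_quote simp del: One_nat_def)

lemma polytime_compose:
  assumes "polytime D e e' f" "polytime D' e' e'' g" "\<And>u. u \<in> D \<Longrightarrow> f u \<in> D'"
  shows "polytime D e e'' (\<lambda>u. g (f u))"
proof -
  let ?R1 = "graph D e e' f" and ?R2 = "graph D' e' e'' g"
  have "\<forall>R\<in>set [?R1, ?R2]. ptime R" using assms by (simp add: polytime_def)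
  from ptime_common[OF this] obtain Q i k i' k' where Q: "computes Q i k ?R1" "computes Q i' k' ?R2" by auto
  let ?ex = "Call i' [Call i [Var 0]]"
  note Q = Q[THEN computes_append, of "[?ex]"]
  have *: "runs (Q @ [?ex]) [e u] ?ex (e'' (g (f u))) ((1 + (size (e u) + 2) ^ k + 3) + ((size (e u) + 2) ^ k + 2) ^ k' + 3) \<and>
     size (e'' (g (f u))) \<le> ((1 + (size (e u) + 2) ^ k + 3) + ((size (e u) + 2) ^ k + 2) ^ k' + 3)" if u: "u \<in> D" for u
  proof -
    note 1 = polytime_runs[OF Q(1) u runs_Var0]
    note 2 = polytime_runs[OF Q(2) assms(3)[OF u] 1(1)]
    have "(size (e' (f u)) + 2) ^ k' \<le> ((size (e u) + 2) ^ k + 2) ^ k'" using 1(2) by (intro power_mono) auto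
    then show ?thesis using 2(2) by (intro conjI runs_mono[OF 2(1)]) auto
  qed
  show ?thesis
    by (rule polytimeI[where B = "\<lambda>s. (1 + (s + 2) ^ k + 3) + ((s + 2) ^ k + 2) ^ k' + 3" and ex = ?ex and Q = Q])
       (use * in \<open>auto intro!: pbound_intros\<close>)
qed

fun epair :: "('a \<Rightarrow> data) \<Rightarrow> ('b \<Rightarrow> data) \<Rightarrow> 'a \<times> 'b \<Rightarrow> data" where
  "epair e e' (x, y) = Pair (e x) (e' y)"

lemma epair_eq: "epair e e' z = Pair (e (fst z)) (e' (snd z))"
  by (cases z) simp

lemma polytime_Pair:
  assumes "polytime D e e1 f" "polytime D e e2 g"
  shows "polytime D e (epair e1 e2) (\<lambda>u. (f u, g u))"
proof -
  let ?R1 = "graph D e e1 f" and ?R2 = "graph D e e2 g"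
  have "\<forall>R\<in>set [?R1, ?R2]. ptime R" using assms by (simp add: polytime_def)
  from ptime_common[OF this] obtain Q i k i' k' where Q: "computes Q i k ?R1" "computes Q i' k' ?R2" by auto
  let ?ex = "EPair (Call i [Var 0]) (Call i' [Var 0])"
  note Q = Q[THEN computes_append, of "[?ex]"]
  show ?thesis
  proof (rule polytimeI[where B = "\<lambda>s. (1 + (s + 2) ^ k + 3) + (1 + (s + 2) ^ k' + 3) + 1" and ex = ?ex and Q = Q])
    fix u assume u: "u \<in> D"
    note r = polytime_runs[OF Q(1) u runs_Var0] polytime_runs[OF Q(2) u runs_Var0]
    show "runs (Q @ [?ex]) [e u] ?ex (epair e1 e2 (f u, g u)) ((1 + (size (e u) + 2) ^ k + 3) + (1 + (size (e u) + 2) ^ k' + 3) + 1)"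
      unfolding epair.simps by (intro runs_Pair r)
    show "size (epair e1 e2 (f u, g u)) \<le> (1 + (size (e u) + 2) ^ k + 3) + (1 + (size (e u) + 2) ^ k' + 3) + 1"
      using r by simp
  qed (intro pbound_intros)
qed

lemma left_Pair: "size (left d) \<le> size d" "size (right d) \<le> size d"
  by (cases d; simp)+

lemma polytime_raw_left: "(\<And>u. u \<in> D \<Longrightarrow> e' (f u) = left (e u)) \<Longrightarrow> polytime D e e' f"
proof (rule polytimeI[where B = "\<lambda>s. s + 2" and Q = "[]" and ex = "Left (Var 0)"])
  fix u assume "\<And>u. u \<in> D \<Longrightarrow> e' (f u) = left (e u)" "u \<in> D"
  then have e: "e' (f u) = left (e u)" by blast
  show "runs ([] @ [Left (Var 0)]) [e u] (Left (Var 0)) (e' (f u)) (size (e u) + 2)"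
    unfolding e by (rule runs_mono[OF runs_Left[OF runs_Var0]]) simp
  show "size (e' (f u)) \<le> size (e u) + 2" using left_Pair[of "e u"] e by simp
qed (intro pbound_intros)

lemma polytime_raw_right: "(\<And>u. u \<in> D \<Longrightarrow> e' (f u) = right (e u)) \<Longrightarrow> polytime D e e' f"
proof (rule polytimeI[where B = "\<lambda>s. s + 2" and Q = "[]" and ex = "Right (Var 0)"])
  fix u assume "\<And>u. u \<in> D \<Longrightarrow> e' (f u) = right (e u)" "u \<in> D"
  then have e: "e' (f u) = right (e u)" by blast
  show "runs ([] @ [Right (Var 0)]) [e u] (Right (Var 0)) (e' (f u)) (size (e u) + 2)"
    unfolding e by (rule runs_mono[OF runs_Right[OF runs_Var0]]) simp
  show "size (e' (f u)) \<le> size (e u) + 2" using left_Pair[of "e u"] e by simp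
qed (intro pbound_intros)

lemma polytime_raw_isAtom: "(\<And>u. u \<in> D \<Longrightarrow> f u \<longleftrightarrow> e u = Atom) \<Longrightarrow> polytime D e enc_bool f"
proof (rule polytimeI[where B = "\<lambda>s. 5" and Q = "[]" and ex = "IfAtom (Var 0) (EPair EAtom EAtom) EAtom"])
  fix u assume "\<And>u. u \<in> D \<Longrightarrow> f u \<longleftrightarrow> e u = Atom" "u \<in> D"
  then have e: "f u \<longleftrightarrow> e u = Atom" by blast
  show "runs ([] @ [IfAtom (Var 0) (EPair EAtom EAtom) EAtom]) [e u] (IfAtom (Var 0) (EPair EAtom EAtom) EAtom) (enc_bool (f u)) 5"
  proof (cases "e u")
    case Atom
    have "runs Q [e u] (IfAtom (Var 0) (EPair EAtom EAtom) EAtom) (Pair Atom Atom) (1 + (1 + 1 + 1) + 1)" for Q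
      by (intro runs_If_Atom runs_Pair runs_Atom) (use runs_Var0[of Q "e u"] Atom in simp)
    from runs_mono[OF this, of 5] show ?thesis using e Atom by simp
  next
    case (Pair d1 d2)
    have "runs Q [e u] (IfAtom (Var 0) (EPair EAtom EAtom) EAtom) Atom (1 + 1 + 1)" for Q
      by (intro runs_If_Pair[of _ _ _ d1 d2] runs_Atom) (use runs_Var0[of Q "e u"] Pair in simp)
    from runs_mono[OF this, of 5] show ?thesis using e Pair by simp
  qed
  show "size (enc_bool (f u)) \<le> 5" by (cases "f u") auto
qed (intro pbound_intros)

lemma polytime_If:
  assumes "polytime D e enc_bool b" "polytime {u\<in>D. b u} e e' f" "polytime {u\<in>D. \<not> b u} e e' g"
  shows "polytime D e e' (\<lambda>u. if b u then f u else g u)"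
proof -
  let ?R1 = "graph D e enc_bool b"
  let ?R2 = "graph {u\<in>D. b u} e e' f"
  let ?R3 = "graph {u\<in>D. \<not> b u} e e' g"
  have "\<forall>R\<in>set [?R1, ?R2, ?R3]. ptime R" using assms by (simp add: polytime_def)
  from ptime_common[OF this] obtain Q i1 k1 i2 k2 i3 k3 where
    Q: "computes Q i1 k1 ?R1" "computes Q i2 k2 ?R2" "computes Q i3 k3 ?R3" by auto
  \<comment> \<open>\<open>True\<close> is coded by a \<open>Pair\<close>, so the branch for
    \<open>f\<close>, which is \<open>i2\<close>, comes last.\<close>
  let ?ex = "IfAtom (Call i1 [Var 0]) (Call i3 [Var 0]) (Call i2 [Var 0])"
  note Q = Q[THEN computes_append, of "[?ex]"]
  let ?B = "\<lambda>s. (1 + (s + 2) ^ k1 + 3) + (1 + (s + 2) ^ k2 + 3) + (1 + (s + 2) ^ k3 + 3) + (1::nat)"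
  show ?thesis
  proof (rule polytimeI[where B = ?B and ex = ?ex and Q = Q])
    fix u assume u: "u \<in> D"
    note r1 = polytime_runs[OF Q(1) u runs_Var0]
    have "runs (Q @ [?ex]) [e u] ?ex (e' (if b u then f u else g u)) (?B (size (e u))) \<and>
       size (e' (if b u then f u else g u)) \<le> ?B (size (e u))"
    proof (cases "b u")
      case True
      then have "u \<in> {u\<in>D. b u}" using u by simp
      note r2 = polytime_runs[OF Q(2) this runs_Var0]
      have "b u = True" using True by simp
      have "runs (Q @ [?ex]) [e u] ?ex (e' (f u)) ((1 + (size (e u) + 2) ^ k1 + 3) + (1 + (size (e u) + 2) ^ k2 + 3) + 1)"
        by (rule runs_If_Pair[OF r1(1)[unfolded \<open>b u = True\<close> enc_bool.simps] r2(1)])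
      then show ?thesis using True r2(2) by (auto intro: runs_mono)
    next
      case False
      then have "u \<in> {u\<in>D. \<not> b u}" using u by simp
      note r2 = polytime_runs[OF Q(3) this runs_Var0]
      have "b u = False" using False by simp
      have "runs (Q @ [?ex]) [e u] ?ex (e' (g u)) ((1 + (size (e u) + 2) ^ k1 + 3) + (1 + (size (e u) + 2) ^ k3 + 3) + 1)"
        by (rule runs_If_Atom[OF r1(1)[unfolded \<open>b u = False\<close> enc_bool.simps] r2(1)])
      then show ?thesis using False r2(2) by (auto intro: runs_mono)
    qed
    then show "runs (Q @ [?ex]) [e u] ?ex (e' (if b u then f u else g u)) (?B (size (e u)))"
       "size (e' (if b u then f u else g u)) \<le> ?B (size (e u))" by auto
  qed (intro pbound_intros)
qed

text \<open>Two measures are at work. \<open>bd\<close> bounds all sizes and does not grow along the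
  recursion, so a call costs at most \<open>T B\<close> apart from its subcalls; \<open>cnt\<close>
  bounds the number of calls, those of the subcalls adding up to less. Only on \<open>E\<close>,
  where recursions start, must \<open>bd\<close> be polynomial in the code. The flag
  \<open>two\<close> selects one or two recursive calls.\<close>

lemma rec_core:
  fixes f :: "'a \<Rightarrow> 'b" and bd cnt :: "'a \<Rightarrow> nat" and two :: bool
    and e :: "'a \<Rightarrow> data" and e' :: "'b \<Rightarrow> data" and lf rt :: "'a \<Rightarrow> 'a"
  defines "res \<equiv> \<lambda>u. Pair (e u) (Pair (e' (f (lf u))) (if two then e' (f (rt u)) else Atom))"
  assumes b: "polytime D e enc_bool b" and g: "polytime {u\<in>D. b u} e e' f"
    and l: "polytime {u\<in>D. \<not> b u} e e lf" and r: "polytime {u\<in>D. \<not> b u} e e rt"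
    and h: "polytime {u\<in>D. \<not> b u} res e' f"
    and step: "\<And>u. u \<in> D \<Longrightarrow> \<not> b u \<Longrightarrow> lf u \<in> D \<and> bd (lf u) \<le> bd u \<and>
      (two \<longrightarrow> rt u \<in> D \<and> bd (rt u) \<le> bd u) \<and> cnt (lf u) + (if two then cnt (rt u) else 0) < cnt u"
    and bd: "\<And>u. u \<in> D \<Longrightarrow> size (e u) \<le> bd u \<and> size (e' (f u)) \<le> bd u \<and> 0 < cnt u \<and> cnt u \<le> bd u"
    and E: "E \<subseteq> D" "\<And>u. u \<in> E \<Longrightarrow> bd u \<le> (size (e u) + 2) ^ kk"
  shows "polytime E e e' f"
proof -
  let ?N = "{u\<in>D. \<not> b u}"
  have "\<forall>R\<in>set [graph D e enc_bool b, graph {u\<in>D. b u} e e' f, graph ?N e e lf, graph ?N e e rt, graph ?N res e' f]. ptime R"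
    using assms by (simp add: polytime_def)
  from ptime_common[OF this] obtain Q i1 k1 i2 k2 i3 k3 i4 k4 i5 k5 where
    Q: "computes Q i1 k1 (graph D e enc_bool b)" "computes Q i2 k2 (graph {u\<in>D. b u} e e' f)"
      "computes Q i3 k3 (graph ?N e e lf)" "computes Q i4 k4 (graph ?N e e rt)" "computes Q i5 k5 (graph ?N res e' f)" by auto
  \<comment> \<open>The index that the new function will have, by which its body calls
    itself.\<close>
  define m where "m = length Q"
  define X where "X = (if two then Call m [Call i4 [Var 0]] else EAtom)"
  define ex where "ex = IfAtom (Call i1 [Var 0]) (Call i5 [EPair (Var 0) (EPair (Call m [Call i3 [Var 0]]) X)]) (Call i2 [Var 0])"
  note Q = Q[THEN computes_append, of "[ex]"]
  let ?Q = "Q @ [ex]"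
  define T where "T s = (s + 2) ^ k1 + (s + 2) ^ k2 + (s + 2) ^ k3 + (s + 2) ^ k4 + (3 * s + 4) ^ k5 + 50" for s :: nat
  have run: "runs ?Q [e u] ex (e' (f u)) (T B * cnt u)" if "u \<in> D" "bd u \<le> B" for u B
    using that
  proof (induction "cnt u" arbitrary: u rule: less_induct)
    case less
    note u = less.prems
    have su: "size (e u) \<le> B" "0 < cnt u" using bd[OF u(1)] u(2) by auto
    have pw: "(size (e u) + 2) ^ k \<le> (B + 2) ^ k" for k using su by (intro power_mono) auto
    note r1 = polytime_runs[OF Q(1) u(1) runs_Var0]
    show ?case
    proof (cases "b u")
      case True
      then have "u \<in> {u\<in>D. b u}" "b u = True" using u by auto
      note r2 = polytime_runs[OF Q(2) this(1) runs_Var0]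
      have "runs ?Q [e u] ex (e' (f u)) ((1 + (size (e u) + 2) ^ k1 + 3) + (1 + (size (e u) + 2) ^ k2 + 3) + 1)"
        unfolding ex_def by (rule runs_If_Pair[OF r1(1)[unfolded \<open>b u = True\<close> enc_bool.simps, unfolded ex_def] r2(1)[unfolded ex_def]])
      moreover have "(1 + (size (e u) + 2) ^ k1 + 3) + (1 + (size (e u) + 2) ^ k2 + 3) + 1 \<le> T B"
        unfolding T_def using pw[of k1] pw[of k2] by linarith
      moreover have "T B \<le> T B * cnt u" using su by simp
      ultimately show ?thesis by (meson runs_mono order_trans)
    next
      case False
      then have N: "u \<in> ?N" "b u = False" using u by auto
      note st = step[OF u(1) False]
      note r3 = polytime_runs[OF Q(3) N(1) runs_Var0] and r4 = polytime_runs[OF Q(4) N(1) runs_Var0]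
      have mQ: "m < length ?Q" "?Q ! m = ex" by (auto simp: m_def)
      have L: "runs ?Q [e u] (Call m [Call i3 [Var 0]]) (e' (f (lf u))) ((1 + (size (e u) + 2) ^ k3 + 3) + T B * cnt (lf u) + 3)"
        by (rule runs_Call[OF r3(1) mQ(1)], unfold mQ(2), rule less.hyps) (use st u in auto)
      define c where "c = (if two then cnt (rt u) else 0)"
      have Rr: "runs ?Q [e u] X (if two then e' (f (rt u)) else Atom) ((1 + (size (e u) + 2) ^ k4 + 3) + T B * c + 3)"
      proof (cases two)
        case True
        then have "runs ?Q [e u] (Call m [Call i4 [Var 0]]) (e' (f (rt u))) ((1 + (size (e u) + 2) ^ k4 + 3) + T B * cnt (rt u) + 3)"
          by (intro runs_Call[OF r4(1) mQ(1)], unfold mQ(2), intro less.hyps) (use st u True in auto)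
        then show ?thesis using True by (simp add: X_def c_def)
      next
        case False then show ?thesis by (auto simp: X_def intro: runs_mono[OF runs_Atom])
      qed
      note P = runs_Pair[OF runs_Var0 runs_Pair[OF L Rr]]
      note r5 = polytime_runs(1)[OF Q(5) N(1), unfolded res_def, OF P]
      have "size (e' (f (lf u))) \<le> B" "two \<Longrightarrow> size (e' (f (rt u))) \<le> B"
        using bd[of "lf u"] bd[of "rt u"] st u(2) by auto
      then have "size (res u) + 2 \<le> 3 * B + 4" using su by (auto simp: res_def)
      then have p5: "(size (res u) + 2) ^ k5 \<le> (3 * B + 4) ^ k5" by (intro power_mono) auto
      note fin = runs_If_Atom[OF r1(1)[unfolded N(2) enc_bool.simps] r5, of "Call i2 [Var 0]", folded ex_def]
      show ?thesis
      proof (rule runs_mono[OF fin])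
        have "T B * (cnt (lf u) + c + 1) \<le> T B * cnt u" using st by (intro mult_left_mono) (auto simp: c_def)
        then have "T B * cnt (lf u) + T B * c + T B \<le> T B * cnt u" by (simp add: algebra_simps)
        then show "1 + (size (e u) + 2) ^ k1 + 3 + (1 + (1 + (size (e u) + 2) ^ k3 + 3 + T B * cnt (lf u) + 3 +
           (1 + (size (e u) + 2) ^ k4 + 3 + T B * c + 3) + 1) + 1 +
           (size (Pair (e u) (Pair (e' (f (lf u))) (if two then e' (f (rt u)) else Atom))) + 2) ^ k5 + 3) + 1 \<le> T B * cnt u"
          using pw[of k1] pw[of k3] pw[of k4] p5[unfolded res_def] unfolding T_def[of B] by linarith
      qed
    qed
  qed
  let ?B = "\<lambda>s. T ((s + 2) ^ kk) * (s + 2) ^ kk + (s + 2) ^ kk"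
  show ?thesis
  proof (rule polytimeI[where B = ?B and Q = Q and ex = ex])
    show "pbound ?B" unfolding T_def by (intro pbound_intros)
    fix u assume u: "u \<in> E"
    then have "u \<in> D" using E by auto
    note c = bd[OF this]
    have A: "runs ?Q [e u] ex (e' (f u)) (T ((size (e u) + 2) ^ kk) * cnt u)"
      by (rule run[OF \<open>u \<in> D\<close> E(2)[OF u]])
    have "T ((size (e u) + 2) ^ kk) * cnt u \<le> T ((size (e u) + 2) ^ kk) * (size (e u) + 2) ^ kk"
      using c E(2)[OF u] by (intro mult_left_mono) auto
    then show "runs ?Q [e u] ex (e' (f u)) (?B (size (e u)))" by (intro runs_mono[OF A]) linarith
    show "size (e' (f u)) \<le> ?B (size (e u))" using c E(2)[OF u] by linarith
  qed
qed

text \<open>The step function \<open>h\<close> is required only on true recursive results, so that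
  facts about \<open>f\<close> can serve as its preconditions.\<close>

lemma polytime_rec2:
  fixes f :: "'a \<Rightarrow> 'b" and bd cnt :: "'a \<Rightarrow> nat"
  assumes eq: "\<And>u. u \<in> D \<Longrightarrow> f u = (if b u then g u else h u (f (lf u)) (f (rt u)))"
    and b: "polytime D e enc_bool b" and g: "polytime {u\<in>D. b u} e e' g"
    and l: "polytime {u\<in>D. \<not> b u} e e lf" and r: "polytime {u\<in>D. \<not> b u} e e rt"
    and h: "polytime {z. fst z \<in> D \<and> \<not> b (fst z) \<and> fst (snd z) = f (lf (fst z)) \<and> snd (snd z) = f (rt (fst z))}
      (epair e (epair e' e')) e' (\<lambda>z. h (fst z) (fst (snd z)) (snd (snd z)))"
    and step: "\<And>u. u \<in> D \<Longrightarrow> \<not> b u \<Longrightarrow> lf u \<in> D \<and> bd (lf u) \<le> bd u \<and>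
      rt u \<in> D \<and> bd (rt u) \<le> bd u \<and> cnt (lf u) + cnt (rt u) < cnt u"
    and bd: "\<And>u. u \<in> D \<Longrightarrow> size (e u) \<le> bd u \<and> size (e' (f u)) \<le> bd u \<and> 0 < cnt u \<and> cnt u \<le> bd u"
    and E: "E \<subseteq> D" "\<And>u. u \<in> E \<Longrightarrow> bd u \<le> (size (e u) + 2) ^ kk"
  shows "polytime E e e' f"
proof (rule rec_core[where two = True and bd = bd and cnt = cnt and D = D and e = e and e' = e' and f = f and b = b and lf = lf and rt = rt and E = E and kk = kk, OF b _ l r _ _ bd E])
  show "polytime {u\<in>D. b u} e e' f" by (rule polytime_cong[OF g]) (auto simp: eq)
  let ?P = "\<lambda>u. (u, f (lf u), f (rt u))"
  have *: "(graph {u\<in>D. \<not> b u} (\<lambda>u. Pair (e u) (Pair (e' (f (lf u))) (if True then e' (f (rt u)) else Atom))) e' f x y) \<Longrightarrow>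
    graph {z. fst z \<in> D \<and> \<not> b (fst z) \<and> fst (snd z) = f (lf (fst z)) \<and> snd (snd z) = f (rt (fst z))}
      (epair e (epair e' e')) e' (\<lambda>z. h (fst z) (fst (snd z)) (snd (snd z))) x y" for x y
    using eq unfolding graph_def by fastforce
  show "polytime {u\<in>D. \<not> b u} (\<lambda>u. Pair (e u) (Pair (e' (f (lf u))) (if True then e' (f (rt u)) else Atom))) e' f"
    using h * unfolding polytime_def ptime_def computes_def by blast
qed (use step in auto)

lemma polytime_rec1:
  fixes f :: "'a \<Rightarrow> 'b" and bd cnt :: "'a \<Rightarrow> nat"
  assumes eq: "\<And>u. u \<in> D \<Longrightarrow> f u = (if b u then g u else h u (f (lf u)))"
    and b: "polytime D e enc_bool b" and g: "polytime {u\<in>D. b u} e e' g"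
    and l: "polytime {u\<in>D. \<not> b u} e e lf"
    and h: "polytime {z. fst z \<in> D \<and> \<not> b (fst z) \<and> snd z = f (lf (fst z))} (epair e e') e' (\<lambda>z. h (fst z) (snd z))"
    and step: "\<And>u. u \<in> D \<Longrightarrow> \<not> b u \<Longrightarrow> lf u \<in> D \<and> bd (lf u) \<le> bd u \<and> cnt (lf u) < cnt u"
    and bd: "\<And>u. u \<in> D \<Longrightarrow> size (e u) \<le> bd u \<and> size (e' (f u)) \<le> bd u \<and> cnt u < bd u"
    and E: "E \<subseteq> D" "\<And>u. u \<in> E \<Longrightarrow> bd u \<le> (size (e u) + 2) ^ kk"
  shows "polytime E e e' f"
proof (rule rec_core[where two = False and bd = bd and cnt = "\<lambda>u. cnt u + 1" and D = D and e = e and e' = e' and f = f and b = b and lf = lf and rt = lf and E = E and kk = kk, OF b _ l l _ _ _ E])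
  show "polytime {u\<in>D. b u} e e' f" by (rule polytime_cong[OF g]) (auto simp: eq)
  let ?e = "\<lambda>z. Pair (e (fst z)) (Pair (e' (snd z)) Atom)"
  let ?N = "{z. fst z \<in> D \<and> \<not> b (fst z) \<and> snd z = f (lf (fst z))}"
  have 1: "polytime ?N ?e e fst" by (rule polytime_raw_left) simp
  have 2: "polytime ?N ?e (\<lambda>y. Pair (e' y) Atom) snd" by (rule polytime_raw_right) simp
  have 3: "polytime UNIV (\<lambda>y. Pair (e' y) Atom) e' (\<lambda>y. y)" by (rule polytime_raw_left) simp
  have "polytime ?N ?e (epair e e') (\<lambda>z. (fst z, snd z))"
    by (rule polytime_Pair[OF 1 polytime_compose[OF 2 3]]) simp
  then have "polytime ?N ?e (epair e e') (\<lambda>z. z)" by simp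
  from polytime_compose[OF this h]
  have *: "polytime {z. fst z \<in> D \<and> \<not> b (fst z) \<and> snd z = f (lf (fst z))} ?e e' (\<lambda>z. h (fst z) (snd z))" by simp
  have "(graph {u\<in>D. \<not> b u} (\<lambda>u. Pair (e u) (Pair (e' (f (lf u))) (if False then e' (f (lf u)) else Atom))) e' f x y) \<Longrightarrow>
    graph {z. fst z \<in> D \<and> \<not> b (fst z) \<and> snd z = f (lf (fst z))} ?e e' (\<lambda>z. h (fst z) (snd z)) x y" for x y
    using eq unfolding graph_def by fastforce
  then show "polytime {u\<in>D. \<not> b u} (\<lambda>u. Pair (e u) (Pair (e' (f (lf u))) (if False then e' (f (lf u)) else Atom))) e' f"
    using * unfolding polytime_def ptime_def computes_def by blast
next
  show "\<And>u. u \<in> D \<Longrightarrow> size (e u) \<le> bd u \<and> size (e' (f u)) \<le> bd u \<and> 0 < cnt u + 1 \<and> cnt u + 1 \<le> bd u"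
    using bd by (auto simp: Suc_le_eq)
qed (use step in auto)

text \<open>When the recursion passes to smaller codes, the size of the code counts the calls and a
  power of it bounds all sizes.\<close>

lemma polytime_rec1_size:
  fixes f :: "'a \<Rightarrow> 'b"
  assumes eq: "\<And>u. u \<in> D \<Longrightarrow> f u = (if b u then g u else h u (f (lf u)))"
    and b: "polytime D e enc_bool b" and g: "polytime {u\<in>D. b u} e e' g"
    and l: "polytime {u\<in>D. \<not> b u} e e lf"
    and h: "polytime {z. fst z \<in> D \<and> \<not> b (fst z) \<and> snd z = f (lf (fst z))} (epair e e') e' (\<lambda>z. h (fst z) (snd z))"
    and step: "\<And>u. u \<in> D \<Longrightarrow> \<not> b u \<Longrightarrow> lf u \<in> D \<and> size (e (lf u)) < size (e u)"
    and B: "pbound B" "\<And>u. u \<in> D \<Longrightarrow> size (e' (f u)) \<le> B (size (e u))"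
  shows "polytime D e e' f"
proof -
  from B(1) obtain k where k: "\<And>s. B s \<le> (s + 2) ^ k" by (auto simp: pbound_def)
  let ?bd = "\<lambda>u. (size (e u) + 2) ^ Suc k"
  show ?thesis
  proof (rule polytime_rec1[where bd = ?bd and cnt = "\<lambda>u. size (e u)" and kk = "Suc k", OF eq b g l h])
    fix u assume u: "u \<in> D"
    show "lf u \<in> D \<and> ?bd (lf u) \<le> ?bd u \<and> size (e (lf u)) < size (e u)" if "\<not> b u"
      using step[OF u that] by (intro conjI power_mono) auto
    have k1: "(size (e u) + 2) ^ k \<le> ?bd u" by (intro power_increasing) auto
    have "(size (e u) + 2) ^ 1 \<le> ?bd u" by (intro power_increasing) auto
    then show "size (e u) \<le> ?bd u \<and> size (e' (f u)) \<le> ?bd u \<and> size (e u) < ?bd u"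
      using B(2)[OF u] k[of "size (e u)"] k1 by simp
  qed auto
qed

section \<open>Lists and unary numbers\<close>

definition elist :: "('a \<Rightarrow> data) \<Rightarrow> 'a list \<Rightarrow> data" where
  "elist e xs = enc_list (map e xs)"

lemma elist_simps [simp]: "elist e [] = Atom" "elist e (x # xs) = Pair (e x) (elist e xs)"
  by (auto simp: elist_def)

lemma elist_tl: "elist e (tl xs) = right (elist e xs)"
  by (cases xs) auto

lemma elist_null: "xs = [] \<longleftrightarrow> elist e xs = Atom"
  by (cases xs) auto

lemma size_elist: "size (elist e xs) = (\<Sum>x\<leftarrow>xs. size (e x) + 1)"
  by (induction xs) auto

text \<open>Inside the construction numbers are in unary; this suffices because they are all polynomial in \<open>n\<close>.\<close>

definition enat :: "nat \<Rightarrow> data" where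
  "enat n = elist (\<lambda>_. Atom) (replicate n ())"

lemma enat_simps [simp]: "enat 0 = Atom" "enat (Suc n) = Pair Atom (enat n)"
  by (auto simp: enat_def)

lemma size_enat [simp]: "size (enat n) = n"
  by (induction n) auto

lemma size_epair [simp]: "size (epair e e' z) = size (e (fst z)) + size (e' (snd z)) + 1"
  by (simp add: epair_eq)

lemma polytime_op1: "polytime UNIV e1 e2 F \<Longrightarrow> polytime D e e1 f \<Longrightarrow> polytime D e e2 (\<lambda>u. F (f u))"
  by (rule polytime_compose[where g = F]) auto

lemma polytime_op1_on: "polytime D' e1 e2 F \<Longrightarrow> polytime D e e1 f \<Longrightarrow> (\<And>u. u \<in> D \<Longrightarrow> f u \<in> D') \<Longrightarrow> polytime D e e2 (\<lambda>u. F (f u))"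
  by (rule polytime_compose[where g = F])

lemma polytime_op2: "polytime UNIV (epair e1 e2) e3 (\<lambda>z. F (fst z) (snd z)) \<Longrightarrow> polytime D e e1 f \<Longrightarrow> polytime D e e2 g \<Longrightarrow>
    polytime D e e3 (\<lambda>u. F (f u) (g u))"
  using polytime_op1[of "epair e1 e2" e3 "\<lambda>z. F (fst z) (snd z)" D e "\<lambda>u. (f u, g u)"] polytime_Pair by fastforce

lemma polytime_op3: "polytime UNIV (epair e1 (epair e2 e3)) e4 (\<lambda>z. F (fst z) (fst (snd z)) (snd (snd z))) \<Longrightarrow>
    polytime D e e1 f \<Longrightarrow> polytime D e e2 g \<Longrightarrow> polytime D e e3 h \<Longrightarrow> polytime D e e4 (\<lambda>u. F (f u) (g u) (h u))"
  using polytime_op1[of "epair e1 (epair e2 e3)" e4 "\<lambda>z. F (fst z) (fst (snd z)) (snd (snd z))" D e "\<lambda>u. (f u, g u, h u)"]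
    polytime_Pair[of D e e1 f _ "\<lambda>u. (g u, h u)"] polytime_Pair[of D e e2 g e3 h] by fastforce

lemma polytime_fst: "polytime D e (epair e1 e2) f \<Longrightarrow> polytime D e e1 (\<lambda>u. fst (f u))"
  by (rule polytime_op1[rotated], assumption, rule polytime_raw_left) (simp add: epair_eq)

lemma polytime_snd: "polytime D e (epair e1 e2) f \<Longrightarrow> polytime D e e2 (\<lambda>u. snd (f u))"
  by (rule polytime_op1[rotated], assumption, rule polytime_raw_right) (simp add: epair_eq)

lemma polytime_hd: "polytime D e (elist e1) f \<Longrightarrow> (\<And>u. u \<in> D \<Longrightarrow> f u \<noteq> []) \<Longrightarrow> polytime D e e1 (\<lambda>u. hd (f u))"
  by (rule polytime_op1_on[where D' = "{xs. xs \<noteq> []}"], rule polytime_raw_left) (auto simp: neq_Nil_conv)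

lemma polytime_tl: "polytime D e (elist e1) f \<Longrightarrow> polytime D e (elist e1) (\<lambda>u. tl (f u))"
  by (rule polytime_op1[rotated], assumption, rule polytime_raw_right) (rule elist_tl)

lemma polytime_null: "polytime D e (elist e1) f \<Longrightarrow> polytime D e enc_bool (\<lambda>u. f u = [])"
  by (rule polytime_op1[rotated], assumption, rule polytime_raw_isAtom) (rule elist_null)

lemma polytime_Cons: "polytime D e e1 f \<Longrightarrow> polytime D e (elist e1) g \<Longrightarrow> polytime D e (elist e1) (\<lambda>u. f u # g u)"
proof (drule polytime_Pair, assumption)
  assume "polytime D e (epair e1 (elist e1)) (\<lambda>u. (f u, g u))"
  then show ?thesis by (rule polytime_cong) auto
qed

lemma polytime_Nil: "polytime D e (elist e1) (\<lambda>u. [])"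
  by (rule polytime_const)

lemma polytime_Suc: "polytime D e enat f \<Longrightarrow> polytime D e enat (\<lambda>u. Suc (f u))"
proof (drule polytime_Pair[OF polytime_const[where c = "()" and e' = "\<lambda>_. Atom"]])
  assume "polytime D e (epair (\<lambda>_. Atom) enat) (\<lambda>u. ((), f u))"
  then show ?thesis by (rule polytime_cong) auto
qed

lemma polytime_pred: "polytime D e enat f \<Longrightarrow> polytime D e enat (\<lambda>u. f u - 1)"
proof (rule polytime_op1[rotated], assumption, rule polytime_raw_right)
  fix n show "enat (n - 1) = right (enat n)" by (cases n) auto
qed

lemma polytime_zero: "polytime D e enat f \<Longrightarrow> polytime D e enc_bool (\<lambda>u. f u = 0)"
proof (rule polytime_op1[rotated], assumption, rule polytime_raw_isAtom)
  fix n show "n = 0 \<longleftrightarrow> enat n = Atom" by (cases n) auto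
qed

lemma polytime_not: "polytime D e enc_bool f \<Longrightarrow> polytime D e enc_bool (\<lambda>u. \<not> f u)"
  by (drule polytime_If[OF _ polytime_const[where c = False and e' = enc_bool] polytime_const[where c = True]]) (erule polytime_cong, auto)

lemma polytime_conj: "polytime D e enc_bool f \<Longrightarrow> polytime {u\<in>D. f u} e enc_bool g \<Longrightarrow> polytime D e enc_bool (\<lambda>u. f u \<and> g u)"
  by (drule (1) polytime_If[OF _ _ polytime_const[where c = False]]) (erule polytime_cong, auto)

lemma polytime_disj: "polytime D e enc_bool f \<Longrightarrow> polytime {u\<in>D. \<not> f u} e enc_bool g \<Longrightarrow> polytime D e enc_bool (\<lambda>u. f u \<or> g u)"
  by (drule (1) polytime_If[OF _ polytime_const[where c = True]]) (erule polytime_cong, auto)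

lemma polytime_bool_eq: "polytime D e enc_bool f \<Longrightarrow> polytime D e enc_bool g \<Longrightarrow> polytime D e enc_bool (\<lambda>u. f u = g u)"
proof -
  assume f: "polytime D e enc_bool f" and g: "polytime D e enc_bool g"
  have "polytime D e enc_bool (\<lambda>u. if f u then g u else \<not> g u)"
    by (rule polytime_If[OF f]) (auto intro: polytime_not polytime_subset[OF g])
  then show ?thesis by (rule polytime_cong) auto
qed

lemmas polytime_basic = polytime_id polytime_fst polytime_snd polytime_hd polytime_tl polytime_null polytime_Cons polytime_Nil polytime_Suc
  polytime_zero polytime_pred polytime_not polytime_Pair

lemma polytime_append0: "polytime UNIV (epair (elist e) (elist e)) (elist e) (\<lambda>z. fst z @ snd z)"
  by (rule polytime_rec1_size[where b = "\<lambda>z. fst z = []" and g = snd and lf = "\<lambda>z. (tl (fst z), snd z)"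
        and h = "\<lambda>z r. hd (fst z) # r" and B = "\<lambda>s. s"])
     (auto intro!: polytime_basic pbound_intros simp: size_elist neq_Nil_conv)

lemmas polytime_append = polytime_op2[OF polytime_append0]

lemma elist_upper: "(\<And>x. x \<in> set xs \<Longrightarrow> size (e x) \<le> m) \<Longrightarrow> size (elist e xs) \<le> length xs * (m + 1)"
proof (induction xs)
  case (Cons x xs)
  have "size (e x) \<le> m" "size (elist e xs) \<le> length xs * (m + 1)" using Cons by auto
  then show ?case by simp
qed simp

lemma elist_length: "length xs \<le> size (elist e xs)"
  by (induction xs) auto

lemma elist_mem: "x \<in> set xs \<Longrightarrow> size (e x) < size (elist e xs)"
  by (induction xs) auto

text \<open>The recursion consumes the list and carries \<open>u\<close> along. Its domain remembers
  that all entries stem from \<open>xs u\<close>, which bounds the size of their images.\<close>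

lemma polytime_map:
  assumes xs: "polytime D e (elist e1) xs"
    and h: "polytime {z. fst z \<in> D \<and> snd z \<in> set (xs (fst z))} (epair e e1) e2 (\<lambda>z. h (fst z) (snd z))"
  shows "polytime D e (elist e2) (\<lambda>u. map (h u) (xs u))"
proof -
  let ?D = "{z. fst z \<in> D \<and> set (snd z) \<subseteq> set (xs (fst z))}"
  let ?e = "epair e (elist e1)"
  obtain k where k: "\<And>z. fst z \<in> D \<Longrightarrow> snd z \<in> set (xs (fst z)) \<Longrightarrow>
      size (e2 (h (fst z) (snd z))) \<le> (size (epair e e1 z) + 2) ^ k"
    using polytime_size[OF h] by auto
  have "polytime ?D ?e (elist e2) (\<lambda>z. map (h (fst z)) (snd z))"
  proof (rule polytime_rec1_size[where b = "\<lambda>z. snd z = []" and g = "\<lambda>_. []" and lf = "\<lambda>z. (fst z, tl (snd z))"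
        and h = "\<lambda>z r. h (fst z) (hd (snd z)) # r" and B = "\<lambda>s. s * ((s + 2) ^ k + 1)"])
    show "polytime {z. fst z \<in> ?D \<and> snd (fst z) \<noteq> [] \<and> snd z = map (h (fst ((\<lambda>z. (fst z, tl (snd z))) (fst z)))) (snd ((\<lambda>z. (fst z, tl (snd z))) (fst z)))}
       (epair ?e (elist e2)) (elist e2) (\<lambda>z. h (fst (fst z)) (hd (snd (fst z))) # snd z)"
      (is "polytime ?Z ?ee _ _")
    proof (rule polytime_Cons)
      have "polytime ?Z ?ee e2 (\<lambda>z. (\<lambda>z. h (fst z) (snd z)) (fst (fst z), hd (snd (fst z))))"
        by (rule polytime_op1_on[OF h]) (auto intro!: polytime_basic)
      then show "polytime ?Z ?ee e2 (\<lambda>z. h (fst (fst z)) (hd (snd (fst z))))" by simp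
      show "polytime ?Z ?ee (elist e2) (\<lambda>z. snd z)" by (rule polytime_snd, rule polytime_id)
    qed
    fix u assume u: "u \<in> ?D"
    have "size (elist e2 (map (h (fst u)) (snd u))) \<le> length (map (h (fst u)) (snd u)) * ((size (?e u) + 2) ^ k + 1)"
    proof (rule elist_upper)
      fix y assume "y \<in> set (map (h (fst u)) (snd u))"
      then obtain x where x: "x \<in> set (snd u)" "y = h (fst u) x" by auto
      have "size (e2 y) \<le> (size (epair e e1 (fst u, x)) + 2) ^ k" using k[of "(fst u, x)"] x u by auto
      also have "\<dots> \<le> (size (?e u) + 2) ^ k" using elist_mem[OF x(1), of e1] by (intro power_mono) auto
      finally show "size (e2 y) \<le> (size (?e u) + 2) ^ k" .
    qed
    also have "\<dots> \<le> size (?e u) * ((size (?e u) + 2) ^ k + 1)"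
      using elist_length[of "snd u" e1] by (intro mult_right_mono) auto
    finally show "size (elist e2 (map (h (fst u)) (snd u))) \<le> size (?e u) * ((size (?e u) + 2) ^ k + 1)" .
  qed (auto intro!: polytime_basic pbound_intros simp: neq_Nil_conv)
  from polytime_op1_on[OF this, of D e "\<lambda>u. (u, xs u)"] show ?thesis
    using polytime_Pair[OF polytime_id xs] by auto
qed

lemma polytime_add0: "polytime UNIV (epair enat enat) enat (\<lambda>z. fst z + snd z)"
  by (rule polytime_rec1_size[where b = "\<lambda>z. fst z = 0" and g = snd and lf = "\<lambda>z. (fst z - 1, snd z)"
        and h = "\<lambda>z r. Suc r" and B = "\<lambda>s. s"])
     (auto intro!: polytime_basic[unfolded One_nat_def] pbound_intros)

lemmas polytime_add = polytime_op2[OF polytime_add0]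

lemma polytime_diff0: "polytime UNIV (epair enat enat) enat (\<lambda>z. fst z - snd z)"
  by (rule polytime_rec1_size[where b = "\<lambda>z. snd z = 0 \<or> fst z = 0" and g = fst and lf = "\<lambda>z. (fst z - 1, snd z - 1)"
        and h = "\<lambda>z r. r" and B = "\<lambda>s. s"])
     (auto intro!: polytime_basic[unfolded One_nat_def] polytime_disj pbound_intros)

lemmas polytime_diff = polytime_op2[OF polytime_diff0]

lemma polytime_le: "polytime D e enat f \<Longrightarrow> polytime D e enat g \<Longrightarrow> polytime D e enc_bool (\<lambda>u. f u \<le> g u)"
  by (drule (1) polytime_diff, drule polytime_zero) simp

lemma polytime_less: "polytime D e enat f \<Longrightarrow> polytime D e enat g \<Longrightarrow> polytime D e enc_bool (\<lambda>u. f u < g u)"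
  by (drule (1) polytime_le[rotated], drule polytime_not) (simp add: not_le)

lemma polytime_eq: "polytime D e enat f \<Longrightarrow> polytime D e enat g \<Longrightarrow> polytime D e enc_bool (\<lambda>u. f u = g u)"
proof -
  assume f: "polytime D e enat f" and g: "polytime D e enat g"
  have "polytime D e enc_bool (\<lambda>u. f u \<le> g u \<and> g u \<le> f u)"
    by (intro polytime_conj polytime_le f g polytime_subset[OF f] polytime_subset[OF g]) auto
  then show ?thesis by (rule polytime_cong) auto
qed

lemma polytime_max: "polytime D e enat f \<Longrightarrow> polytime D e enat g \<Longrightarrow> polytime D e enat (\<lambda>u. max (f u) (g u))"
proof -
  assume f: "polytime D e enat f" and g: "polytime D e enat g"
  have "polytime D e enat (\<lambda>u. if f u \<le> g u then g u else f u)"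
    by (intro polytime_If polytime_le f g polytime_subset[OF f] polytime_subset[OF g]) auto
  then show ?thesis by (rule polytime_cong) auto
qed

lemma polytime_min: "polytime D e enat f \<Longrightarrow> polytime D e enat g \<Longrightarrow> polytime D e enat (\<lambda>u. min (f u) (g u))"
proof -
  assume f: "polytime D e enat f" and g: "polytime D e enat g"
  have "polytime D e enat (\<lambda>u. if f u \<le> g u then f u else g u)"
    by (intro polytime_If polytime_le f g polytime_subset[OF f] polytime_subset[OF g]) auto
  then show ?thesis by (rule polytime_cong) auto
qed

lemma polytime_mult0: "polytime UNIV (epair enat enat) enat (\<lambda>z. fst z * snd z)"
proof (rule polytime_rec1_size[where b = "\<lambda>z. fst z = 0" and g = "\<lambda>_. 0" and lf = "\<lambda>z. (fst z - 1, snd z)"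
        and h = "\<lambda>z r. snd z + r" and B = "\<lambda>s. s * s"])
  fix z :: "nat \<times> nat"
  show "size (enat (fst z * snd z)) \<le> size (epair enat enat z) * size (epair enat enat z)"
    by (simp, intro order_trans[OF mult_le_mono[of "fst z" "Suc (fst z + snd z)" "snd z" "Suc (fst z + snd z)"]]) auto
  show "fst z * snd z = (if fst z = 0 then 0 else snd z + fst (fst z - 1, snd z) * snd (fst z - 1, snd z))"
    by (cases "fst z") auto
qed (auto intro!: polytime_basic[unfolded One_nat_def] polytime_add polytime_const pbound_intros)

lemmas polytime_mult = polytime_op2[OF polytime_mult0]

lemma polytime_div0: "polytime UNIV (epair enat enat) enat (\<lambda>z. fst z div snd z)"
proof (rule polytime_rec1_size[where b = "\<lambda>z. snd z = 0 \<or> fst z < snd z" and g = "\<lambda>_. 0" and lf = "\<lambda>z. (fst z - snd z, snd z)"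
        and h = "\<lambda>z r. Suc r" and B = "\<lambda>s. s"])
  fix z :: "nat \<times> nat"
  show "size (enat (fst z div snd z)) \<le> size (epair enat enat z)"
    unfolding size_enat size_epair using div_le_dividend[of "fst z" "snd z"] by linarith
qed (auto intro!: polytime_basic polytime_disj polytime_less polytime_diff polytime_const pbound_intros simp: le_div_geq)

lemmas polytime_div = polytime_op2[OF polytime_div0]

lemma polytime_mod0: "polytime UNIV (epair enat enat) enat (\<lambda>z. fst z mod snd z)"
proof (rule polytime_rec1_size[where b = "\<lambda>z. snd z = 0 \<or> fst z < snd z" and g = fst and lf = "\<lambda>z. (fst z - snd z, snd z)"
        and h = "\<lambda>z r. r" and B = "\<lambda>s. s"])
  fix z :: "nat \<times> nat"
  show "size (enat (fst z mod snd z)) \<le> size (epair enat enat z)"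
    unfolding size_enat size_epair using mod_less_eq_dividend[of "fst z" "snd z"] by linarith
qed (auto intro!: polytime_basic polytime_disj polytime_less polytime_diff polytime_const pbound_intros simp: le_mod_geq)

lemmas polytime_mod = polytime_op2[OF polytime_mod0]

lemma polytime_even: "polytime D e enat f \<Longrightarrow> polytime D e enc_bool (\<lambda>u. even (f u))"
  unfolding even_iff_mod_2_eq_zero by (intro polytime_zero polytime_mod polytime_const)

lemma polytime_length0: "polytime UNIV (elist e) enat length"
  by (rule polytime_rec1_size[where b = "\<lambda>xs. xs = []" and g = "\<lambda>_. 0" and lf = tl
        and h = "\<lambda>xs r. Suc r" and B = "\<lambda>s. s"])
     (auto intro!: polytime_basic polytime_const pbound_intros elist_length simp: neq_Nil_conv)

lemmas polytime_length = polytime_op1[OF polytime_length0]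

lemma polytime_concat0: "polytime UNIV (elist (elist e)) (elist e) concat"
proof (rule polytime_rec1_size[where b = "\<lambda>xs. xs = []" and g = "\<lambda>_. []" and lf = tl
        and h = "\<lambda>xs r. hd xs @ r" and B = "\<lambda>s. s"])
  fix xs :: "'a list list"
  show "size (elist e (concat xs)) \<le> size (elist (elist e) xs)" by (induction xs) (auto simp: size_elist)
qed (auto intro!: polytime_basic polytime_append pbound_intros simp: neq_Nil_conv)

lemmas polytime_concat = polytime_op1[OF polytime_concat0]

lemma polytime_upt0: "polytime UNIV enat (elist enat) (\<lambda>n. [0..<n])"
proof (rule polytime_rec1_size[where b = "\<lambda>n. n = 0" and g = "\<lambda>_. []" and lf = "\<lambda>n. n - 1"
        and h = "\<lambda>n r. r @ [n - 1]" and B = "\<lambda>s. s * (s + 1)"])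
  fix n :: nat
  show "size (elist enat [0..<n]) \<le> size (enat n) * (size (enat n) + 1)"
    using elist_upper[of "[0..<n]" enat n] by auto
  show "[0..<n] = (if n = 0 then [] else [0..<n - 1] @ [n - 1])" by (cases n) auto
qed (auto intro!: polytime_basic[unfolded One_nat_def] polytime_append pbound_intros)

lemmas polytime_upt = polytime_op1[OF polytime_upt0]

lemma polytime_upt1: "polytime D e enat f \<Longrightarrow> polytime D e (elist enat) (\<lambda>u. [1..<f u + 1])"
proof -
  assume f: "polytime D e enat f"
  have "polytime D e (elist enat) (\<lambda>u. map (\<lambda>i. Suc i) [0..<f u])"
    by (rule f polytime_map polytime_upt polytime_Suc polytime_snd polytime_id)+
  then show ?thesis by (rule polytime_cong) (auto simp: map_Suc_upt)
qed

lemma polytime_last0: "polytime {xs. xs \<noteq> []} (elist e) e last"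
proof (rule polytime_rec1_size[where b = "\<lambda>xs. tl xs = []" and g = hd and lf = tl
        and h = "\<lambda>xs r. r" and B = "\<lambda>s. s"])
  fix xs :: "'a list" assume "xs \<in> {xs. xs \<noteq> []}"
  then show "size (e (last xs)) \<le> size (elist e xs)" using elist_mem[of "last xs" xs e] by auto
qed (auto intro!: polytime_basic pbound_intros simp: neq_Nil_conv split: if_splits)

lemma polytime_last: "polytime D e (elist e1) f \<Longrightarrow> (\<And>u. u \<in> D \<Longrightarrow> f u \<noteq> []) \<Longrightarrow> polytime D e e1 (\<lambda>u. last (f u))"
  by (rule polytime_op1_on[OF polytime_last0]) auto

lemma polytime_butlast0: "polytime UNIV (elist e) (elist e) butlast"
proof (rule polytime_rec1_size[where b = "\<lambda>xs. tl xs = []" and g = "\<lambda>_. []" and lf = tl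
        and h = "\<lambda>xs r. hd xs # r" and B = "\<lambda>s. s"])
  fix xs :: "'a list"
  show "butlast xs = (if tl xs = [] then [] else hd xs # butlast (tl xs))" by (cases xs) auto
  show "size (elist e (butlast xs)) \<le> size (elist e xs)" by (induction xs) auto
  show "tl xs \<in> UNIV \<and> size (elist e (tl xs)) < size (elist e xs)" if "tl xs \<noteq> []" using that by (cases xs) auto
qed (auto intro!: polytime_basic pbound_intros)

lemmas polytime_butlast = polytime_op1[OF polytime_butlast0]

lemma polytime_sum_list0: "polytime UNIV (elist enat) enat sum_list"
proof (rule polytime_rec1_size[where b = "\<lambda>xs. xs = []" and g = "\<lambda>_. 0" and lf = tl
        and h = "\<lambda>xs r. hd xs + r" and B = "\<lambda>s. s"])
  fix xs :: "nat list"
  show "size (enat (sum_list xs)) \<le> size (elist enat xs)" by (induction xs) auto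
qed (auto intro!: polytime_basic polytime_add polytime_const pbound_intros simp: neq_Nil_conv)

lemmas polytime_sum_list = polytime_op1[OF polytime_sum_list0]

lemma polytime_foldr_max0: "polytime UNIV (elist enat) enat (\<lambda>xs. foldr max xs c)"
proof (rule polytime_rec1_size[where b = "\<lambda>xs. xs = []" and g = "\<lambda>_. c" and lf = tl
        and h = "\<lambda>xs r. max (hd xs) r" and B = "\<lambda>s. s + c"])
  fix xs :: "nat list"
  show "size (enat (foldr max xs c)) \<le> size (elist enat xs) + c" by (induction xs) auto
qed (auto intro!: polytime_basic polytime_max polytime_const pbound_intros simp: neq_Nil_conv)

lemmas polytime_foldr_max = polytime_op1[OF polytime_foldr_max0]

text \<open>In unary a power is as long as its value, so a polynomial bound on the values has to be
  supplied from outside.\<close>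

lemma polytime_pow2:
  assumes f: "polytime D e enat f" and B: "pbound B" "\<And>u. u \<in> D \<Longrightarrow> 2 ^ f u \<le> B (size (e u))"
  shows "polytime D e enat (\<lambda>u. 2 ^ f u)"
proof -
  obtain k where k: "\<And>s. B s \<le> (s + 2) ^ k" using B(1) by (auto simp: pbound_def)
  let ?D = "{z. fst z \<in> D \<and> snd z \<le> f (fst z)}"
  have "polytime ?D (epair e enat) enat (\<lambda>z. 2 ^ snd z)"
  proof (rule polytime_rec1_size[where b = "\<lambda>z. snd z = 0" and g = "\<lambda>_. 1" and lf = "\<lambda>z. (fst z, snd z - 1)"
        and h = "\<lambda>z r. r + r" and B = "\<lambda>s. (s + 2) ^ k"])
    fix z assume z: "z \<in> ?D"
    have "(2::nat) ^ snd z \<le> 2 ^ f (fst z)" using z by (intro power_increasing) auto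
    also have "\<dots> \<le> (size (e (fst z)) + 2) ^ k" using B(2)[of "fst z"] k z by (auto intro: order_trans)
    also have "\<dots> \<le> (size (epair e enat z) + 2) ^ k" by (intro power_mono) auto
    finally show "size (enat (2 ^ snd z)) \<le> (size (epair e enat z) + 2) ^ k" by simp
    show "(2::nat) ^ snd z = (if snd z = 0 then 1 else 2 ^ snd (fst z, snd z - 1) + 2 ^ snd (fst z, snd z - 1))"
      by (cases "snd z") auto
  qed (auto intro!: polytime_basic[unfolded One_nat_def] polytime_add polytime_const pbound_intros)
  from polytime_op1_on[OF this polytime_Pair[OF polytime_id f]] show ?thesis by simp
qed

section \<open>Binary numbers, used for arrival times and for the vertex numbers of the
  output\<close>

lemma enc_nat_0 [simp]: "enc_nat 0 = Atom"
  by (simp add: enc_nat.simps)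

lemma enc_nat_pos: "n \<noteq> 0 \<Longrightarrow> enc_nat n = Pair (enc_bool (odd n)) (enc_nat (n div 2))"
  by (subst enc_nat.simps) simp

lemma polytime_bzero: "polytime D e enc_nat f \<Longrightarrow> polytime D e enc_bool (\<lambda>u. f u = 0)"
proof (rule polytime_op1[rotated], assumption, rule polytime_raw_isAtom)
  fix n show "n = 0 \<longleftrightarrow> enc_nat n = Atom" by (cases "n = 0") (auto simp: enc_nat_pos)
qed

lemma polytime_bhalf: "polytime D e enc_nat f \<Longrightarrow> polytime D e enc_nat (\<lambda>u. f u div 2)"
proof (rule polytime_op1[rotated], assumption, rule polytime_raw_right)
  fix n show "enc_nat (n div 2) = right (enc_nat n)" by (cases "n = 0") (auto simp: enc_nat_pos)
qed

lemma polytime_bodd: "polytime D e enc_nat f \<Longrightarrow> polytime D e enc_bool (\<lambda>u. odd (f u))"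
proof (rule polytime_op1[where F = odd], rule polytime_raw_left)
  fix n :: nat show "enc_bool (odd n) = left (enc_nat n)" by (cases "n = 0") (auto simp: enc_nat_pos)
qed

lemma polytime_beven: "polytime D e enc_nat f \<Longrightarrow> polytime D e enc_bool (\<lambda>u. even (f u))"
  using polytime_not[OF polytime_bodd[of D e f]] by simp

lemma polytime_bdouble: "polytime D e enc_nat f \<Longrightarrow> (\<And>u. u \<in> D \<Longrightarrow> f u \<noteq> 0) \<Longrightarrow> polytime D e enc_nat (\<lambda>u. 2 * f u)"
proof -
  assume f: "polytime D e enc_nat f" "\<And>u. u \<in> D \<Longrightarrow> f u \<noteq> 0"
  have "polytime D e (epair enc_bool enc_nat) (\<lambda>u. (False, f u))" by (intro polytime_Pair polytime_const f)
  then show ?thesis by (rule polytime_cong) (use f(2) in \<open>auto simp: enc_nat_pos\<close>)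
qed

lemma polytime_bdouble1: "polytime D e enc_nat f \<Longrightarrow> polytime D e enc_nat (\<lambda>u. Suc (2 * f u))"
proof -
  assume f: "polytime D e enc_nat f"
  have "polytime D e (epair enc_bool enc_nat) (\<lambda>u. (True, f u))" by (intro polytime_Pair polytime_const f)
  then show ?thesis by (rule polytime_cong) (auto simp: enc_nat_pos)
qed

lemma enc_nat_half: "n \<noteq> 0 \<Longrightarrow> size (enc_nat (n div 2)) < size (enc_nat n)"
  by (simp add: enc_nat_pos)

lemma enc_nat_Suc: "size (enc_nat (Suc n)) \<le> size (enc_nat n) + 2"
proof (induction n rule: less_induct)
  case (less n)
  show ?case
  proof (cases "even n")
    case True
    then show ?thesis by (cases "n = 0") (auto simp: enc_nat_pos)
  next
    case False
    then obtain m where n: "n = Suc (2 * m)" by (metis oddE Suc_eq_plus1)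
    then show ?thesis using less[of m] by (auto simp: enc_nat_pos)
  qed
qed

lemma size_enc_nat: "size (enc_nat n) \<le> 2 * n"
  by (induction n) (use enc_nat_Suc le_trans in \<open>fastforce+\<close>)

text \<open>A carry runs through the odd digits: \<open>Suc n = 2 * Suc (n div 2)\<close> for odd
  \<open>n\<close>. That the recursive result is a successor, hence nonzero, permits doubling by
  prefixing a digit.\<close>

lemma polytime_bSuc0: "polytime UNIV enc_nat enc_nat Suc"
proof (rule polytime_rec1_size[where b = "\<lambda>n. \<not> odd n" and g = "\<lambda>n. Suc (2 * (n div 2))" and lf = "\<lambda>n. n div 2"
        and h = "\<lambda>n r. 2 * r" and B = "\<lambda>s. s + 2"])
  show "polytime {z. fst z \<in> UNIV \<and> \<not> \<not> odd (fst z) \<and> snd z = Suc (fst z div 2)} (epair enc_nat enc_nat) enc_nat (\<lambda>z. 2 * snd z)"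
    by (rule polytime_bdouble polytime_snd polytime_id | auto)+
  show "size (enc_nat (Suc u)) \<le> size (enc_nat u) + 2" for u by (rule enc_nat_Suc)
qed (auto intro!: polytime_basic polytime_beven polytime_bhalf polytime_bdouble1 pbound_intros enc_nat_half elim!: oddE)

lemmas polytime_bSuc = polytime_op1[OF polytime_bSuc0]

text \<open>Halving both sides preserves \<open>\<le>\<close> unless the left one is odd and the
  right one even; then the halves must satisfy the strict inequality, that is the negation of the
  comparison with sides swapped.\<close>

lemma polytime_ble0: "polytime UNIV (epair enc_nat enc_nat) enc_bool (\<lambda>z. fst z \<le> snd z)"
proof (rule polytime_rec1_size[where b = "\<lambda>z. fst z = 0 \<or> snd z = 0" and g = "\<lambda>z. fst z = 0"
        and lf = "\<lambda>z. if odd (fst z) \<and> \<not> odd (snd z) then (snd z div 2, fst z div 2) else (fst z div 2, snd z div 2)"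
        and h = "\<lambda>z r. r = (\<not> (odd (fst z) \<and> \<not> odd (snd z)))" and B = "\<lambda>s. 1"])
  fix z :: "nat \<times> nat"
  let ?c = "odd (fst z) \<and> \<not> odd (snd z)"
  let ?l = "if ?c then (snd z div 2, fst z div 2) else (fst z div 2, snd z div 2)"
  show "(fst z \<le> snd z) = (if fst z = 0 \<or> snd z = 0 then fst z = 0 else (fst ?l \<le> snd ?l) = (\<not> ?c))"
    by (auto elim!: oddE evenE)
  show "?l \<in> UNIV \<and> size (epair enc_nat enc_nat ?l) < size (epair enc_nat enc_nat z)" if "\<not> (fst z = 0 \<or> snd z = 0)"
    using that enc_nat_half[of "fst z"] enc_nat_half[of "snd z"] by auto
  show "size (enc_bool (fst z \<le> snd z)) \<le> 1" by (cases "fst z \<le> snd z") auto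
  have c: "polytime D (epair enc_nat enc_nat) enc_bool (\<lambda>z. odd (fst z) \<and> \<not> odd (snd z))" for D
    by (rule polytime_conj polytime_not polytime_beven polytime_fst polytime_snd polytime_id)+
  show "polytime {u \<in> UNIV. \<not> (fst u = 0 \<or> snd u = 0)} (epair enc_nat enc_nat) (epair enc_nat enc_nat)
     (\<lambda>z. if odd (fst z) \<and> \<not> odd (snd z) then (snd z div 2, fst z div 2) else (fst z div 2, snd z div 2))"
    by (rule polytime_If c polytime_Pair polytime_bhalf polytime_fst polytime_snd polytime_id)+
  show "polytime {z. fst z \<in> UNIV \<and> \<not> (fst (fst z) = 0 \<or> snd (fst z) = 0) \<and>
      snd z = (fst (if odd (fst (fst z)) \<and> \<not> odd (snd (fst z)) then (snd (fst z) div 2, fst (fst z) div 2) else (fst (fst z) div 2, snd (fst z) div 2))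
        \<le> snd (if odd (fst (fst z)) \<and> \<not> odd (snd (fst z)) then (snd (fst z) div 2, fst (fst z) div 2) else (fst (fst z) div 2, snd (fst z) div 2)))}
     (epair (epair enc_nat enc_nat) enc_bool) enc_bool
     (\<lambda>z. snd z = (\<not> (odd (fst (fst z)) \<and> \<not> odd (snd (fst z)))))"
    by (rule polytime_bool_eq polytime_not polytime_conj polytime_beven polytime_fst polytime_snd polytime_id)+
qed (rule pbound_intros polytime_disj polytime_bzero polytime_fst polytime_snd polytime_id)+

lemmas polytime_ble = polytime_op2[OF polytime_ble0]

lemma polytime_bmax: "polytime D e enc_nat f \<Longrightarrow> polytime D e enc_nat g \<Longrightarrow> polytime D e enc_nat (\<lambda>u. max (f u) (g u))"
proof -
  assume f: "polytime D e enc_nat f" and g: "polytime D e enc_nat g"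
  have "polytime D e enc_nat (\<lambda>u. if f u \<le> g u then g u else f u)"
    by (intro polytime_If polytime_ble f g polytime_subset[OF f] polytime_subset[OF g]) auto
  then show ?thesis by (rule polytime_cong) auto
qed

lemma polytime_bin0: "polytime UNIV enat enc_nat (\<lambda>n. n)"
  by (rule polytime_rec1_size[where b = "\<lambda>n. n = 0" and g = "\<lambda>_. 0" and lf = "\<lambda>n. n - 1"
        and h = "\<lambda>n r. Suc r" and B = "\<lambda>s. 2 * s"])
     (auto intro!: polytime_basic[unfolded One_nat_def] polytime_bSuc polytime_const pbound_intros size_enc_nat)

lemmas polytime_bin = polytime_op1[OF polytime_bin0]

lemmas polytime_rules = polytime_const polytime_id polytime_fst polytime_snd polytime_Pair polytime_If polytime_null polytime_zero polytime_not
  polytime_conj polytime_disj polytime_le polytime_less polytime_eq polytime_bool_eq polytime_Suc polytime_pred polytime_add polytime_diff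
  polytime_max polytime_min polytime_mult polytime_div polytime_mod polytime_even polytime_length polytime_concat polytime_upt polytime_upt1
  polytime_butlast polytime_sum_list polytime_foldr_max polytime_append polytime_tl polytime_Cons polytime_map polytime_hd polytime_last

section \<open>Parameters, weights and items\<close>

lemma hl_mem: "x \<in> set (hl m) \<Longrightarrow> x \<le> m"
proof (induction m rule: hl.induct)
  case (1 m)
  show ?case
  proof (cases "m = 0")
    case False
    then have "x = m \<or> x \<in> set (hl (m div 2))" using 1(2) by (simp add: hl.simps[of m])
    moreover have "m div 2 \<le> m" by simp
    ultimately show ?thesis using 1(1)[OF False] by linarith
  qed (use 1(2) in \<open>simp add: hl.simps[of 0]\<close>)
qed

lemma hl_length_le: "length (hl m) \<le> m"
proof (induction m rule: hl.induct)
  case (1 m)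
  then show ?case by (cases "m = 0") (auto simp: hl.simps[of m] hl.simps[of 0])
qed

lemma polytime_hl0: "polytime UNIV enat (elist enat) hl"
proof (rule polytime_rec1_size[where b = "\<lambda>n. n = 0" and g = "\<lambda>_. []" and lf = "\<lambda>n. n div 2"
        and h = "\<lambda>n r. n # r" and B = "\<lambda>s. s * (s + 1)"])
  fix n :: nat
  show "hl n = (if n = 0 then [] else n # hl (n div 2))" by (rule hl.simps)
  have "size (elist enat (hl n)) \<le> length (hl n) * (n + 1)" by (rule elist_upper) (auto dest: hl_mem)
  also have "\<dots> \<le> n * (n + 1)" by (intro mult_right_mono hl_length_le) auto
  finally show "size (elist enat (hl n)) \<le> size (enat n) * (size (enat n) + 1)" by simp
qed (rule polytime_rules pbound_intros | simp)+

lemmas polytime_hl = polytime_op1[OF polytime_hl0]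

lemma polytime_low0: "polytime UNIV enat enat low"
proof (rule polytime_rec1_size[where b = "\<lambda>n. n = 0 \<or> odd n" and g = "\<lambda>_. 1" and lf = "\<lambda>n. n div 2"
        and h = "\<lambda>n r. r + r" and B = "\<lambda>s. s + 1"])
  fix n :: nat
  show "low n = (if n = 0 \<or> odd n then 1 else low (n div 2) + low (n div 2))" by (subst low.simps) auto
  show "size (enat (low n)) \<le> size (enat n) + 1" using low_le[of n] by (cases "n = 0") (auto simp: low.simps[of 0])
qed (rule polytime_rules pbound_intros | simp)+

lemmas polytime_low = polytime_op1[OF polytime_low0]

lemma polytime_chain0: "polytime UNIV enat (elist enat) chain"
proof (rule polytime_rec1_size[where b = "\<lambda>n. n = 0" and g = "\<lambda>_. []" and lf = "\<lambda>n. n div 2"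
        and h = "\<lambda>n r. (if odd n then [n] else []) @ map (\<lambda>i. 2 * i) r" and B = "\<lambda>s. s * (s + 1)"])
  fix n :: nat
  show "chain n = (if n = 0 then [] else (if odd n then [n] else []) @ map ((*) 2) (chain (n div 2)))"
    by (rule chain.simps)
  have "size (elist enat (chain n)) \<le> length (chain n) * (n + 1)" by (rule elist_upper) (auto dest: chain_bounds)
  also have "\<dots> \<le> n * (n + 1)" by (intro mult_right_mono chain_length) auto
  finally show "size (elist enat (chain n)) \<le> size (enat n) * (size (enat n) + 1)" by simp
qed (rule polytime_rules pbound_intros | simp)+

lemmas polytime_chain = polytime_op1[OF polytime_chain0]

lemma geta_mem: "geta d xs i = d \<or> geta d xs i \<in> set xs"
  by (induction xs arbitrary: i) auto

lemma polytime_geta0: "polytime UNIV (epair (elist e) enat) e (\<lambda>z. geta d (fst z) (snd z))"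
proof (rule polytime_rec1_size[where b = "\<lambda>z. fst z = [] \<or> snd z = 0" and g = "\<lambda>z. if fst z = [] then d else hd (fst z)"
        and lf = "\<lambda>z. (tl (fst z), snd z - 1)" and h = "\<lambda>z r. r" and B = "\<lambda>s. s + size (e d)"])
  fix z :: "'a list \<times> nat"
  show "geta d (fst z) (snd z) = (if fst z = [] \<or> snd z = 0 then if fst z = [] then d else hd (fst z)
      else geta d (fst (tl (fst z), snd z - 1)) (snd (tl (fst z), snd z - 1)))"
    by (cases "fst z") auto
  have "size (e (geta d xs i)) \<le> size (elist e xs) + size (e d)" for xs i
    using geta_mem[of d xs i] elist_mem[of "geta d xs i" xs e] by (auto simp: less_imp_le trans_le_add1)
  from this[of "fst z" "snd z"] show "size (e (geta d (fst z) (snd z))) \<le> size (epair (elist e) enat z) + size (e d)"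
    unfolding size_epair by linarith
  show "(tl (fst z), snd z - 1) \<in> UNIV \<and> size (epair (elist e) enat (tl (fst z), snd z - 1)) < size (epair (elist e) enat z)"
    if "\<not> (fst z = [] \<or> snd z = 0)" using that by (cases "fst z") auto
qed (rule polytime_rules pbound_intros | simp)+

lemmas polytime_geta = polytime_op2[OF polytime_geta0]

type_synonym 'a enc = "'a \<Rightarrow> data"

abbreviation eal :: "times enc" where "eal \<equiv> elist (epair enc_nat enc_nat)"

lemma wt_mem: "wt m x ps = 1 \<or> wt m x ps \<in> set ps"
  by (induction m x ps rule: wt.induct) auto

text \<open>The binary counter may gain two \<open>Pair\<close> nodes per step
  (\<open>enc_nat_Suc\<close>), which \<open>2 * length\<close> in \<open>bd\<close> reserves. The
  number of steps is limited by the list of powers and not by the arrival times, whose values may be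
  exponential.\<close>

lemma polytime_wt0: "polytime UNIV (epair enc_nat (epair enc_nat (elist enat))) enat (\<lambda>z. wt (fst z) (fst (snd z)) (snd (snd z)))"
proof (rule polytime_rec1[where D = UNIV and b = "\<lambda>z. snd (snd z) = [] \<or> fst z \<le> fst (snd z)"
      and g = "\<lambda>z. if snd (snd z) = [] then 1 else hd (snd (snd z))" and lf = "\<lambda>z. (fst z, Suc (fst (snd z)), tl (snd (snd z)))"
      and h = "\<lambda>z r. r" and cnt = "\<lambda>z. length (snd (snd z))" and kk = 3
      and bd = "\<lambda>z. size (enc_nat (fst z)) + size (enc_nat (fst (snd z))) + 2 * length (snd (snd z)) + size (elist enat (snd (snd z))) + 3"])
  fix z :: "nat \<times> nat \<times> nat list"
  obtain m x ps where z: "z = (m, x, ps)" by (cases z)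
  show "wt (fst z) (fst (snd z)) (snd (snd z)) = (if snd (snd z) = [] \<or> fst z \<le> fst (snd z)
     then if snd (snd z) = [] then 1 else hd (snd (snd z)) else wt (fst (fst z, Suc (fst (snd z)), tl (snd (snd z))))
       (fst (snd (fst z, Suc (fst (snd z)), tl (snd (snd z))))) (snd (snd (fst z, Suc (fst (snd z)), tl (snd (snd z))))))"
    by (cases ps) (auto simp: z)
  let ?bd = "\<lambda>z :: nat \<times> nat \<times> nat list. size (enc_nat (fst z)) + size (enc_nat (fst (snd z))) + 2 * length (snd (snd z)) + size (elist enat (snd (snd z))) + 3"
  let ?l = "(fst z, Suc (fst (snd z)), tl (snd (snd z)))"
  show "?l \<in> UNIV \<and> ?bd ?l \<le> ?bd z \<and> length (snd (snd ?l)) < length (snd (snd z))" if "\<not> (snd (snd z) = [] \<or> fst z \<le> fst (snd z))"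
    using that enc_nat_Suc[of x] by (cases ps) (auto simp: z)
  have "wt m x ps \<le> size (elist enat ps) + 1" using wt_mem[of m x ps] elist_mem[of _ ps enat] by force
  then show "size (epair enc_nat (epair enc_nat (elist enat)) z) \<le> ?bd z \<and>
      size (enat (wt (fst z) (fst (snd z)) (snd (snd z)))) \<le> ?bd z \<and> length (snd (snd z)) < ?bd z"
    by (auto simp: z)
  have "length ps \<le> size (elist enat ps)" by (rule elist_length)
  then have "?bd z \<le> 4 * (size (epair enc_nat (epair enc_nat (elist enat)) z) + 2)" by (simp add: z)
  also have "\<dots> \<le> (size (epair enc_nat (epair enc_nat (elist enat)) z) + 2) ^ 2 * (size (epair enc_nat (epair enc_nat (elist enat)) z) + 2)"
    by (intro mult_right_mono) (auto simp: power2_eq_square)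
  finally show "?bd z \<le> (size (epair enc_nat (epair enc_nat (elist enat)) z) + 2) ^ 3"
    by (simp only: power3_eq_cube power2_eq_square)
qed (rule polytime_const polytime_id polytime_fst polytime_snd polytime_Pair polytime_If polytime_null polytime_disj polytime_ble polytime_bSuc polytime_tl polytime_hd | simp)+

lemmas polytime_wt = polytime_op3[OF polytime_wt0]

lemma polytime_amax0: "polytime UNIV eal enc_nat amax"
proof (rule polytime_rec1_size[where b = "\<lambda>al. al = []" and g = "\<lambda>_. 0" and lf = tl
      and h = "\<lambda>al r. max (max (fst (hd al)) (snd (hd al))) r" and B = "\<lambda>s. s"])
  fix al :: times
  show "amax al = (if al = [] then 0 else max (max (fst (hd al)) (snd (hd al))) (amax (tl al)))"
    by (cases al) (auto simp: amax_def)
  show "size (enc_nat (amax al)) \<le> size (eal al)"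
  proof (induction al)
    case (Cons x al)
    have "amax (x # al) = max (max (fst x) (snd x)) (amax al)" by (simp add: amax_def)
    then have "amax (x # al) = fst x \<or> amax (x # al) = snd x \<or> amax (x # al) = amax al" by (auto simp: max_def)
    then show ?case using Cons by (auto simp: epair_eq)
  qed (simp add: amax_def)
  show "tl al \<in> UNIV \<and> size (eal (tl al)) < size (eal al)" if "al \<noteq> []" using that by (cases al) auto
qed (rule polytime_const polytime_id polytime_fst polytime_snd polytime_Pair polytime_null polytime_bmax polytime_tl polytime_hd pbound_intros | simp)+

lemmas polytime_amax = polytime_op1[OF polytime_amax0]

lemma polytime_lg: "polytime D e enat f \<Longrightarrow> polytime D e enat (\<lambda>u. lg (f u))"
  unfolding lg_def by (rule polytime_length polytime_hl polytime_diff polytime_const | assumption)+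

lemma polytime_lam: "polytime D e enat f \<Longrightarrow> polytime D e enat (\<lambda>u. lam (f u))"
proof (rule polytime_op1[where F = lam])
  show "polytime UNIV enat enat lam" unfolding lam_def
    by (rule polytime_rules polytime_hl polytime_lg)+
qed

lemma pow_lg: "2 ^ lg n \<le> 2 * (n + 1)"
proof (cases "2 \<le> n")
  case True
  then obtain k where "lg n = Suc k" using lg_bounds[OF True] by (cases "lg n") auto
  then show ?thesis using lg_bounds[OF True] by simp
next
  case False
  then have "n - 1 = 0" by simp
  then show ?thesis by (simp add: lg_def hl.simps)
qed

lemma lam_le: "lam n \<le> lg n"
proof -
  have "length (hl (lg n - 1)) - 1 \<le> lg n" using hl_length_le[of "lg n - 1"] by linarith
  then show ?thesis by (simp add: lam_def)
qed

text \<open>Since \<open>2 ^ lg n\<close> is linear in \<open>n\<close>, such exponents give values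
  of order \<open>n ^ 4\<close>.\<close>

lemma polytime_pow_lg:
  assumes "polytime D e enat f" "polytime D e enat g" "\<And>u. u \<in> D \<Longrightarrow> g u \<le> 4 * lg (f u) + 7"
  shows "polytime D e enat (\<lambda>u. 2 ^ g u)"
proof -
  have "polytime {z. snd z \<le> 4 * lg (fst z) + 7} (epair enat enat) enat (\<lambda>z. 2 ^ snd z)"
  proof (rule polytime_pow2[where B = "\<lambda>s. 128 * (2 * (s + 1)) ^ 4"])
    fix z :: "nat \<times> nat" assume "z \<in> {z. snd z \<le> 4 * lg (fst z) + 7}"
    then have "(2::nat) ^ snd z \<le> 2 ^ (4 * lg (fst z) + 7)" by (intro power_increasing) auto
    also have "\<dots> = 128 * (2 ^ lg (fst z)) ^ 4" by (simp add: power_add power_mult[symmetric] mult.commute)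
    also have "\<dots> \<le> 128 * (2 * (size (epair enat enat z) + 1)) ^ 4"
      by (intro mult_left_mono power_mono order_trans[OF pow_lg]) auto
    finally show "2 ^ snd z \<le> 128 * (2 * (size (epair enat enat z) + 1)) ^ 4" .
  qed (rule polytime_rules pbound_intros)+
  from polytime_op1_on[OF this polytime_Pair[OF assms(1,2)]] show ?thesis using assms(3) by simp
qed

lemma polytime_bs: "polytime D e enat f \<Longrightarrow> polytime D e enat (\<lambda>u. bs (f u))"
  unfolding bs_def
proof (intro polytime_pow_lg[of D e f] polytime_lam)
  show "lam (f u) \<le> 4 * lg (f u) + 7" for u using lam_le[of "f u"] by linarith
qed

lemma polytime_nb: "polytime D e enat f \<Longrightarrow> polytime D e enat (\<lambda>u. nb (f u))"
  unfolding nb_def by (rule polytime_div polytime_diff polytime_const polytime_bs | assumption)+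

lemma polytime_ew0: "polytime UNIV (epair eal enat) enat (\<lambda>z. ew (fst z) (snd z))"
  unfolding ew_def
  by (rule polytime_max polytime_wt polytime_amax polytime_fst[of _ _ enc_nat enc_nat] polytime_snd[of _ _ enc_nat enc_nat] polytime_geta polytime_hl
      polytime_pow_lg[of _ _ "\<lambda>z. length (fst z)"] polytime_mult polytime_const polytime_lg polytime_length polytime_fst polytime_snd polytime_id | simp)+

lemmas polytime_ew = polytime_op2[OF polytime_ew0]

lemma bw_alt: "bw al b = foldr max (map (\<lambda>j. ew al (b * bs (length al) + j)) [0..<bs (length al)]) 1"
  unfolding bw_def foldr_map by (simp add: fun_eq_iff o_def)

lemma polytime_bw0: "polytime UNIV (epair eal enat) enat (\<lambda>z. bw (fst z) (snd z))"
  unfolding bw_alt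
  by (rule polytime_foldr_max polytime_map polytime_ew polytime_add polytime_mult polytime_bs polytime_length polytime_upt polytime_fst polytime_snd polytime_id)+

lemmas polytime_bw = polytime_op2[OF polytime_bw0]

abbreviation eitem :: "item enc" where "eitem \<equiv> epair enat (epair enat enat)"

lemma polytime_parr: "polytime D e enat f \<Longrightarrow> polytime D e enat g \<Longrightarrow> polytime D e enat (\<lambda>u. parr (f u) (g u))"
  unfolding parr_def by (rule polytime_add polytime_mult polytime_const polytime_lam | assumption)+

lemma polytime_garr: "polytime D e enat f \<Longrightarrow> polytime D e enat g \<Longrightarrow> polytime D e enat (\<lambda>u. garr (f u) (g u))"
  unfolding garr_def by (rule polytime_add polytime_mult polytime_const polytime_lam | assumption)+

lemma polytime_blk0: "polytime UNIV (epair eal enat) eitem (\<lambda>z. blk (fst z) (snd z))"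
  unfolding blk_def
  by (rule polytime_Pair polytime_parr polytime_garr polytime_bw polytime_add polytime_mult polytime_diff polytime_const polytime_bs polytime_length polytime_fst polytime_snd polytime_id)+

lemmas polytime_blk = polytime_op2[OF polytime_blk0]

lemma polytime_xit0: "polytime UNIV (epair eal enat) (elist eitem) (\<lambda>z. xit (fst z) (snd z))"
  unfolding xit_def
  by (rule polytime_map polytime_blk polytime_diff polytime_const polytime_upt polytime_low polytime_fst polytime_snd polytime_id)+

lemmas polytime_xit = polytime_op2[OF polytime_xit0]

section \<open>Formulas as data and the recursion that builds them\<close>

fun efm :: "fm \<Rightarrow> data" where
  "efm (Lf v) = Pair Atom (enat v)"
| "efm (Op b A B) = Pair (Pair Atom (enc_bool b)) (Pair (efm A) (efm B))"

abbreviation eelt :: "(nat \<times> nat) enc" where "eelt \<equiv> epair enat enat"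
abbreviation eent :: "(fm \<times> nat) enc" where "eent \<equiv> epair efm enat"

fun isLf :: "fm \<Rightarrow> bool" where "isLf (Lf v) = True" | "isLf (Op b A B) = False"
fun leafv :: "fm \<Rightarrow> nat" where "leafv (Lf v) = v" | "leafv (Op b A B) = 0"
fun opof :: "fm \<Rightarrow> bool" where "opof (Op b A B) = b" | "opof (Lf v) = False"
fun lop :: "fm \<Rightarrow> fm" where "lop (Op b A B) = A" | "lop (Lf v) = Lf v"
fun rop :: "fm \<Rightarrow> fm" where "rop (Op b A B) = B" | "rop (Lf v) = Lf v"

lemma isLf_iff: "\<not> isLf F \<longleftrightarrow> (\<exists>b A B. F = Op b A B)" "isLf F \<longleftrightarrow> (\<exists>v. F = Lf v)"
  by (cases F; simp)+

lemma not_isLf: "\<not> isLf F \<Longrightarrow> enc_bool (opof F) = right (left (efm F)) \<and>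
    efm (lop F) = left (right (efm F)) \<and> efm (rop F) = right (right (efm F))"
  by (cases F) auto

lemma polytime_isLf: "polytime D e efm f \<Longrightarrow> polytime D e enc_bool (\<lambda>u. isLf (f u))"
proof (rule polytime_op1[where F = isLf and ?e1.0 = efm])
  have 1: "polytime UNIV efm (\<lambda>F. left (efm F)) (\<lambda>F. F)" by (rule polytime_raw_left) simp
  have 2: "polytime UNIV (\<lambda>F. left (efm F)) enc_bool isLf"
  proof (rule polytime_raw_isAtom)
    fix F show "isLf F \<longleftrightarrow> left (efm F) = Atom" by (cases F) auto
  qed
  show "polytime UNIV efm enc_bool isLf" using polytime_compose[OF 1 2] by simp
qed

lemma polytime_leafv: "polytime D e efm f \<Longrightarrow> (\<And>u. u \<in> D \<Longrightarrow> isLf (f u)) \<Longrightarrow> polytime D e enat (\<lambda>u. leafv (f u))"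
  by (rule polytime_op1_on[where D' = "{F. isLf F}" and F = leafv], rule polytime_raw_right) (auto simp: isLf_iff)

lemma polytime_opof: "polytime D e efm f \<Longrightarrow> (\<And>u. u \<in> D \<Longrightarrow> \<not> isLf (f u)) \<Longrightarrow> polytime D e enc_bool (\<lambda>u. opof (f u))"
proof (rule polytime_op1_on[where D' = "{F. \<not> isLf F}" and F = opof and ?e1.0 = efm])
  have 1: "polytime {F. \<not> isLf F} efm (\<lambda>F. left (efm F)) (\<lambda>F. F)" by (rule polytime_raw_left) simp
  have 2: "polytime {F. \<not> isLf F} (\<lambda>F. left (efm F)) enc_bool opof" by (rule polytime_raw_right) (auto simp: not_isLf)
  show "polytime {F. \<not> isLf F} efm enc_bool opof" using polytime_compose[OF 1 2] by simp
qed auto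

lemma polytime_lop: "polytime D e efm f \<Longrightarrow> (\<And>u. u \<in> D \<Longrightarrow> \<not> isLf (f u)) \<Longrightarrow> polytime D e efm (\<lambda>u. lop (f u))"
proof (rule polytime_op1_on[where D' = "{F. \<not> isLf F}" and F = lop and ?e1.0 = efm])
  have 1: "polytime {F. \<not> isLf F} efm (\<lambda>F. right (efm F)) (\<lambda>F. F)" by (rule polytime_raw_right) simp
  have 2: "polytime {F. \<not> isLf F} (\<lambda>F. right (efm F)) efm lop" by (rule polytime_raw_left) (auto simp: not_isLf)
  show "polytime {F. \<not> isLf F} efm efm lop" using polytime_compose[OF 1 2] by simp
qed auto

lemma polytime_rop: "polytime D e efm f \<Longrightarrow> (\<And>u. u \<in> D \<Longrightarrow> \<not> isLf (f u)) \<Longrightarrow> polytime D e efm (\<lambda>u. rop (f u))"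
proof (rule polytime_op1_on[where D' = "{F. \<not> isLf F}" and F = rop and ?e1.0 = efm])
  have 1: "polytime {F. \<not> isLf F} efm (\<lambda>F. right (efm F)) (\<lambda>F. F)" by (rule polytime_raw_right) simp
  have 2: "polytime {F. \<not> isLf F} (\<lambda>F. right (efm F)) efm rop" by (rule polytime_raw_right) (auto simp: not_isLf)
  show "polytime {F. \<not> isLf F} efm efm rop" using polytime_compose[OF 1 2] by simp
qed auto

lemma polytime_Lf: "polytime D e enat f \<Longrightarrow> polytime D e efm (\<lambda>u. Lf (f u))"
proof -
  assume f: "polytime D e enat f"
  have "polytime D e (epair (\<lambda>_. Atom) enat) (\<lambda>u. ((), f u))" by (intro polytime_Pair polytime_const f)
  then show ?thesis by (rule polytime_cong) auto
qed

lemma polytime_Op: "polytime D e enc_bool f \<Longrightarrow> polytime D e efm g \<Longrightarrow> polytime D e efm h \<Longrightarrow> polytime D e efm (\<lambda>u. Op (f u) (g u) (h u))"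
proof -
  assume f: "polytime D e enc_bool f" and g: "polytime D e efm g" and h: "polytime D e efm h"
  have "polytime D e (epair (epair (\<lambda>_. Atom) enc_bool) (epair efm efm)) (\<lambda>u. (((), f u), (g u, h u)))"
    by (intro polytime_Pair polytime_const f g h)
  then show ?thesis by (rule polytime_cong) auto
qed

lemmas polytime_fm_rules = polytime_isLf polytime_leafv polytime_opof polytime_lop polytime_rop polytime_Lf polytime_Op polytime_rules

lemma size_enc_bool: "size (enc_bool b) \<le> 1"
  by (cases b) auto

lemma size_Op: "size (efm (Op b A B)) \<le> size (efm A) + size (efm B) + 4"
  using size_enc_bool[of b] by simp

text \<open>A potential: beyond its code each entry holds 4 units, the size of the \<open>Op\<close>
  node by which it may be joined to another. Hence joining does not increase it.\<close>

definition ssz :: "(fm \<times> nat) list \<Rightarrow> nat" where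
  "ssz S = (\<Sum>x\<leftarrow>S. size (efm (fst x)) + snd x + 6)"

lemma ssz_simps [simp]: "ssz [] = 0" "ssz (x # S) = size (efm (fst x)) + snd x + 6 + ssz S"
  "ssz (S @ S') = ssz S + ssz S'"
  by (auto simp: ssz_def)

lemma ssz_size: "size (elist eent S) + 4 * length S = ssz S"
  by (induction S) auto

lemma ssz_ins: "ssz (ins b f w S) \<le> size (efm f) + w + 6 + ssz S"
proof (induction b f w S rule: ins.induct)
  case (2 b f w gv S)
  then show ?case using size_Op[of b f "fst gv"] by (cases "w = snd gv") (auto simp del: efm.simps)
qed simp

abbreviation eins :: "(bool \<times> fm \<times> nat \<times> (fm \<times> nat) list) enc" where
  "eins \<equiv> epair enc_bool (epair efm (epair enat (elist eent)))"

lemma poly_bound: "x \<le> 4 * (s + 2) \<Longrightarrow> x \<le> (s + 2) ^ 3" for x s :: nat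
proof -
  assume "x \<le> 4 * (s + 2)"
  also have "\<dots> \<le> (s + 2) ^ 2 * (s + 2)" by (intro mult_right_mono) (auto simp: power2_eq_square)
  also have "\<dots> = (s + 2) ^ 3" by (simp only: power3_eq_cube power2_eq_square)
  finally show ?thesis .
qed

lemma polytime_ins0: "polytime UNIV eins (elist eent) (\<lambda>z. ins (fst z) (fst (snd z)) (fst (snd (snd z))) (snd (snd (snd z))))"
proof (rule polytime_rec1[where D = UNIV and kk = 3
      and b = "\<lambda>z. snd (snd (snd z)) = [] \<or> fst (snd (snd z)) < snd (hd (snd (snd (snd z))))"
      and g = "\<lambda>z. (fst (snd z), fst (snd (snd z))) # snd (snd (snd z))"
      and lf = "\<lambda>z. if fst (snd (snd z)) = snd (hd (snd (snd (snd z))))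
        then (fst z, Op (fst z) (fst (snd z)) (fst (hd (snd (snd (snd z))))), fst (snd (snd z)) + fst (snd (snd z)), tl (snd (snd (snd z))))
        else (fst z, fst (snd z), fst (snd (snd z)), tl (snd (snd (snd z))))"
      and h = "\<lambda>z r. if fst (snd (snd z)) = snd (hd (snd (snd (snd z)))) then r else hd (snd (snd (snd z))) # r"
      and cnt = "\<lambda>z. length (snd (snd (snd z)))"
      and bd = "\<lambda>z. size (efm (fst (snd z))) + fst (snd (snd z)) + ssz (snd (snd (snd z))) + 20"])
  fix z :: "bool \<times> fm \<times> nat \<times> (fm \<times> nat) list"
  obtain b f w S where z: "z = (b, f, w, S)" by (cases z)
  let ?bd = "\<lambda>z. size (efm (fst (snd z))) + fst (snd (snd z)) + ssz (snd (snd (snd z))) + 20"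
  let ?l = "\<lambda>z :: bool \<times> fm \<times> nat \<times> (fm \<times> nat) list. if fst (snd (snd z)) = snd (hd (snd (snd (snd z))))
        then (fst z, Op (fst z) (fst (snd z)) (fst (hd (snd (snd (snd z))))), fst (snd (snd z)) + fst (snd (snd z)), tl (snd (snd (snd z))))
        else (fst z, fst (snd z), fst (snd (snd z)), tl (snd (snd (snd z))))"
  let ?ins = "\<lambda>z. ins (fst z) (fst (snd z)) (fst (snd (snd z))) (snd (snd (snd z)))"
  show "?ins z = (if snd (snd (snd z)) = [] \<or> fst (snd (snd z)) < snd (hd (snd (snd (snd z)))) then (fst (snd z), fst (snd (snd z))) # snd (snd (snd z))
     else if fst (snd (snd z)) = snd (hd (snd (snd (snd z)))) then ?ins (?l z) else hd (snd (snd (snd z))) # ?ins (?l z))"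
    by (cases S) (auto simp: z)
  show "?l z \<in> UNIV \<and> ?bd (?l z) \<le> ?bd z \<and> length (snd (snd (snd (?l z)))) < length (snd (snd (snd z)))"
    if "\<not> (snd (snd (snd z)) = [] \<or> fst (snd (snd z)) < snd (hd (snd (snd (snd z)))))"
    using that size_Op[of b f "fst (hd S)"] by (cases S) (auto simp: z simp del: efm.simps)
  have "size (elist eent (ins b f w S)) \<le> ssz (ins b f w S)" using ssz_size[of "ins b f w S"] by linarith
  also have "\<dots> \<le> size (efm f) + w + 6 + ssz S" by (rule ssz_ins)
  finally have 1: "size (elist eent (ins b f w S)) \<le> ?bd z" by (simp add: z)
  have 2: "size (elist eent S) + 4 * length S = ssz S" by (rule ssz_size)
  show "size (eins z) \<le> ?bd z \<and> size (elist eent (?ins z)) \<le> ?bd z \<and> length (snd (snd (snd z))) < ?bd z"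
    using 1 2 size_enc_bool[of b] by (auto simp: z)
next
  fix z :: "bool \<times> fm \<times> nat \<times> (fm \<times> nat) list"
  obtain b f w S where z: "z = (b, f, w, S)" by (cases z)
  have "ssz S \<le> 3 * size (elist eent S)" by (induction S) auto
  then show "size (efm (fst (snd z))) + fst (snd (snd z)) + ssz (snd (snd (snd z))) + 20 \<le> (size (eins z) + 2) ^ 3"
    by (intro poly_bound) (simp add: z)
qed (rule polytime_fm_rules | simp)+

lemmas polytime_ins = polytime_op1[OF polytime_ins0, OF polytime_Pair[OF _ polytime_Pair[OF _ polytime_Pair]], simplified]

lemma ssz_insall: "ssz (insall b t) \<le> (\<Sum>x\<leftarrow>t. fst x + snd x + 7)"
proof (induction t)
  case (Cons x t)
  then show ?case using ssz_ins[of b "Lf (fst x)" "snd x" "insall b t"] by simp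
qed simp

lemma polytime_insall0: "polytime UNIV (epair enc_bool (elist eelt)) (elist eent) (\<lambda>z. insall (fst z) (snd z))"
proof (rule polytime_rec1_size[where b = "\<lambda>z. snd z = []" and g = "\<lambda>_. []" and lf = "\<lambda>z. (fst z, tl (snd z))"
      and h = "\<lambda>z r. ins (fst z) (Lf (fst (hd (snd z)))) (snd (hd (snd z))) r" and B = "\<lambda>s. 4 * s"])
  fix z :: "bool \<times> (nat \<times> nat) list"
  show "insall (fst z) (snd z) = (if snd z = [] then [] else ins (fst z) (Lf (fst (hd (snd z)))) (snd (hd (snd z)))
     (insall (fst (fst z, tl (snd z))) (snd (fst z, tl (snd z)))))" by (cases "snd z") auto
  have "(\<Sum>x\<leftarrow>t. fst x + snd x + 7) \<le> 4 * size (elist eelt t)" for t by (induction t) auto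
  from le_trans[OF ssz_insall this] have "ssz (insall (fst z) (snd z)) \<le> 4 * size (elist eelt (snd z))" .
  then show "size (elist eent (insall (fst z) (snd z))) \<le> 4 * size (epair enc_bool (elist eelt) z)"
    using ssz_size[of "insall (fst z) (snd z)"] by simp
  show "(fst z, tl (snd z)) \<in> UNIV \<and> size (epair enc_bool (elist eelt) (fst z, tl (snd z))) < size (epair enc_bool (elist eelt) z)"
    if "\<not> snd z = []" using that by (cases "snd z") auto
qed (rule polytime_ins polytime_fm_rules pbound_intros | simp)+

lemmas polytime_insall = polytime_op2[OF polytime_insall0]

lemma size_chn: "size (efm (chn b f S)) \<le> size (efm f) + ssz S"
proof (induction b f S rule: chn.induct)
  case (2 b f g S)
  then show ?case using size_Op[of b f "fst g"] by (simp del: efm.simps)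
qed simp

lemma polytime_chn0: "polytime UNIV (epair enc_bool (epair efm (elist eent))) efm (\<lambda>z. chn (fst z) (fst (snd z)) (snd (snd z)))"
proof (rule polytime_rec1[where D = UNIV and kk = 3 and b = "\<lambda>z. snd (snd z) = []" and g = "\<lambda>z. fst (snd z)"
      and lf = "\<lambda>z. (fst z, Op (fst z) (fst (snd z)) (fst (hd (snd (snd z)))), tl (snd (snd z)))"
      and h = "\<lambda>z r. r" and cnt = "\<lambda>z. length (snd (snd z))"
      and bd = "\<lambda>z. size (efm (fst (snd z))) + ssz (snd (snd z)) + 15"])
  fix z :: "bool \<times> fm \<times> (fm \<times> nat) list"
  obtain b f S where z: "z = (b, f, S)" by (cases z)
  let ?l = "(fst z, Op (fst z) (fst (snd z)) (fst (hd (snd (snd z)))), tl (snd (snd z)))"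
  show "chn (fst z) (fst (snd z)) (snd (snd z)) = (if snd (snd z) = [] then fst (snd z) else chn (fst ?l) (fst (snd ?l)) (snd (snd ?l)))"
    by (cases S) (auto simp: z)
  show "?l \<in> UNIV \<and> size (efm (fst (snd ?l))) + ssz (snd (snd ?l)) + 15 \<le> size (efm (fst (snd z))) + ssz (snd (snd z)) + 15 \<and>
     length (snd (snd ?l)) < length (snd (snd z))" if "\<not> snd (snd z) = []"
    using that size_Op[of b f "fst (hd S)"] by (cases S) (auto simp: z simp del: efm.simps)
  show "size (epair enc_bool (epair efm (elist eent)) z) \<le> size (efm (fst (snd z))) + ssz (snd (snd z)) + 15 \<and>
     size (efm (chn (fst z) (fst (snd z)) (snd (snd z)))) \<le> size (efm (fst (snd z))) + ssz (snd (snd z)) + 15 \<and>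
     length (snd (snd z)) < size (efm (fst (snd z))) + ssz (snd (snd z)) + 15"
    using size_chn[of b f S] ssz_size[of S] size_enc_bool[of b] by (simp add: z)
next
  fix z :: "bool \<times> fm \<times> (fm \<times> nat) list"
  have "ssz S \<le> 3 * size (elist eent S)" for S by (induction S) auto
  from this[of "snd (snd z)"] show "size (efm (fst (snd z))) + ssz (snd (snd z)) + 15 \<le> (size (epair enc_bool (epair efm (elist eent)) z) + 2) ^ 3"
    using size_enc_bool by (intro poly_bound) (cases z, simp)
qed (rule polytime_fm_rules | simp)+

lemmas polytime_chn = polytime_op3[OF polytime_chn0]

lemma polytime_wsum: "polytime D e (elist (epair e1 enat)) f \<Longrightarrow> polytime D e enat (\<lambda>u. wsum (f u))"
proof (rule polytime_op1[where F = wsum])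
  show "polytime UNIV (elist (epair e1 enat)) enat wsum" unfolding wsum_def by (rule polytime_rules)+
qed

lemma polytime_evens0: "polytime UNIV (elist e) (elist e) evens"
proof (rule polytime_rec1_size[where b = "\<lambda>t. tl t = []" and g = "\<lambda>t. t" and lf = "\<lambda>t. tl (tl t)"
      and h = "\<lambda>t r. hd t # r" and B = "\<lambda>s. s"])
  fix t :: "'a list"
  show "evens t = (if tl t = [] then t else hd t # evens (tl (tl t)))" by (cases t rule: evens.cases) auto
  show "size (elist e (evens t)) \<le> size (elist e t)" by (induction t rule: evens.induct) auto
  show "tl (tl t) \<in> UNIV \<and> size (elist e (tl (tl t))) < size (elist e t)" if "\<not> tl t = []"
    using that by (cases t rule: evens.cases) auto
qed (rule polytime_rules pbound_intros | force)+

lemmas polytime_evens = polytime_op1[OF polytime_evens0]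

abbreviation ecut :: "(nat \<times> nat \<times> nat \<times> (nat \<times> nat) list) enc" where
  "ecut \<equiv> epair enat (epair enat (epair enat (elist eelt)))"

lemma len3: "\<not> length t < 3 \<Longrightarrow> t \<noteq> [] \<and> tl t \<noteq> []"
  by (cases t; cases "tl t") auto

lemma polytime_cut0: "polytime UNIV ecut (epair (elist eelt) (elist eelt))
   (\<lambda>z. cut (fst z) (fst (snd z)) (fst (snd (snd z))) (snd (snd (snd z))))"
proof (rule polytime_rec1[where D = UNIV and kk = 3
      and b = "\<lambda>z. length (snd (snd (snd z))) < 3 \<or> \<not> fst (snd (snd z)) + fst z * snd (hd (snd (snd (snd z)))) + 2 * snd (hd (tl (snd (snd (snd z))))) \<le> fst (snd z)"
      and g = "\<lambda>z. ([], snd (snd (snd z)))"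
      and lf = "\<lambda>z. (fst z, fst (snd z), fst (snd (snd z)) + fst z * (snd (hd (snd (snd (snd z)))) + snd (hd (tl (snd (snd (snd z)))))), tl (tl (snd (snd (snd z)))))"
      and h = "\<lambda>z r. (hd (snd (snd (snd z))) # hd (tl (snd (snd (snd z)))) # fst r, snd r)"
      and cnt = "\<lambda>z. length (snd (snd (snd z)))"
      and bd = "\<lambda>z. fst z + fst (snd z) + fst (snd (snd z)) + fst z * wsum (snd (snd (snd z))) + size (elist eelt (snd (snd (snd z)))) + 10"])
  fix z :: "nat \<times> nat \<times> nat \<times> (nat \<times> nat) list"
  obtain c p m t where z: "z = (c, p, m, t)" by (cases z)
  let ?b = "\<lambda>z :: nat \<times> nat \<times> nat \<times> (nat \<times> nat) list. length (snd (snd (snd z))) < 3 \<or> \<not> fst (snd (snd z)) + fst z * snd (hd (snd (snd (snd z)))) + 2 * snd (hd (tl (snd (snd (snd z))))) \<le> fst (snd z)"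
  let ?l = "\<lambda>z :: nat \<times> nat \<times> nat \<times> (nat \<times> nat) list. (fst z, fst (snd z), fst (snd (snd z)) + fst z * (snd (hd (snd (snd (snd z)))) + snd (hd (tl (snd (snd (snd z)))))), tl (tl (snd (snd (snd z)))))"
  let ?bd = "\<lambda>z. fst z + fst (snd z) + fst (snd (snd z)) + fst z * wsum (snd (snd (snd z))) + size (elist eelt (snd (snd (snd z)))) + 10"
  let ?cut = "\<lambda>z. cut (fst z) (fst (snd z)) (fst (snd (snd z))) (snd (snd (snd z)))"
  show "?cut z = (if ?b z then ([], snd (snd (snd z)))
     else (hd (snd (snd (snd z))) # hd (tl (snd (snd (snd z)))) # fst (?cut (?l z)), snd (?cut (?l z))))"
    by (cases "(c, p, m, t)" rule: cut.cases) (auto simp: z Let_def)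
  show "?l z \<in> UNIV \<and> ?bd (?l z) \<le> ?bd z \<and> length (snd (snd (snd (?l z)))) < length (snd (snd (snd z)))" if "\<not> ?b z"
    using that by (cases "(c, p, m, t)" rule: cut.cases) (auto simp: z algebra_simps)
  have "size (elist eelt (fst (cut c p m t))) + size (elist eelt (snd (cut c p m t))) \<le> size (elist eelt t)"
    by (induction c p m t rule: cut.induct) (auto simp: Let_def)
  then show "size (ecut z) \<le> ?bd z \<and> size (epair (elist eelt) (elist eelt) (?cut z)) \<le> ?bd z \<and> length (snd (snd (snd z))) < ?bd z"
    using elist_length[of t eelt] by (auto simp: z)
next
  fix z :: "nat \<times> nat \<times> nat \<times> (nat \<times> nat) list"
  obtain c p m t where z: "z = (c, p, m, t)" by (cases z)
  have w: "wsum t \<le> size (elist eelt t)" by (induction t) auto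
  define s where "s = size (ecut z) + 2"
  have "c \<le> s" "wsum t \<le> s" "5 \<le> s" using w by (auto simp: s_def z)
  then have "c * wsum t \<le> s * s" "3 * s \<le> s * s" by (auto intro: mult_mono)
  moreover have "c + p + m + size (elist eelt t) + 10 \<le> 3 * s" using \<open>5 \<le> s\<close> by (simp add: s_def z)
  ultimately have "c + p + m + c * wsum t + size (elist eelt t) + 10 \<le> 2 * (s * s)" by linarith
  also have "\<dots> \<le> s * (s * s)" using \<open>5 \<le> s\<close> by (intro mult_right_mono) auto
  finally show "fst z + fst (snd z) + fst (snd (snd z)) + fst z * wsum (snd (snd (snd z))) + size (elist eelt (snd (snd (snd z)))) + 10
     \<le> (size (ecut z) + 2) ^ 3"
    unfolding s_def[symmetric] by (simp only: z fst_conv snd_conv power3_eq_cube mult.assoc)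
qed (rule polytime_rules | force dest: len3)+

lemmas polytime_cut = polytime_op1[OF polytime_cut0, OF polytime_Pair[OF _ polytime_Pair[OF _ polytime_Pair]], simplified]

abbreviation est :: "pstate enc" where
  "est \<equiv> epair enc_bool (epair (elist enat) (epair (elist eent) (elist eelt)))"

lemma peel_alt: "peel z \<longleftrightarrow> fst (snd (snd z)) \<noteq> [] \<and> butlast (fst (snd (snd z))) \<noteq> [] \<and>
    snd (last (fst (snd (snd z)))) = hd (fst (snd z))"
  by (cases z) (auto simp: peel_def)

lemma pcut_alt: "pcut z = cut (2 * length (fst (snd z))) (hd (fst (snd z))) (wsum (fst (snd (snd z)))) (snd (snd (snd z)))"
  by (cases z) (auto simp: pcut_def)

lemma lsub_alt: "lsub z = (if peel z then (fst z, [], [last (fst (snd (snd z)))], [])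
    else (fst z, tl (fst (snd z)), fst (snd (snd z)), fst (pcut z)))"
  by (cases z) (auto simp: lsub_def)

lemma rsub_alt: "rsub z = (if peel z then (fst z, tl (fst (snd z)), butlast (fst (snd (snd z))), snd (snd (snd z)))
    else (\<not> fst z, tl (fst (snd z)), insall (\<not> fst z) (evens (fst (pcut z)) @ [hd (snd (pcut z))]), tl (snd (pcut z))))"
  by (cases z) (auto simp: rsub_def)

lemma pbase_alt: "pbase z \<longleftrightarrow> fst (snd z) = [] \<or> snd (snd (snd z)) = [] \<or> tl (snd (snd (snd z))) = []"
  by (cases z) (auto simp: pbase_def)

lemma pend_alt: "pend z = (if snd (snd (snd z)) = []
    then chn (fst z) (fst (hd (fst (snd (snd z))))) (tl (fst (snd (snd z))))
    else chn (fst z)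
      (fst (hd (ins (fst z) (Lf (fst (hd (snd (snd (snd z)))))) (snd (hd (snd (snd (snd z))))) (fst (snd (snd z))))))
      (tl (ins (fst z) (Lf (fst (hd (snd (snd (snd z)))))) (snd (hd (snd (snd (snd z))))) (fst (snd (snd z))))))"
  by (cases z) (auto simp: pend_def Let_def)

lemma pcut_ok:
  assumes "\<not> pbase z"
  shows "snd (snd (snd z)) = fst (pcut z) @ hd (snd (pcut z)) # tl (snd (pcut z))" "snd (pcut z) \<noteq> []"
proof -
  have "cut (2 * length (fst (snd z))) (hd (fst (snd z))) (wsum (fst (snd (snd z)))) (snd (snd (snd z))) = (fst (pcut z), snd (pcut z))"
    by (simp add: pcut_alt)
  note c = cut_correct[OF this]
  show "snd (pcut z) \<noteq> []" using c(3) assms by (auto simp: pbase_alt)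
  then show "snd (snd (snd z)) = fst (pcut z) @ hd (snd (pcut z)) # tl (snd (pcut z))" using c(1) by simp
qed

lemmas polytime_build_rules = polytime_cut polytime_ins polytime_insall polytime_chn polytime_wsum polytime_evens polytime_fm_rules

lemma polytime_pcut: "D \<subseteq> {z. fst (snd z) \<noteq> []} \<Longrightarrow> polytime D est (epair (elist eelt) (elist eelt)) pcut"
  unfolding pcut_alt[abs_def] by (rule polytime_build_rules | force)+

lemma polytime_peel: "D \<subseteq> {z. fst (snd z) \<noteq> []} \<Longrightarrow> polytime D est enc_bool peel"
  unfolding peel_alt[abs_def] by (rule polytime_build_rules | force)+

lemma polytime_pbase: "polytime D est enc_bool pbase"
  unfolding pbase_alt[abs_def] by (rule polytime_build_rules | force)+

lemma polytime_pend: "D \<subseteq> {z. fst (snd (snd z)) \<noteq> []} \<Longrightarrow> polytime D est efm pend"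
  unfolding pend_alt[abs_def] by (rule polytime_build_rules | force)+

lemma polytime_lsub: "D \<subseteq> {z. \<not> pbase z} \<Longrightarrow> polytime D est est lsub"
  unfolding lsub_alt[abs_def] by (rule polytime_peel polytime_pcut polytime_build_rules | force simp: pbase_alt peel_alt)+

lemma polytime_rsub: "D \<subseteq> {z. \<not> pbase z} \<Longrightarrow> polytime D est est rsub"
  unfolding rsub_alt[abs_def] by (rule polytime_peel polytime_pcut polytime_build_rules | (use pcut_ok(2) in \<open>force simp: pbase_alt\<close>))+

text \<open>A potential for literals: of the 12 units, 7 are for becoming a leaf of a counter
  (\<open>ssz_insall\<close>) and 5 are left to pay for the gate of a recursion step.\<close>

definition tsz :: "(nat \<times> nat) list \<Rightarrow> nat" where
  "tsz t = (\<Sum>x\<leftarrow>t. fst x + snd x + 12)"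

lemma tsz_simps [simp]: "tsz [] = 0" "tsz (x # t) = fst x + snd x + 12 + tsz t" "tsz (t @ t') = tsz t + tsz t'"
  by (auto simp: tsz_def)

lemma tsz_evens: "tsz (evens t) \<le> tsz t"
  by (induction t rule: evens.induct) auto

lemma tsz_length: "12 * length t \<le> tsz t"
  by (induction t) auto

lemma ssz_insall': "ssz (insall b t) + 5 * length t \<le> tsz t"
proof -
  have "(\<Sum>x\<leftarrow>t. fst x + snd x + 7) + 5 * length t = tsz t" by (induction t) auto
  then show ?thesis using ssz_insall[of b t] by linarith
qed

text \<open>Each level may copy a literal once more, so literals are weighted by the number of
  levels still possible; \<open>calls\<close> counts in the same way.\<close>

fun rmeas :: "pstate \<Rightarrow> nat" where
  "rmeas (b, ps, S, t) = ssz S + tsz t * (length ps + 1)"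

fun calls :: "pstate \<Rightarrow> nat" where
  "calls (b, ps, S, t) = length S + length t * (length ps + 1)"

lemma length_ins: "length (ins b f w S) \<le> length S + 1"
  by (induction b f w S rule: ins.induct) auto

lemma length_insall: "length (insall b t) \<le> length t"
  by (induction t) (auto intro: order_trans[OF length_ins])

text \<open>The level given up releases \<open>tsz u\<close>, and with what the splitting literal
  holds this pays for the new counter. The 4 units to spare are the size of the \<open>Op\<close>
  node of the step.\<close>

lemma sub_measures:
  assumes S: "fst (snd (snd z)) \<noteq> []" and nb: "\<not> pbase z"
  shows "fst (snd (snd (lsub z))) \<noteq> []" "fst (snd (snd (rsub z))) \<noteq> []"
    "rmeas (lsub z) + rmeas (rsub z) + 4 \<le> rmeas z" "calls (lsub z) + calls (rsub z) < calls z"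
    "size (elist enat (fst (snd (lsub z)))) \<le> size (elist enat (fst (snd z)))"
    "size (elist enat (fst (snd (rsub z)))) \<le> size (elist enat (fst (snd z)))"
proof -
  obtain b ps S' t where z: "z = (b, ps, S', t)" by (cases z)
  obtain p ps' where ps: "ps = p # ps'" using nb by (cases ps) (auto simp: z pbase_alt)
  have t0: "t \<noteq> []" using nb by (auto simp: z pbase_alt)
  have tt: "tsz t \<ge> 12" using tsz_length[of t] t0 by (cases t) auto
  show "fst (snd (snd (lsub z))) \<noteq> []" using S by (auto simp: lsub_alt)
  show "fst (snd (snd (rsub z))) \<noteq> []" by (auto simp: rsub_alt peel_alt)
  show "size (elist enat (fst (snd (lsub z)))) \<le> size (elist enat (fst (snd z)))"
    "size (elist enat (fst (snd (rsub z)))) \<le> size (elist enat (fst (snd z)))"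
    by (auto simp: z ps lsub_alt rsub_alt)
  have "rmeas (lsub z) + rmeas (rsub z) + 4 \<le> rmeas z \<and> calls (lsub z) + calls (rsub z) < calls z"
  proof (cases "peel z")
    case True
    have "S' = butlast S' @ [last S']" using S by (simp add: z)
    then have "ssz S' = ssz (butlast S') + ssz [last S']" "length S' = length (butlast S') + 1"
      by (metis ssz_simps(3), metis length_append_singleton Suc_eq_plus1)
    then show ?thesis using True tt t0 by (simp add: z ps lsub_alt rsub_alt)
  next
    case False
    define u where "u = fst (pcut z)"
    define y r where "y = hd (snd (pcut z))" and "r = tl (snd (pcut z))"
    have t: "t = u @ y # r" using pcut_ok(1)[OF nb] by (simp add: z u_def y_def r_def)
    have l: "lsub z = (b, ps', S', u)" "rsub z = (\<not> b, ps', insall (\<not> b) (evens u @ [y]), r)"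
      using False by (simp_all add: z ps lsub_alt rsub_alt u_def y_def r_def)
    have 1: "ssz (insall (\<not> b) (evens u @ [y])) + 5 \<le> tsz u + tsz [y]"
      using ssz_insall'[of "\<not> b" "evens u @ [y]"] tsz_evens[of u] by simp
    have "length (evens u) \<le> length u" by (induction u rule: evens.induct) auto
    then have 2: "length (insall (\<not> b) (evens u @ [y])) \<le> length u + 1"
      using length_insall[of "\<not> b" "evens u @ [y]"] by simp
    have "rmeas z = ssz S' + tsz u * (length ps' + 1) + tsz u + tsz [y] * (length ps' + 2) + tsz r * (length ps' + 1) + tsz r"
      unfolding z ps t by (simp add: algebra_simps)
    moreover have "tsz [y] \<le> tsz [y] * (length ps' + 2)" by simp
    ultimately have "rmeas (lsub z) + rmeas (rsub z) + 4 \<le> rmeas z" using 1 unfolding l by simp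
    moreover have "calls z = length S' + length u * (length ps' + 1) + length u + (length ps' + 2) + length r * (length ps' + 1) + length r"
      unfolding z ps t by (simp add: algebra_simps)
    then have "calls (lsub z) + calls (rsub z) < calls z" using 2 unfolding l by simp
    ultimately show ?thesis by simp
  qed
  then show "rmeas (lsub z) + rmeas (rsub z) + 4 \<le> rmeas z" "calls (lsub z) + calls (rsub z) < calls z" by auto
qed

lemma pend_size: "fst (snd (snd z)) \<noteq> [] \<Longrightarrow> size (efm (pend z)) \<le> rmeas z"
proof -
  assume S: "fst (snd (snd z)) \<noteq> []"
  obtain b ps S t where z: "z = (b, ps, S, t)" by (cases z)
  define S' where "S' = (if t = [] then S else ins b (Lf (fst (hd t))) (snd (hd t)) S)"
  have p: "pend z = chn b (fst (hd S')) (tl S')" by (simp add: z pend_def S'_def Let_def)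
  have "S' \<noteq> []" using S by (auto simp: z S'_def)
  then obtain x R where x: "S' = x # R" by (cases S') auto
  have "size (efm (pend z)) \<le> ssz S'" using size_chn[of b "fst x" R] unfolding p x by simp
  also have "ssz S' \<le> ssz S + tsz t"
    using ssz_ins[of b "Lf (fst (hd t))" "snd (hd t)" S] by (cases t) (auto simp: S'_def)
  also have "\<dots> \<le> rmeas z" by (simp add: z)
  finally show ?thesis .
qed

lemma build_size: "fst (snd (snd z)) \<noteq> [] \<Longrightarrow> size (efm (build z)) \<le> rmeas z"
proof (induction "length (fst (snd z))" arbitrary: z rule: less_induct)
  case less
  show ?case
  proof (cases "pbase z")
    case True then show ?thesis using pend_size less.prems by (simp add: build.simps[of z])
  next
    case False
    note m = sub_measures[OF less.prems False]
    have "length (fst (snd (lsub z))) < length (fst (snd z))" "length (fst (snd (rsub z))) < length (fst (snd z))"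
      using False by (cases "fst (snd z)"; auto simp: lsub_alt rsub_alt pbase_alt)+
    then have "size (efm (build (lsub z))) \<le> rmeas (lsub z)" "size (efm (build (rsub z))) \<le> rmeas (rsub z)"
      using less.hyps m(1,2) by auto
    moreover have "build z = Op (fst z) (build (lsub z)) (build (rsub z))" using False by (simp add: build.simps[of z])
    ultimately show ?thesis using m(3) size_Op[of "fst z" "build (lsub z)" "build (rsub z)"] by (simp del: efm.simps)
  qed
qed

text \<open>The recursion branches, so its depth says little: \<open>calls\<close> bounds the call
  tree and \<open>rmeas\<close> the formula, both linear in the literals times the number of
  budgets.\<close>

lemma polytime_build0: "polytime {z. fst (snd (snd z)) \<noteq> []} est efm build"
proof (rule polytime_rec2[where D = "{z. fst (snd (snd z)) \<noteq> []}" and kk = 3 and b = pbase and g = pend and lf = lsub and rt = rsub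
      and h = "\<lambda>z. Op (fst z)" and cnt = calls and bd = "\<lambda>z. rmeas z + size (elist enat (fst (snd z))) + 10"])
  fix z :: pstate assume z: "z \<in> {z. fst (snd (snd z)) \<noteq> []}"
  obtain b ps S t where zz: "z = (b, ps, S, t)" by (cases z)
  show "build z = (if pbase z then pend z else Op (fst z) (build (lsub z)) (build (rsub z)))" by (rule build.simps)
  show "lsub z \<in> {z. fst (snd (snd z)) \<noteq> []} \<and> rmeas (lsub z) + size (elist enat (fst (snd (lsub z)))) + 10 \<le> rmeas z + size (elist enat (fst (snd z))) + 10 \<and>
    rsub z \<in> {z. fst (snd (snd z)) \<noteq> []} \<and> rmeas (rsub z) + size (elist enat (fst (snd (rsub z)))) + 10 \<le> rmeas z + size (elist enat (fst (snd z))) + 10 \<and>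
    calls (lsub z) + calls (rsub z) < calls z" if "\<not> pbase z"
    using sub_measures[OF _ that] z by auto
  have "size (elist eelt t) \<le> tsz t" by (induction t) auto
  moreover have "tsz t \<le> tsz t * (length ps + 1)" by simp
  moreover have "length t * (length ps + 1) \<le> tsz t * (length ps + 1)" using tsz_length[of t] by (intro mult_right_mono) auto
  moreover have "size (elist eent S) + 4 * length S = ssz S" by (rule ssz_size)
  ultimately show "size (est z) \<le> rmeas z + size (elist enat (fst (snd z))) + 10 \<and>
      size (efm (build z)) \<le> rmeas z + size (elist enat (fst (snd z))) + 10 \<and> 0 < calls z \<and>
      calls z \<le> rmeas z + size (elist enat (fst (snd z))) + 10"
    using build_size[of z] z size_enc_bool[of b] by (auto simp: zz)
next
  fix z :: pstate
  obtain b ps S t where zz: "z = (b, ps, S, t)" by (cases z)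
  define s where "s = size (est z) + 2"
  have 1: "ssz S \<le> 3 * size (elist eent S)" by (induction S) auto
  have 2: "tsz t \<le> 6 * size (elist eelt t)" by (induction t) auto
  have 3: "length ps \<le> size (elist enat ps)" by (rule elist_length)
  define a where "a = size (elist eelt t)"
  have s: "s = size (enc_bool b) + size (elist enat ps) + size (elist eent S) + a + 5" by (simp add: s_def zz a_def)
  have "tsz t * (length ps + 1) \<le> (6 * a) * (length ps + 1)" using 2 by (intro mult_right_mono) (auto simp: a_def)
  also have "\<dots> \<le> 3 * (s * s)"
  proof -
    have "2 * (a * (length ps + 1)) \<le> (a + (length ps + 1)) * (a + (length ps + 1))" by (simp add: algebra_simps)
    also have "\<dots> \<le> s * s" using 3 s by (intro mult_mono) auto
    finally show ?thesis by simp
  qed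
  moreover have "ssz S + size (elist enat ps) + 10 \<le> 3 * s" using 1 s by simp
  moreover have "5 \<le> s" by (simp add: s)
  then have "3 * s \<le> s * s" by (intro mult_right_mono) auto
  ultimately have "ssz S + tsz t * (length ps + 1) + size (elist enat ps) + 10 \<le> 4 * (s * s)" by linarith
  also have "\<dots> \<le> s * (s * s)" using \<open>5 \<le> s\<close> by (intro mult_right_mono) auto
  finally show "rmeas z + size (elist enat (fst (snd z))) + 10 \<le> (size (est z) + 2) ^ 3"
    unfolding s_def[symmetric] by (simp only: zz rmeas.simps fst_conv snd_conv power3_eq_cube mult.assoc)
qed (rule polytime_pbase polytime_pend polytime_lsub polytime_rsub polytime_build_rules | force)+

section \<open>Scaling and the formulas of the stages\<close>

lemma polytime_altl0: "polytime UNIV (elist eitem) (elist eelt) altl"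
proof (rule polytime_rec1_size[where b = "\<lambda>t. t = []" and g = "\<lambda>t. []" and lf = tl
      and h = "\<lambda>t r. (fst (hd t), snd (snd (hd t))) # (if tl t = [] then [] else (fst (snd (hd t)), snd (snd (hd t))) # r)"
      and B = "\<lambda>s. 2 * s"])
  fix t :: "item list"
  show "altl t = (if t = [] then [] else (fst (hd t), snd (snd (hd t))) #
      (if tl t = [] then [] else (fst (snd (hd t)), snd (snd (hd t))) # altl (tl t)))" by (cases t) auto
  show "size (elist eelt (altl t)) \<le> 2 * size (elist eitem t)" by (induction t) auto
  show "tl t \<in> UNIV \<and> size (elist eitem (tl t)) < size (elist eitem t)" if "t \<noteq> []" using that by (cases t) auto
qed (rule polytime_rules pbound_intros | force)+

lemmas polytime_altl = polytime_op1[OF polytime_altl0]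

lemma polytime_halve: "polytime D e (elist eitem) f \<Longrightarrow> polytime D e (elist eitem) (\<lambda>u. halve (f u))"
proof (rule polytime_op1[where F = halve])
  show "polytime UNIV (elist eitem) (elist eitem) halve" unfolding halve_def by (rule polytime_rules)+
qed

lemma polytime_fits: "polytime D e enat f \<Longrightarrow> polytime D e (elist eitem) g \<Longrightarrow> polytime D e enc_bool (\<lambda>u. fits (f u) (g u))"
proof (rule polytime_op2[where F = fits])
  show "polytime UNIV (epair enat (elist eitem)) enc_bool (\<lambda>z. fits (fst z) (snd z))"
    unfolding fits_def itemsum_def by (rule polytime_hl polytime_rules)+
qed

lemma size_halve: "size (elist eitem (halve ls)) \<le> size (elist eitem ls)"
proof -
  have "(w + 1) div 2 \<le> w" for w :: nat by linarith
  then show ?thesis by (induction ls) (auto simp: halve_def add_mono)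
qed

lemma size_scal: "size (elist eitem (snd (scal M q f ls))) \<le> size (elist eitem ls)"
  by (induction M q f ls rule: scal.induct) (auto intro: order_trans[OF _ size_halve])

lemma length_scal: "length (snd (scal M q f ls)) = length ls"
  by (induction M q f ls rule: scal.induct) (auto simp: halve_comb)

abbreviation esc :: "(nat \<times> nat \<times> nat \<times> nat \<times> item list) enc" where
  "esc \<equiv> epair enat (epair enat (epair enat (epair enat (elist eitem))))"

text \<open>The first component is padding: it makes room for the weights within a polynomial bound.\<close>

lemma polytime_scal0: "polytime {z. fst (snd (snd z)) * 2 ^ fst (snd (snd (snd z))) \<le> 128 * (2 * (fst z + 1)) ^ 4} esc (epair enat (elist eitem))
    (\<lambda>z. scal (fst (snd z)) (fst (snd (snd z))) (fst (snd (snd (snd z)))) (snd (snd (snd (snd z)))))"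
proof -
  have "pbound (\<lambda>s. 128 * (2 * (s + 1)) ^ 4 + s + 10)" by (rule pbound_intros)+
  then obtain k where k: "\<And>s :: nat. 128 * (2 * (s + 1)) ^ 4 + s + 10 \<le> (s + 2) ^ k" by (auto simp: pbound_def)
  let ?bd = "\<lambda>z :: nat \<times> nat \<times> nat \<times> nat \<times> item list. fst z + fst (snd z) + fst (snd (snd z)) * 2 ^ fst (snd (snd (snd z))) +
     fst (snd (snd (snd z))) + size (elist eitem (snd (snd (snd (snd z))))) + 10"
  let ?b = "\<lambda>z. fst (snd (snd (snd z))) = 0 \<or> fits (fst (snd z)) (snd (snd (snd (snd z))))"
  let ?l = "\<lambda>z. (fst z, fst (snd z), 2 * fst (snd (snd z)), fst (snd (snd (snd z))) - 1, halve (snd (snd (snd (snd z)))))"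
  let ?s = "\<lambda>z. scal (fst (snd z)) (fst (snd (snd z))) (fst (snd (snd (snd z)))) (snd (snd (snd (snd z))))"
  show ?thesis
  proof (rule polytime_rec1[where D = UNIV and kk = k and b = ?b and g = "\<lambda>z. (fst (snd (snd z)), snd (snd (snd (snd z))))"
        and lf = ?l and h = "\<lambda>z r. r" and cnt = "\<lambda>z. fst (snd (snd (snd z)))" and bd = ?bd])
    fix z :: "nat \<times> nat \<times> nat \<times> nat \<times> item list"
    obtain p M q f ls where z: "z = (p, M, q, f, ls)" by (cases z)
    show "?s z = (if ?b z then (fst (snd (snd z)), snd (snd (snd (snd z)))) else ?s (?l z))"
      by (cases f) (auto simp: z)
    show "?l z \<in> UNIV \<and> ?bd (?l z) \<le> ?bd z \<and> fst (snd (snd (snd (?l z)))) < fst (snd (snd (snd z)))" if "\<not> ?b z"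
      using that size_halve[of ls] by (cases f) (auto simp: z)
    define Q where "Q = q * 2 ^ f"
    have "q \<le> Q" by (simp add: Q_def)
    moreover have "fst (scal M q f ls) \<le> Q" unfolding Q_def by (rule scal_le)
    ultimately show "size (esc z) \<le> ?bd z \<and> size (epair enat (elist eitem) (?s z)) \<le> ?bd z \<and> fst (snd (snd (snd z))) < ?bd z"
      using size_scal[of M q f ls] by (simp add: z Q_def[symmetric])
  next
    fix z :: "nat \<times> nat \<times> nat \<times> nat \<times> item list"
    obtain p M q f ls where z: "z = (p, M, q, f, ls)" by (cases z)
    assume "z \<in> {z. fst (snd (snd z)) * 2 ^ fst (snd (snd (snd z))) \<le> 128 * (2 * (fst z + 1)) ^ 4}"
    then have "q * 2 ^ f \<le> 128 * (2 * (p + 1)) ^ 4" by (simp add: z)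
    also have "\<dots> \<le> 128 * (2 * (size (esc z) + 1)) ^ 4" by (intro mult_left_mono power_mono) (auto simp: z)
    finally have "?bd z \<le> 128 * (2 * (size (esc z) + 1)) ^ 4 + size (esc z) + 10" by (simp add: z)
    then show "?bd z \<le> (size (esc z) + 2) ^ k" using k[of "size (esc z)"] by linarith
  qed (rule polytime_fits polytime_halve polytime_rules | force)+
qed

lemma polytime_scal:
  assumes "polytime D e enat p" "polytime D e enat M" "polytime D e enat f" "polytime D e (elist eitem) ls"
    "\<And>u. u \<in> D \<Longrightarrow> 2 ^ f u \<le> 128 * (2 * (p u + 1)) ^ 4"
  shows "polytime D e (epair enat (elist eitem)) (\<lambda>u. scal (M u) 1 (f u) (ls u))"
proof -
  have "polytime D e esc (\<lambda>u. (p u, M u, 1, f u, ls u))" by (intro polytime_Pair polytime_const assms)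
  from polytime_op1_on[OF polytime_scal0 this] show ?thesis using assms(5) by simp
qed

text \<open>\<open>p\<close> supplies the padding for \<open>scal\<close>; it is instantiated by the
  number of input pairs.\<close>

lemma polytime_gform:
  assumes p: "polytime D e enat p" and M: "polytime D e enat M" and f: "polytime D e enat f" and ls: "polytime D e (elist eitem) ls"
    and pb: "\<And>u. u \<in> D \<Longrightarrow> 2 ^ f u \<le> 128 * (2 * (p u + 1)) ^ 4" and ne: "\<And>u. u \<in> D \<Longrightarrow> ls u \<noteq> []"
  shows "polytime D e efm (\<lambda>u. gform (M u) (f u) (ls u))" "polytime D e efm (\<lambda>u. pform (M u) (f u) (ls u))"
    "polytime D e enat (\<lambda>u. wform (M u) (f u) (ls u))"
proof -
  let ?s = "\<lambda>u. snd (scal (M u) 1 (f u) (ls u))"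
  note sc = polytime_scal[OF p M f ls pb]
  have ne': "?s u \<noteq> []" if "u \<in> D" for u using ne[OF that] length_scal[of "M u" 1 "f u" "ls u"] by auto
  have ne2: "altl (?s u) \<noteq> []" "insall b (map snd (?s u)) \<noteq> []" if "u \<in> D" for u b using ne'[OF that] by auto
  have t: "polytime D e (elist eelt) (\<lambda>u. altl (?s u))" by (rule polytime_altl polytime_snd sc)+
  show "polytime D e efm (\<lambda>u. gform (M u) (f u) (ls u))"
    unfolding gform_def Let_def
  proof (rule polytime_op1_on[OF polytime_build0])
    show "polytime D e est (\<lambda>u. (False, tl (hl (M u)), [(Lf (fst (hd (altl (?s u)))), snd (hd (altl (?s u))))], tl (altl (?s u))))"
      by (rule M t polytime_hl polytime_hd[of D e eelt] polytime_fst[of D e enat enat] polytime_snd[of D e enat enat] polytime_fm_rules | use ne2 in simp)+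
  qed auto
  have i: "polytime D e (elist eent) (\<lambda>u. insall True (map snd (?s u)))"
    apply (rule polytime_insall)
     apply (rule polytime_const)
    apply (rule polytime_map)
     apply (rule polytime_snd)
     apply (rule sc)
     apply assumption
    apply (rule polytime_snd)
    apply (rule polytime_snd)
    apply (rule polytime_id)
    done
  show "polytime D e efm (\<lambda>u. pform (M u) (f u) (ls u))"
    unfolding pform_def Let_def
    by (rule polytime_chn polytime_const polytime_fst[of D e efm enat] polytime_tl polytime_hd i | use ne2 in simp)+
  show "polytime D e enat (\<lambda>u. wform (M u) (f u) (ls u))"
    unfolding wform_def 
    apply (rule polytime_mult)
     apply (rule polytime_fst)
     apply (rule sc)
     apply assumption
    apply (rule M)
    done
qed

lemma pow_pad: "g \<le> 4 * lg n + 7 \<Longrightarrow> 2 ^ g \<le> 128 * (2 * (n + 1)) ^ 4"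
proof -
  assume "g \<le> 4 * lg n + 7"
  then have "(2::nat) ^ g \<le> 2 ^ (4 * lg n + 7)" by (intro power_increasing) auto
  also have "\<dots> = 128 * (2 ^ lg n) ^ 4" by (simp add: power_add power_mult[symmetric] mult.commute)
  also have "\<dots> \<le> 128 * (2 * (n + 1)) ^ 4" by (intro mult_left_mono power_mono pow_lg) auto
  finally show ?thesis .
qed

lemma polytime_xM: "polytime D e eal f \<Longrightarrow> polytime D e enat (\<lambda>u. 2 ^ xexp (length (f u)))"
  unfolding xexp_def by (rule polytime_pow_lg[of _ _ "\<lambda>u. length (f u)"] polytime_rules polytime_lg | assumption | simp)+

lemma polytime_yM: "polytime D e eal f \<Longrightarrow> polytime D e enat (\<lambda>u. 2 ^ yexp (length (f u)))"
proof -
  assume f: "polytime D e eal f"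
  have "2 * lam n + 7 \<le> 4 * lg n + 7" for n using lam_le[of n] by simp
  then show ?thesis unfolding yexp_def
    by (intro polytime_pow_lg[of _ _ "\<lambda>u. length (f u)"] polytime_add polytime_mult polytime_lam polytime_length[OF f] polytime_const) auto
qed

lemma xit_nonempty: "xit al b \<noteq> []"
  using low_pos[of b] by (simp add: xit_def)

lemma polytime_gx0: "polytime UNIV (epair eal enat) efm (\<lambda>z. gx (fst z) (snd z))"
  "polytime UNIV (epair eal enat) efm (\<lambda>z. px (fst z) (snd z))"
  "polytime UNIV (epair eal enat) enat (\<lambda>z. wx (fst z) (snd z))"
  unfolding gx_def px_def wx_def
  by (rule polytime_gform[where p = "\<lambda>z. length (fst z)"], (rule polytime_xM polytime_xit polytime_lg polytime_rules pow_pad xit_nonempty | simp)+)+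

lemmas polytime_gx = polytime_gx0[THEN polytime_op2]

section \<open>Layout of the circuit as data\<close>

lemma gates_le: "gates F \<le> size (efm F)"
  by (induction F) auto

lemma polytime_gates0: "polytime UNIV efm enat gates"
proof (rule polytime_rec2[where D = UNIV and kk = 1 and b = isLf and g = "\<lambda>_. 0" and lf = lop and rt = rop
      and h = "\<lambda>z r r'. r + r' + 1" and cnt = "\<lambda>F. size (efm F)" and bd = "\<lambda>F. size (efm F)"])
  fix F
  show "gates F = (if isLf F then 0 else gates (lop F) + gates (rop F) + 1)" by (cases F) auto
  show "lop F \<in> UNIV \<and> size (efm (lop F)) \<le> size (efm F) \<and> rop F \<in> UNIV \<and> size (efm (rop F)) \<le> size (efm F) \<and>
     size (efm (lop F)) + size (efm (rop F)) < size (efm F)" if "\<not> isLf F" using that by (cases F) auto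
  show "size (efm F) \<le> size (efm F) \<and> size (enat (gates F)) \<le> size (efm F) \<and> 0 < size (efm F) \<and> size (efm F) \<le> size (efm F)"
    using gates_le[of F] by (cases F) auto
qed (rule polytime_fm_rules | simp)+

lemmas polytime_gates = polytime_op1[OF polytime_gates0]

lemma root_alt: "root k F = (if isLf F then leafv F else k + gates (lop F) + gates (rop F))"
  by (cases F) auto

lemma polytime_root0: "polytime UNIV (epair enat efm) enat (\<lambda>z. root (fst z) (snd z))"
  unfolding root_alt by (rule polytime_gates polytime_fm_rules | simp)+

lemmas polytime_root = polytime_op2[OF polytime_root0]

lemma polytime_AndGate: "polytime D e enat f \<Longrightarrow> polytime D e enat g \<Longrightarrow> polytime D e enc_node (\<lambda>u. AndGate (f u) (g u))"
proof -
  assume f: "polytime D e enat f" and g: "polytime D e enat g"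
  have "polytime D e (epair enc_nat (epair enc_nat enc_nat)) (\<lambda>u. (3, (f u, g u)))"
    by (intro polytime_Pair polytime_const polytime_bin f g)
  then show ?thesis by (rule polytime_cong) auto
qed

lemma polytime_OrGate: "polytime D e enat f \<Longrightarrow> polytime D e enat g \<Longrightarrow> polytime D e enc_node (\<lambda>u. OrGate (f u) (g u))"
proof -
  assume f: "polytime D e enat f" and g: "polytime D e enat g"
  have "polytime D e (epair enc_nat (epair enc_nat enc_nat)) (\<lambda>u. (4, (f u, g u)))"
    by (intro polytime_Pair polytime_const polytime_bin f g)
  then show ?thesis by (rule polytime_cong) auto
qed

lemma polytime_Input: "polytime D e enat f \<Longrightarrow> polytime D e enc_node (\<lambda>u. Input (P (f u)))"
  "polytime D e enat f \<Longrightarrow> polytime D e enc_node (\<lambda>u. Input (G (f u)))"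
proof -
  assume f: "polytime D e enat f"
  have 0: "polytime D e (epair enc_nat enc_nat) (\<lambda>u. (0, f u))" by (intro polytime_Pair polytime_const polytime_bin f)
  have 1: "polytime D e (epair enc_nat enc_nat) (\<lambda>u. (1, f u))" by (intro polytime_Pair polytime_const polytime_bin f)
  show "polytime D e enc_node (\<lambda>u. Input (P (f u)))" by (rule polytime_cong[OF 0]) auto
  show "polytime D e enc_node (\<lambda>u. Input (G (f u)))" by (rule polytime_cong[OF 1]) auto
qed

lemma gate_alt: "gate b u v = (if b then AndGate u v else OrGate u v)"
  by (cases b) auto

lemma polytime_gate0: "polytime UNIV (epair enc_bool (epair enat enat)) enc_node (\<lambda>z. gate (fst z) (fst (snd z)) (snd (snd z)))"
  unfolding gate_alt by (rule polytime_AndGate polytime_OrGate polytime_rules)+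

lemmas polytime_gate = polytime_op3[OF polytime_gate0]

lemma size_gate: "size (enc_node (gate b u v)) \<le> 2 * u + 2 * v + 6"
  using size_enc_nat[of u] size_enc_nat[of v] by (cases b) (auto simp: enc_nat.simps)

lemma root_le: "root k F \<le> k + size (efm F)"
  using gates_le[of F] by (cases F) auto

lemma flat_size: "x \<in> set (flat k F) \<Longrightarrow> size (enc_node x) \<le> 4 * (k + size (efm F)) + 6"
proof (induction F arbitrary: k)
  case (Op b A B)
  have g: "gates A \<le> size (efm A)" by (rule gates_le)
  have r: "root k A \<le> k + size (efm A)" "root (k + gates A) B \<le> k + gates A + size (efm B)" by (rule root_le)+
  consider "x \<in> set (flat k A)" | "x \<in> set (flat (k + gates A) B)" | "x = gate b (root k A) (root (k + gates A) B)"
    using Op.prems by auto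
  then show ?case
  proof cases
    case 1 then show ?thesis using Op.IH(1) by fastforce
  next
    case 2 then show ?thesis using Op.IH(2)[OF 2] g by simp
  next
    case 3 then show ?thesis using size_gate[of b "root k A" "root (k + gates A) B"] r g by simp
  qed
qed simp

text \<open>The first vertex grows along the recursion, but its sum with the size of the remaining
  formula does not. That sum bounds both the number of nodes and, up to a factor, the code of a
  node, so \<open>bd\<close> is quadratic in it.\<close>

lemma polytime_flat0: "polytime UNIV (epair enat efm) (elist enc_node) (\<lambda>z. flat (fst z) (snd z))"
proof -
  let ?s = "\<lambda>z. fst z + size (efm (snd z))"
  let ?bd = "\<lambda>z. ?s z * (4 * ?s z + 7) + ?s z + 1"
  have mono: "a \<le> b \<Longrightarrow> a * (4 * a + 7) + a + 1 \<le> b * (4 * b + 7) + b + (1::nat)" for a b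
    by (intro add_mono mult_mono) auto
  have "pbound (\<lambda>s. s * (4 * s + 7) + s + 1)" by (rule pbound_intros)+
  then obtain k where k: "\<And>s :: nat. s * (4 * s + 7) + s + 1 \<le> (s + 2) ^ k" by (auto simp: pbound_def)
  show ?thesis
  proof (rule polytime_rec2[where D = UNIV and kk = k and b = "\<lambda>z. isLf (snd z)" and g = "\<lambda>_. []"
        and lf = "\<lambda>z. (fst z, lop (snd z))" and rt = "\<lambda>z. (fst z + gates (lop (snd z)), rop (snd z))"
        and h = "\<lambda>z r r'. r @ r' @ [gate (opof (snd z)) (root (fst z) (lop (snd z))) (root (fst z + gates (lop (snd z))) (rop (snd z)))]"
        and cnt = "\<lambda>z. size (efm (snd z))" and bd = ?bd])
    fix z :: "nat \<times> fm"
    obtain m F where z: "z = (m, F)" by (cases z)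
    show "flat (fst z) (snd z) = (if isLf (snd z) then [] else flat (fst (fst z, lop (snd z))) (snd (fst z, lop (snd z))) @
      flat (fst (fst z + gates (lop (snd z)), rop (snd z))) (snd (fst z + gates (lop (snd z)), rop (snd z))) @
      [gate (opof (snd z)) (root (fst z) (lop (snd z))) (root (fst z + gates (lop (snd z))) (rop (snd z)))])"
      by (cases F) (auto simp: z)
    show "(fst z, lop (snd z)) \<in> UNIV \<and> ?bd (fst z, lop (snd z)) \<le> ?bd z \<and>
      (fst z + gates (lop (snd z)), rop (snd z)) \<in> UNIV \<and> ?bd (fst z + gates (lop (snd z)), rop (snd z)) \<le> ?bd z \<and>
      size (efm (snd (fst z, lop (snd z)))) + size (efm (snd (fst z + gates (lop (snd z)), rop (snd z)))) < size (efm (snd z))"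
      if "\<not> isLf (snd z)"
    proof (intro conjI mono)
      show "?s (fst z, lop (snd z)) \<le> ?s z" using that by (cases F) (auto simp: z)
      show "?s (fst z + gates (lop (snd z)), rop (snd z)) \<le> ?s z"
        using that gates_le[of "lop F"] by (cases F) (auto simp: z)
      show "size (efm (snd (fst z, lop (snd z)))) + size (efm (snd (fst z + gates (lop (snd z)), rop (snd z)))) < size (efm (snd z))"
        using that by (cases F) (auto simp: z)
    qed auto
    have "size (elist enc_node (flat m F)) \<le> length (flat m F) * (4 * (m + size (efm F)) + 6 + 1)"
      by (rule elist_upper) (rule flat_size)
    also have "\<dots> \<le> (m + size (efm F)) * (4 * (m + size (efm F)) + 7)"
      using gates_le[of F] by (intro mult_mono) auto
    finally show "size (epair enat efm z) \<le> ?bd z \<and> size (elist enc_node (flat (fst z) (snd z))) \<le> ?bd z \<and>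
      0 < size (efm (snd z)) \<and> size (efm (snd z)) \<le> ?bd z"
      by (cases F) (auto simp: z)
  next
    fix z :: "nat \<times> fm"
    have "?bd z \<le> size (epair enat efm z) * (4 * size (epair enat efm z) + 7) + size (epair enat efm z) + 1" by (rule mono) simp
    then show "?bd z \<le> (size (epair enat efm z) + 2) ^ k" using k[of "size (epair enat efm z)"] by linarith
  qed (rule polytime_gate polytime_root polytime_gates polytime_fm_rules | simp)+
qed

lemma flats_size: "x \<in> set (flats k Fs) \<Longrightarrow> size (enc_node x) \<le> 4 * (k + size (elist efm Fs)) + 6"
proof (induction Fs arbitrary: k)
  case (Cons F Fs)
  consider "x \<in> set (flat k F)" | "x \<in> set (flats (k + gates F) Fs)" using Cons.prems by auto
  then show ?case
  proof cases
    case 1 then show ?thesis using flat_size[OF 1] by simp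
  next
    case 2 then show ?thesis using Cons.IH[OF 2] gates_le[of F] by simp
  qed
qed simp

lemma roots_le: "x \<in> set (roots k Fs) \<Longrightarrow> x \<le> k + size (elist efm Fs)"
proof (induction Fs arbitrary: k)
  case (Cons F Fs)
  have "gates F \<le> size (efm F)" "root k F \<le> k + size (efm F)" by (rule gates_le root_le)+
  then show ?case using Cons.prems Cons.IH[of "k + gates F"] by auto
qed simp

lemma size_fms_le: "size_fms Fs \<le> size (elist efm Fs)"
proof (induction Fs)
  case (Cons F Fs) then show ?case using gates_le[of F] by simp
qed simp

lemma polytime_size_fms: "polytime D e (elist efm) f \<Longrightarrow> polytime D e enat (\<lambda>u. size_fms (f u))"
  unfolding size_fms_def by (rule polytime_gates polytime_rules | assumption)+

text \<open>Common to \<open>flats\<close> and \<open>roots\<close>, which differ only in the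
  contribution \<open>v\<close> of a single formula.\<close>

lemma polytime_flats_gen:
  fixes w :: "nat \<Rightarrow> fm list \<Rightarrow> 'a list"
  assumes Nil: "\<And>k. w k [] = []" and Cons: "\<And>k F Fs. w k (F # Fs) = v k F @ w (k + gates F) Fs"
    and v: "polytime UNIV (epair enat efm) (elist e') (\<lambda>z. v (fst z) (snd z))"
    and sz: "\<And>k Fs x. x \<in> set (w k Fs) \<Longrightarrow> size (e' x) \<le> 4 * (k + size (elist efm Fs)) + 6"
    and len: "\<And>k Fs. length (w k Fs) \<le> size (elist efm Fs)"
  shows "polytime UNIV (epair enat (elist efm)) (elist e') (\<lambda>z. w (fst z) (snd z))"
proof -
  let ?s = "\<lambda>z. fst z + size (elist efm (snd z))"
  let ?bd = "\<lambda>z. ?s z * (4 * ?s z + 7) + ?s z + 1"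
  have mono: "a \<le> b \<Longrightarrow> a * (4 * a + 7) + a + 1 \<le> b * (4 * b + 7) + b + (1::nat)" for a b
    by (intro add_mono mult_mono) auto
  have "pbound (\<lambda>s. s * (4 * s + 7) + s + 1)" by (rule pbound_intros)+
  then obtain k where k: "\<And>s :: nat. s * (4 * s + 7) + s + 1 \<le> (s + 2) ^ k" by (auto simp: pbound_def)
  show ?thesis
  proof (rule polytime_rec1[where D = UNIV and kk = k and b = "\<lambda>z. snd z = []" and g = "\<lambda>z. []"
        and lf = "\<lambda>z. (fst z + gates (hd (snd z)), tl (snd z))" and h = "\<lambda>z r. v (fst z) (hd (snd z)) @ r"
        and cnt = "\<lambda>z. length (snd z)" and bd = ?bd])
    fix z :: "nat \<times> fm list"
    obtain m Fs where z: "z = (m, Fs)" by (cases z)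
    show "w (fst z) (snd z) = (if snd z = [] then [] else v (fst z) (hd (snd z)) @
        w (fst (fst z + gates (hd (snd z)), tl (snd z))) (snd (fst z + gates (hd (snd z)), tl (snd z))))"
      by (cases Fs) (auto simp: z Nil Cons)
    show "(fst z + gates (hd (snd z)), tl (snd z)) \<in> UNIV \<and>
      ?bd (fst z + gates (hd (snd z)), tl (snd z)) \<le> ?bd z \<and>
      length (snd (fst z + gates (hd (snd z)), tl (snd z))) < length (snd z)" if "snd z \<noteq> []"
    proof (intro conjI mono)
      show "?s (fst z + gates (hd (snd z)), tl (snd z)) \<le> ?s z"
        using that gates_le[of "hd Fs"] by (cases Fs) (auto simp: z)
      show "length (snd (fst z + gates (hd (snd z)), tl (snd z))) < length (snd z)"
        using that by (cases Fs) (auto simp: z)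
    qed auto
    have "size (elist e' (w m Fs)) \<le> length (w m Fs) * (4 * (m + size (elist efm Fs)) + 6 + 1)"
      by (rule elist_upper) (rule sz)
    also have "\<dots> \<le> (m + size (elist efm Fs)) * (4 * (m + size (elist efm Fs)) + 7)"
      using len[of m Fs] by (intro mult_mono) auto
    finally show "size (epair enat (elist efm) z) \<le> ?bd z \<and> size (elist e' (w (fst z) (snd z))) \<le> ?bd z \<and>
      length (snd z) < ?bd z"
      using elist_length[of Fs efm] by (auto simp: z)
  next
    fix z :: "nat \<times> fm list"
    have "?bd z \<le> size (epair enat (elist efm) z) * (4 * size (epair enat (elist efm) z) + 7) + size (epair enat (elist efm) z) + 1"
      by (rule mono) simp
    then show "?bd z \<le> (size (epair enat (elist efm) z) + 2) ^ k" using k[of "size (epair enat (elist efm) z)"] by linarith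
  qed (rule polytime_op2[OF v] polytime_gates polytime_fm_rules | simp)+
qed

lemma polytime_flats0: "polytime UNIV (epair enat (elist efm)) (elist enc_node) (\<lambda>z. flats (fst z) (snd z))"
  by (rule polytime_flats_gen[where v = flat], (rule flats.simps polytime_flat0 flats_size | assumption | simp add: size_fms_le)+)

lemmas polytime_flats = polytime_op2[OF polytime_flats0]

lemma polytime_roots0: "polytime UNIV (epair enat (elist efm)) (elist enat) (\<lambda>z. roots (fst z) (snd z))"
proof (rule polytime_flats_gen[where v = "\<lambda>k F. [root k F]"])
  show "polytime UNIV (epair enat efm) (elist enat) (\<lambda>z. [root (fst z) (snd z)])" by (rule polytime_root polytime_rules)+
  show "size (enat x) \<le> 4 * (k + size (elist efm Fs)) + 6" if "x \<in> set (roots k Fs)" for k Fs x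
    using roots_le[OF that] by simp
qed (auto intro: elist_length)

lemmas polytime_roots = polytime_op2[OF polytime_roots0]

text \<open>The domain limits the step number, which keeps \<open>2 ^ t\<close> inside
  \<open>before\<close> polynomial.\<close>

lemma polytime_layer0: "polytime {z. snd z < lam (length (fst z))} (epair eal enat) (elist enc_node)
    (\<lambda>z. layer (length (fst z)) (bs (length (fst z))) (snd z))"
proof -
  have "t < lam n \<Longrightarrow> t \<le> 4 * lg n + 7" for t n using lam_le[of n] by linarith
  note t = this
  show ?thesis unfolding layer_def before_def
    by (rule polytime_AndGate polytime_OrGate polytime_bs polytime_pow_lg[where f = "\<lambda>z. length (fst (fst z))"] polytime_rules | use t in force)+
qed

lemma layers_alt: "layers n L m = map (\<lambda>i. Input (P i)) [0..<n] @ map (\<lambda>i. Input (G i)) [0..<n] @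
     concat (map (\<lambda>t. layer n L t) [0..<m])"
  by (simp add: layers_def)

lemma polytime_layers: "polytime UNIV eal (elist enc_node) (\<lambda>al. layers (length al) (bs (length al)) (lam (length al)))"
proof -
  let ?D = "{z. fst z \<in> UNIV \<and> snd z \<in> set [0..<lam (length (fst z))]}"
  have "polytime ?D (epair eal enat) (elist enc_node) (\<lambda>z. layer (length (fst z)) (bs (length (fst z))) (snd z))"
    by (rule polytime_subset[OF polytime_layer0]) auto
  note l = polytime_map[OF polytime_upt[OF polytime_lam[OF polytime_length[OF polytime_id]]] this]
  show ?thesis unfolding layers_alt
    by (rule polytime_append polytime_concat l polytime_Input polytime_map polytime_upt polytime_length polytime_snd polytime_id)+
qed

lemma polytime_fsX: "polytime D e eal f \<Longrightarrow> polytime D e (elist efm) (\<lambda>u. fsX (f u))"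
proof (rule polytime_op1[where F = fsX])
  have eq: "fsX = (\<lambda>al. map (\<lambda>b. gx al b) [1..<nb (length al) + 1] @ map (\<lambda>b. px al b) [1..<nb (length al) + 1])"
    by (simp add: fsX_def fun_eq_iff)
  show "polytime UNIV eal (elist efm) fsX" unfolding eq by (rule polytime_append polytime_map polytime_gx polytime_nb polytime_upt1 polytime_length polytime_fst polytime_snd polytime_id)+
qed

lemma polytime_k0: "polytime D e eal f \<Longrightarrow> polytime D e enat (\<lambda>u. k0 (f u))"
  unfolding k0_def by (rule polytime_lam polytime_rules | assumption)+

lemma polytime_k1: "polytime D e eal f \<Longrightarrow> polytime D e enat (\<lambda>u. k1 (f u))"
  unfolding k1_def by (rule polytime_k0 polytime_size_fms polytime_fsX polytime_add | assumption)+

lemma polytime_rX: "polytime D e eal f \<Longrightarrow> polytime D e (elist enat) (\<lambda>u. rX (f u))"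
  unfolding rX_def by (rule polytime_k0 polytime_roots polytime_fsX | assumption)+

lemma polytime_yit0: "polytime UNIV (epair eal enat) (elist eitem) (\<lambda>z. yit (fst z) (snd z))"
  unfolding yit_def by (rule polytime_geta polytime_rX polytime_gx polytime_nb polytime_chain polytime_rules)+

lemmas polytime_yit = polytime_op2[OF polytime_yit0]

lemma chain_nonempty: "0 < b \<Longrightarrow> chain b \<noteq> []"
proof (induction b rule: less_induct)
  case (less b)
  then show ?case by (subst chain.simps) (auto elim!: evenE)
qed

lemma yit_nonempty: "0 < b \<Longrightarrow> yit al b \<noteq> []"
  by (simp add: yit_def chain_nonempty)

lemma polytime_gy0: "polytime {z. 0 < snd z} (epair eal enat) efm (\<lambda>z. gy (fst z) (snd z))"
  unfolding gy_def
  by (rule polytime_gform[where p = "\<lambda>z. length (fst z)"], (rule polytime_yM polytime_yit polytime_lg polytime_rules pow_pad yit_nonempty | simp)+)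

lemma polytime_fsY: "polytime D e eal f \<Longrightarrow> polytime D e (elist efm) (\<lambda>u. fsY (f u))"
proof (rule polytime_op1[where F = fsY])
  have eq: "fsY = (\<lambda>al. map (\<lambda>b. gy al b) [1..<nb (length al) + 1])"
    by (simp add: fsY_def fun_eq_iff)
  let ?D = "{z. fst z \<in> UNIV \<and> snd z \<in> set [1..<nb (length (fst z)) + 1]}"
  have "polytime ?D (epair eal enat) efm (\<lambda>z. gy (fst z) (snd z))" by (rule polytime_subset[OF polytime_gy0]) auto
  from polytime_map[OF polytime_upt1[OF polytime_nb[OF polytime_length[OF polytime_id]]] this]
  show "polytime UNIV eal (elist efm) fsY" unfolding eq .
qed

lemma polytime_k2: "polytime D e eal f \<Longrightarrow> polytime D e enat (\<lambda>u. k2 (f u))"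
  unfolding k2_def by (rule polytime_k1 polytime_size_fms polytime_fsY polytime_add | assumption)+

lemma polytime_rY: "polytime D e eal f \<Longrightarrow> polytime D e (elist enat) (\<lambda>u. rY (f u))"
  unfolding rY_def by (rule polytime_k1 polytime_roots polytime_fsY | assumption)+

lemma polytime_zf0: "polytime UNIV (epair eal enat) efm (\<lambda>z. zf (fst z) (snd z))"
  unfolding zf_def Let_def by (rule polytime_geta polytime_rY polytime_bs polytime_garr polytime_parr polytime_fm_rules)+

lemma polytime_fsZ: "polytime D e eal f \<Longrightarrow> polytime D e (elist efm) (\<lambda>u. fsZ (f u))"
proof (rule polytime_op1[where F = fsZ])
  have eq: "fsZ = (\<lambda>al. map (\<lambda>b. zf al b) [0..<length al])" by (simp add: fsZ_def fun_eq_iff)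
  show "polytime UNIV eal (elist efm) fsZ" unfolding eq by (rule polytime_op2[OF polytime_zf0] polytime_rules)+
qed

lemma polytime_circ: "polytime UNIV eal enc_circuit circ"
proof -
  \<comment> \<open>The mapped identity is not idle: it converts the output vertices from unary to
    binary.\<close>
  have "polytime UNIV eal (elist enc_nat) (\<lambda>al. map (\<lambda>i. i) (roots (k2 al) (fsZ al)))"
    by (rule polytime_bin polytime_map polytime_roots polytime_k2 polytime_fsZ polytime_snd polytime_id)+
  then have o: "polytime UNIV eal (elist enc_nat) (\<lambda>al. outputs (circ al))" by (simp add: circ_def)
  have "polytime UNIV eal (elist enc_node) (\<lambda>al. nodes (circ al))"
    unfolding circ_def circuit.sel
    by (rule polytime_append polytime_layers polytime_flats polytime_k0 polytime_k1 polytime_k2 polytime_fsX polytime_fsY polytime_fsZ polytime_id)+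
  from polytime_Pair[OF this o] show ?thesis
    by (rule polytime_cong) (auto simp: enc_circuit_def elist_def)
qed

text \<open>The main function must have number 0, so a mere call of the computed function is put in
  front of the program; it takes four extra steps, whence the constant in the polynomial.\<close>

lemma polytime_constructible:
  assumes f: "polytime D e e' f" and R: "\<And>x. x \<in> D \<Longrightarrow> R x (f x)"
  shows "constructible_in_poly_time D e e' R"
proof -
  obtain Q i k where Q: "computes Q i k (graph D e e' f)" using f by (auto simp: polytime_def ptime_def)
  define A where "A = [Call (Suc i) [Var 0]]"
  have "computes (A @ map (shift (length A)) Q) (length A + i) k (graph D e e' f)"
    by (rule computes_shift[OF Q])
  then obtain B where B: "computes (Call (Suc i) [Var 0] # B) (Suc i) k (graph D e e' f)" by (auto simp: A_def)
  let ?Q = "Call (Suc i) [Var 0] # B"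
  let ?q = "[:2, 1:] ^ k + [:4:] :: nat poly"
  have "R x (f x) \<and> (\<exists>t. eval ?Q [e x] (Call 0 [Var 0]) (e' (f x)) t \<and> t + size (e' (f x)) \<le> poly ?q (size (e x)))"
    if x: "x \<in> D" for x
  proof -
    have "graph D e e' f (e x) (e' (f x))" using x by (auto simp: graph_def)
    then obtain t where t: "eval ?Q [e x] (Call (Suc i) [Var 0]) (e' (f x)) t" "t + size (e' (f x)) \<le> (size (e x) + 2) ^ k"
      using B unfolding computes_def by blast
    have "evals ?Q [e x] [Var 0] [e x] (1 + 1 + 1)"
      using eval_Var[of 0 "[e x]" ?Q] by (intro evals_Cons evals_Nil) simp
    from eval_Call[OF this, of 0 "e' (f x)" t] t(1)
    have "eval ?Q [e x] (Call 0 [Var 0]) (e' (f x)) (1 + 1 + 1 + t + 1)" by simp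
    moreover have "1 + 1 + 1 + t + 1 + size (e' (f x)) \<le> poly ?q (size (e x))"
      using t(2) by (simp add: poly_power add.commute)
    ultimately show ?thesis using R[OF x] by blast
  qed
  then show ?thesis unfolding constructible_in_poly_time_def by blast
qed

theorem theorem5p10:
  "constructible_in_poly_time {(n :: nat, a :: signal \<Rightarrow> nat). n \<ge> 3} enc_instance enc_circuit
     (\<lambda>(n, a) C.
        let W = (\<Sum>i = 0..n - 1. (2::real) ^ a (P i) + 2 ^ a (G i));
            d1 = (if n \<le> 2 ^ 21 then 8.461 else 9.067);
            d2 = (if n \<le> 2 ^ 21 then 6.2 else 4.442)
        in adder_circuit n C \<and>
           real (delay C a) \<le> log 2 W + 3 * log 2 (log 2 (real n))
             + 3 * log 2 (log 2 (log 2 (real n))) + d1 \<and>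
           real (circuit_size C) \<le> d2 * real n * log 2 (real n))"
proof (rule polytime_constructible[where f = "\<lambda>(n, a). circ (arrivals n a)"])
  let ?D = "{(n :: nat, a :: signal \<Rightarrow> nat). n \<ge> 3}"
  \<comment> \<open>An instance and its list of arrival times have literally the same code, so the
    identity program does this conversion.\<close>
  have "polytime ?D enc_instance eal (\<lambda>(n, a). arrivals n a)"
    by (rule polytime_cong[OF polytime_id]) (auto simp: elist_def arrivals_def)
  from polytime_op1[OF polytime_circ this]
  show "polytime ?D enc_instance enc_circuit (\<lambda>(n, a). circ (arrivals n a))" by (simp add: case_prod_beta')
next
  fix x :: "nat \<times> (signal \<Rightarrow> nat)" assume "x \<in> {(n, a). n \<ge> 3}"
  then obtain n a where x: "x = (n, a)" "3 \<le> n" by auto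
  have W: "{0..n - Suc 0} = {..<n}" using x(2) by auto
  show "(case x of (n, a) \<Rightarrow> \<lambda>C.
        let W = (\<Sum>i = 0..n - 1. (2::real) ^ a (P i) + 2 ^ a (G i));
            d1 = (if n \<le> 2 ^ 21 then 8.461 else 9.067);
            d2 = (if n \<le> 2 ^ 21 then 6.2 else 4.442)
        in adder_circuit n C \<and>
           real (delay C a) \<le> log 2 W + 3 * log 2 (log 2 (real n))
             + 3 * log 2 (log 2 (log 2 (real n))) + d1 \<and>
           real (circuit_size C) \<le> d2 * real n * log 2 (real n)) (case x of (n, a) \<Rightarrow> circ (arrivals n a))"
    using circ_adder[OF x(2), of a] circ_delay[OF x(2), of a] circ_size_log[OF x(2), of a]
    unfolding x(1) Let_def by (auto simp: W split: if_splits)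
qed

end
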